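(* Let $M$ be a five-dimensional Riemannian spin manifold with metric $g$, let $H$ be a $3$-form, $\phi$ a function, $\epsilon$ a nowhere-vanishing spinor field, $A$ a metric connection with curvature $F^A$ on a vector bundle $E$ over $M$, $\nabla$ a metric connection on $TM$ with curvature $R$, and $\alpha'>0$ a constant. Suppose that the heterotic Killing spinor equations $$\nabla^+\epsilon=0,\qquad \Big(\Gamma^m\partial_m\phi-\tfrac1{12}H_{mnp}\Gamma^{mnp}\Big)\epsilon=0,\qquad F^A_{mn}\Gamma^{mn}\epsilon=0$$ and the anomaly cancellation condition $$dH=\frac{\alpha'}4\Big(Tr(R\wedge R)-Tr(F^A\wedge F^A)\Big)$$ hold. Let $\psi$ and $F$ be the endomorphism and the fundamental $2$-form of the almost contact metric structure determined by $\epsilon$. Then the Einstein equation of motion $$Ric^g_{ij}-\frac14H_{imn}H_j{}^{mn}+2\nabla^g_i\nabla^g_j\phi-\frac{\alpha'}4\Big[(F^A)_{imns}(F^A)_j{}^{mns}-R_{imns}R_j{}^{mns}\Big]=0$$ holds if and only if $$\frac12\Big[R_{msij}R_{trij}+R_{mtij}R_{rsij}+R_{mrij}R_{stij}\Big]F^{tr}\psi^s_n=R_{mstr}R_n{}^{str}.$$ In particular, if $R$ is an instanton, then the last identity holds.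
   Context: $\nabla^+=\nabla^g+\frac12H$, i.e. $g(\nabla^+_XY,Z)=g(\nabla^g_XY,Z)+\frac12H(X,Y,Z)$, with $\nabla^g$ the Levi-Civita connection; $\nabla^+\epsilon$ is the induced derivative on spinors. $\Gamma^m$ are gamma matrices with $\Gamma^m\Gamma^n+\Gamma^n\Gamma^m=2g^{mn}$, and $\Gamma^{mn},\Gamma^{mnp}$ are antisymmetrized products. In dimension five, a spinor $\epsilon$ parallel for $\nabla^+$ determines an almost contact metric structure $(g,\xi,\eta,\psi)$: a unit vector field $\xi$ with dual $1$-form $\eta$ and an endomorphism $\psi$ with $\psi\xi=0$, $\psi^2=-\mathrm{id}+\eta\otimes\xi$, $g(\psi\cdot,\psi\cdot)=g-\eta\otimes\eta$, via $$\xi\cdot\epsilon=\sqrt{-1}\,\epsilon,\qquad -2\psi X\cdot\epsilon+\xi\cdot X\cdot\epsilon=\sqrt{-1}\,X\cdot\epsilon,$$ where $X\cdot=\sqrt{-1}\,X_m\Gamma^m$ (so $X\cdot X\cdot=-|X|^2$). The fundamental form is $F(X,Y)=g(X,\psi Y)$, $F_{ij}=g_{is}\psi^s_j$. The curvature $2$-forms of $\nabla$ in an orthonormal frame are $\Omega^i_j=d\omega^i_j+\omega^i_k\wedge\omega^k_j$, where $\nabla_XE_j=\omega^s_j(X)E_s$, and $R_{ijkl}=\Omega^l_k(E_i,E_j)$: the first two indices are form indices and the last two endomorphism indices. Likewise $(F^A)_{imns}$ has form indices $i,m$ and bundle indices $n,s$ in an orthonormal frame of $E$. $Ric^g$ is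 the Ricci tensor of $\nabla^g$ (positive on round spheres). Repeated indices are summed over their full range, with indices moved by the metric, with this exception: the traces over endomorphism/bundle indices in the anomaly condition and in the Einstein equation use one common normalization, the sum over pairs of distinct indices, i.e. $Tr(R\wedge R)=\sum_{i<j}\Omega^i_j\wedge\Omega^i_j=8\pi^2p_1(\nabla)$ with $p_1(\nabla)=\frac1{8\pi^2}\sum_{i<j}\Omega^i_j\wedge\Omega^i_j$, and in the Einstein equation $R_{imns}R_j{}^{mns}$ stands for $\sum_m\sum_{n<s}R_{imns}R_{jmns}$; similarly for $F^A$. In the quadratic identity on $R$ all repeated indices are summed over the full range. $R$ is an ($SU(2)$-)instanton if, in its form indices, $\Omega^m_n(\psi X,\psi Y)=\Omega^m_n(X,Y)$ and $\sum_{k=1}^5\Omega^m_n(E_k,\psi E_k)=0$ for an orthonormal frame $E_k$. *)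

theory Defs
  imports "HOL-Analysis.Analysis"
begin

section \<open>Smooth five-manifolds\<close>

primrec Ck_on :: "nat \<Rightarrow> 'a::real_normed_vector set \<Rightarrow> ('a \<Rightarrow> 'b::real_normed_vector) \<Rightarrow> bool" where
  "Ck_on 0 S f \<longleftrightarrow> continuous_on S f"
| "Ck_on (Suc k) S f \<longleftrightarrow> (\<forall>x\<in>S. f differentiable at x) \<and>
     (\<forall>v. Ck_on k S (\<lambda>x. frechet_derivative f (at x) v))"

text \<open>Only used for open \<open>S\<close> in a Euclidean space.\<close>

definition smooth_on :: "'a::real_normed_vector set \<Rightarrow> ('a \<Rightarrow> 'b::real_normed_vector) \<Rightarrow> bool" where
  "smooth_on S f \<longleftrightarrow> (\<forall>k. Ck_on k S f)"

text \<open>The manifold is a whole type \<open>'p\<close> (Hausdorff and second countable in the main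
  statement); a chart is an open set together with its coordinate map.\<close>

type_synonym 'p chart = "'p set \<times> ('p \<Rightarrow> real^5)"

definition smooth_atlas :: "'p::topological_space chart set \<Rightarrow> bool" where
  "smooth_atlas A \<longleftrightarrow>
     (\<forall>(U, x)\<in>A. open U \<and> open (x ` U) \<and> homeomorphism U (x ` U) x (inv_into U x)) \<and>
     \<Union> (fst ` A) = UNIV \<and>
     (\<forall>(U, x)\<in>A. \<forall>(V, y)\<in>A. smooth_on (x ` (U \<inter> V)) (y \<circ> inv_into U x))"

definition smooth_fn :: "'p::topological_space chart set \<Rightarrow> 'p set \<Rightarrow>
    ('p \<Rightarrow> 'b::real_normed_vector) \<Rightarrow> bool" where
  "smooth_fn A W f \<longleftrightarrow> (\<forall>(U, x)\<in>A. smooth_on (x ` (U \<inter> W)) (f \<circ> inv_into U x))"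

definition smooth_near :: "'p::topological_space chart set \<Rightarrow> 'p \<Rightarrow> ('p \<Rightarrow> real) \<Rightarrow> bool" where
  "smooth_near A p f \<longleftrightarrow> (\<exists>W. open W \<and> p \<in> W \<and> smooth_fn A W f)"

text \<open>A tangent vector at \<open>p\<close> is a directional derivative in a chart, acting on the functions
  that are smooth near \<open>p\<close> and extended by zero to all other functions, so that tangent vectors
  are equal as soon as they agree on smooth functions.  By the chain rule the choice of the
  chart around \<open>p\<close> does not matter.\<close>

type_synonym 'p tvec = "('p \<Rightarrow> real) \<Rightarrow> real"
type_synonym 'p vfield = "'p \<Rightarrow> 'p tvec"

definition chart_vec :: "'p::topological_space chart set \<Rightarrow> 'p chart \<Rightarrow> 'p \<Rightarrow> real^5 \<Rightarrow> 'p tvec" where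
  "chart_vec A c p u = (\<lambda>f. if smooth_near A p f
     then frechet_derivative (f \<circ> inv_into (fst c) (snd c)) (at (snd c p)) u else 0)"

definition tspace :: "'p::topological_space chart set \<Rightarrow> 'p \<Rightarrow> 'p tvec set" where
  "tspace A p = {chart_vec A c p u | c u. c \<in> A \<and> p \<in> fst c}"

definition smooth_vfield :: "'p::topological_space chart set \<Rightarrow> 'p set \<Rightarrow> 'p vfield \<Rightarrow> bool" where
  "smooth_vfield A W X \<longleftrightarrow> (\<forall>p\<in>W. X p \<in> tspace A p) \<and>
     (\<forall>V f. open V \<and> V \<subseteq> W \<and> smooth_fn A V f \<longrightarrow> smooth_fn A V (\<lambda>p. X p f))"

definition lie_bracket :: "'p::topological_space chart set \<Rightarrow> 'p vfield \<Rightarrow> 'p vfield \<Rightarrow> 'p vfield" where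
  "lie_bracket A X Y p = (\<lambda>f. if smooth_near A p f
     then X p (\<lambda>q. Y q f) - Y p (\<lambda>q. X q f) else 0)"

definition tlinear :: "'p::topological_space chart set \<Rightarrow> 'p \<Rightarrow> ('p tvec \<Rightarrow> 'b::real_vector) \<Rightarrow> bool" where
  "tlinear A p \<theta> \<longleftrightarrow> (\<forall>v\<in>tspace A p. \<forall>w\<in>tspace A p. \<forall>c d.
     \<theta> (\<lambda>f. c * v f + d * w f) = c *\<^sub>R \<theta> v + d *\<^sub>R \<theta> w)"

definition mat_deriv :: "'p tvec \<Rightarrow> ('p \<Rightarrow> real^'n^'m) \<Rightarrow> real^'n^'m" where
  "mat_deriv v M = (\<chi> a b. v (\<lambda>q. M q $ a $ b))"

definition spinor_deriv :: "'p tvec \<Rightarrow> ('p \<Rightarrow> complex^4) \<Rightarrow> complex^4" where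
  "spinor_deriv v s = (\<chi> k. Complex (v (\<lambda>q. Re (s q $ k))) (v (\<lambda>q. Im (s q $ k))))"


section \<open>Metrics and three-forms\<close>

definition riemannian_metric ::
  "'p::topological_space chart set \<Rightarrow> ('p \<Rightarrow> 'p tvec \<Rightarrow> 'p tvec \<Rightarrow> real) \<Rightarrow> bool" where
  "riemannian_metric A g \<longleftrightarrow>
     (\<forall>p. \<forall>v\<in>tspace A p. tlinear A p (g p v) \<and> (\<forall>w\<in>tspace A p. g p v w = g p w v) \<and>
        (v \<noteq> (\<lambda>f. 0) \<longrightarrow> g p v v > 0)) \<and>
     (\<forall>W X Y. open W \<and> smooth_vfield A W X \<and> smooth_vfield A W Y
        \<longrightarrow> smooth_fn A W (\<lambda>p. g p (X p) (Y p)))"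

definition three_form ::
  "'p::topological_space chart set \<Rightarrow> ('p \<Rightarrow> 'p tvec \<Rightarrow> 'p tvec \<Rightarrow> 'p tvec \<Rightarrow> real) \<Rightarrow> bool" where
  "three_form A H \<longleftrightarrow>
     (\<forall>p. \<forall>u\<in>tspace A p. \<forall>v\<in>tspace A p. tlinear A p (H p u v) \<and>
        (\<forall>w\<in>tspace A p. H p v u w = - H p u v w \<and> H p u w v = - H p u v w)) \<and>
     (\<forall>W X Y Z. open W \<and> smooth_vfield A W X \<and> smooth_vfield A W Y \<and> smooth_vfield A W Z
        \<longrightarrow> smooth_fn A W (\<lambda>p. H p (X p) (Y p) (Z p)))"

text \<open>The exterior derivative of a three-form by its invariant formula, with the convention
  in which no numerical prefactor occurs.\<close>

definition ext_deriv3 ::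
  "'p::topological_space chart set \<Rightarrow> ('p \<Rightarrow> 'p tvec \<Rightarrow> 'p tvec \<Rightarrow> 'p tvec \<Rightarrow> real) \<Rightarrow>
     'p vfield \<Rightarrow> 'p vfield \<Rightarrow> 'p vfield \<Rightarrow> 'p vfield \<Rightarrow> 'p \<Rightarrow> real" where
  "ext_deriv3 A H X Y Z W p =
       X p (\<lambda>q. H q (Y q) (Z q) (W q)) - Y p (\<lambda>q. H q (X q) (Z q) (W q))
     + Z p (\<lambda>q. H q (X q) (Y q) (W q)) - W p (\<lambda>q. H q (X q) (Y q) (Z q))
     - H p (lie_bracket A X Y p) (Z p) (W p) + H p (lie_bracket A X Z p) (Y p) (W p)
     - H p (lie_bracket A X W p) (Y p) (Z p) - H p (lie_bracket A Y Z p) (X p) (W p)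
     + H p (lie_bracket A Y W p) (X p) (Z p) - H p (lie_bracket A Z W p) (X p) (Y p)"


section \<open>Metric bundles and connections\<close>

text \<open>A real vector bundle with fibre metric, of rank \<open>CARD('r)\<close>, is given by an open cover
  \<open>V\<close>, an orthonormal frame over each \<open>V j\<close>, and the transition matrices \<open>\<tau> j k\<close>
  expressing the \<open>k\<close>-th frame through the \<open>j\<close>-th one: \<open>f\<^sub>k = f\<^sub>j \<tau> j k\<close>.\<close>

definition metric_bundle ::
  "'p::topological_space chart set \<Rightarrow> ('j \<Rightarrow> 'p set) \<Rightarrow> ('j \<Rightarrow> 'j \<Rightarrow> 'p \<Rightarrow> real^'r^'r) \<Rightarrow> bool" where
  "metric_bundle A V \<tau> \<longleftrightarrow>
     (\<forall>j. open (V j)) \<and> (\<Union>j. V j) = UNIV \<and>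
     (\<forall>j k. smooth_fn A (V j \<inter> V k) (\<tau> j k)) \<and>
     (\<forall>j k. \<forall>p\<in>V j \<inter> V k. orthogonal_matrix (\<tau> j k p)) \<and>
     (\<forall>j k l. \<forall>p\<in>V j \<inter> V k \<inter> V l. \<tau> j k p ** \<tau> k l p = \<tau> j l p)"

text \<open>A metric connection is given by its connection forms in the orthonormal frames of the
  cover: \<open>w j p v $ s $ b\<close> is \<open>\<omega>\<^sup>s\<^sub>b(v)\<close>, where \<open>\<nabla>\<^sub>v f\<^sub>b = \<omega>\<^sup>s\<^sub>b(v) f\<^sub>s\<close> in the \<open>j\<close>-th frame.  The last
  condition is the change-of-frame law \<open>\<tau> \<omega>\<^sub>k = d\<tau> + \<omega>\<^sub>j \<tau>\<close> for \<open>\<tau> = \<tau> j k\<close>.\<close>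

definition metric_connection ::
  "'p::topological_space chart set \<Rightarrow> ('j \<Rightarrow> 'p set) \<Rightarrow> ('j \<Rightarrow> 'j \<Rightarrow> 'p \<Rightarrow> real^'r^'r) \<Rightarrow>
     ('j \<Rightarrow> 'p \<Rightarrow> 'p tvec \<Rightarrow> real^'r^'r) \<Rightarrow> bool" where
  "metric_connection A V \<tau> w \<longleftrightarrow>
     (\<forall>j. \<forall>p\<in>V j. tlinear A p (w j p) \<and> (\<forall>v\<in>tspace A p. transpose (w j p v) = - w j p v)) \<and>
     (\<forall>j W X. open W \<and> W \<subseteq> V j \<and> smooth_vfield A W X \<longrightarrow> smooth_fn A W (\<lambda>p. w j p (X p))) \<and>
     (\<forall>j k. \<forall>p\<in>V j \<inter> V k. \<forall>v\<in>tspace A p.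
        \<tau> j k p ** w k p v = mat_deriv v (\<tau> j k) + w j p v ** \<tau> j k p)"

text \<open>\<open>curvature A w X Y p $ i $ j\<close> is \<open>\<Omega>\<^sup>i\<^sub>j(X,Y)\<close> with \<open>\<Omega> = d\<omega> + \<omega> \<and> \<omega>\<close>, for the connection form
  \<open>w\<close> of a single frame.\<close>

definition curvature ::
  "'p::topological_space chart set \<Rightarrow> ('p \<Rightarrow> 'p tvec \<Rightarrow> real^'r^'r) \<Rightarrow>
     'p vfield \<Rightarrow> 'p vfield \<Rightarrow> 'p \<Rightarrow> real^'r^'r" where
  "curvature A w X Y p =
     mat_deriv (X p) (\<lambda>q. w q (Y q)) - mat_deriv (Y p) (\<lambda>q. w q (X q)) - w p (lie_bracket A X Y p)
     + (w p (X p) ** w p (Y p) - w p (Y p) ** w p (X p))"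

text \<open>\<open>curv_comp A E w p i j k l\<close> is \<open>R\<^sub>i\<^sub>j\<^sub>k\<^sub>l = \<Omega>\<^sup>l\<^sub>k(E\<^sub>i, E\<^sub>j)\<close>: first the form indices, then the
  endomorphism indices, the latter in reversed order.\<close>

definition curv_comp ::
  "'p::topological_space chart set \<Rightarrow> (5 \<Rightarrow> 'p vfield) \<Rightarrow> ('p \<Rightarrow> 'p tvec \<Rightarrow> real^'r^'r) \<Rightarrow> 'p \<Rightarrow>
     5 \<Rightarrow> 5 \<Rightarrow> 'r \<Rightarrow> 'r \<Rightarrow> real" where
  "curv_comp A E w p i j k l = curvature A w (E i) (E j) p $ l $ k"

definition orthonormal_frames ::
  "'p::topological_space chart set \<Rightarrow> ('p \<Rightarrow> 'p tvec \<Rightarrow> 'p tvec \<Rightarrow> real) \<Rightarrow> ('i \<Rightarrow> 'p set) \<Rightarrow>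
     ('i \<Rightarrow> 5 \<Rightarrow> 'p vfield) \<Rightarrow> bool" where
  "orthonormal_frames A g U e \<longleftrightarrow>
     (\<forall>i. open (U i)) \<and> (\<Union>i. U i) = UNIV \<and> (\<forall>i a. smooth_vfield A (U i) (e i a)) \<and>
     (\<forall>i. \<forall>p\<in>U i. \<forall>a b. g p (e i a p) (e i b p) = (if a = b then 1 else 0))"

text \<open>\<open>(e j) = (e i) (frame_transition g e i j)\<close>, so that with this cocycle a
  \<^const>\<open>metric_connection\<close> is a metric connection on the tangent bundle.\<close>

definition frame_transition ::
  "('p \<Rightarrow> 'p tvec \<Rightarrow> 'p tvec \<Rightarrow> real) \<Rightarrow> ('i \<Rightarrow> 5 \<Rightarrow> 'p vfield) \<Rightarrow> 'i \<Rightarrow> 'i \<Rightarrow> 'p \<Rightarrow> real^5^5" where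
  "frame_transition g e i j p = (\<chi> a b. g p (e i a p) (e j b p))"

text \<open>The Levi-Civita connection: metric and torsion free,
  \<open>\<nabla>\<^sub>X Y - \<nabla>\<^sub>Y X = [X, Y]\<close> for the frame fields.\<close>

definition levi_civita ::
  "'p::topological_space chart set \<Rightarrow> ('p \<Rightarrow> 'p tvec \<Rightarrow> 'p tvec \<Rightarrow> real) \<Rightarrow> ('i \<Rightarrow> 'p set) \<Rightarrow>
     ('i \<Rightarrow> 5 \<Rightarrow> 'p vfield) \<Rightarrow> ('i \<Rightarrow> 'p \<Rightarrow> 'p tvec \<Rightarrow> real^5^5) \<Rightarrow> bool" where
  "levi_civita A g U e w \<longleftrightarrow>
     metric_connection A U (frame_transition g e) w \<and>
     (\<forall>i. \<forall>p\<in>U i. \<forall>a b. (\<lambda>f. \<Sum>s\<in>UNIV. (w i p (e i a p) $ s $ b - w i p (e i b p) $ s $ a) * e i s p f)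
        = lie_bracket A (e i a) (e i b) p)"

text \<open>\<open>g(\<nabla>\<^sup>+\<^sub>X Y, Z) = g(\<nabla>\<^sup>g\<^sub>X Y, Z) + H(X,Y,Z)/2\<close>, where \<open>w\<close> is the Levi-Civita connection.\<close>

definition plus_connection ::
  "('p \<Rightarrow> 'p tvec \<Rightarrow> 'p tvec \<Rightarrow> 'p tvec \<Rightarrow> real) \<Rightarrow> ('i \<Rightarrow> 5 \<Rightarrow> 'p vfield) \<Rightarrow>
     ('i \<Rightarrow> 'p \<Rightarrow> 'p tvec \<Rightarrow> real^5^5) \<Rightarrow> 'i \<Rightarrow> 'p \<Rightarrow> 'p tvec \<Rightarrow> real^5^5" where
  "plus_connection H e w i p v = w i p v + (\<chi> s b. H p v (e i b p) (e i s p) / 2)"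


section \<open>Gamma matrices and spinors\<close>

definition gamma_matrices :: "(5 \<Rightarrow> complex^4^4) \<Rightarrow> bool" where
  "gamma_matrices \<Gamma> \<longleftrightarrow>
     (\<forall>a b. \<Gamma> a ** \<Gamma> b + \<Gamma> b ** \<Gamma> a = (if a = b then 2 *\<^sub>R mat 1 else 0))"

definition gamma2 :: "(5 \<Rightarrow> complex^4^4) \<Rightarrow> 5 \<Rightarrow> 5 \<Rightarrow> complex^4^4" where
  "gamma2 \<Gamma> a b = (1/2) *\<^sub>R (\<Gamma> a ** \<Gamma> b - \<Gamma> b ** \<Gamma> a)"

definition gamma3 :: "(5 \<Rightarrow> complex^4^4) \<Rightarrow> 5 \<Rightarrow> 5 \<Rightarrow> 5 \<Rightarrow> complex^4^4" where
  "gamma3 \<Gamma> a b c = (1/6) *\<^sub>R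
     (\<Gamma> a ** \<Gamma> b ** \<Gamma> c + \<Gamma> b ** \<Gamma> c ** \<Gamma> a + \<Gamma> c ** \<Gamma> a ** \<Gamma> b
      - \<Gamma> b ** \<Gamma> a ** \<Gamma> c - \<Gamma> a ** \<Gamma> c ** \<Gamma> b - \<Gamma> c ** \<Gamma> b ** \<Gamma> a)"

definition slash :: "(5 \<Rightarrow> complex^4^4) \<Rightarrow> real^5 \<Rightarrow> complex^4^4" where
  "slash \<Gamma> v = (\<Sum>a\<in>UNIV. (v $ a) *\<^sub>R \<Gamma> a)"

text \<open>\<open>Spin(5)\<close> in the (faithful) representation on \<open>\<complex>\<^sup>4\<close>: the products of an even number of
  unit vectors of the Clifford algebra.\<close>

inductive_set spin_group :: "(5 \<Rightarrow> complex^4^4) \<Rightarrow> (complex^4^4) set" for \<Gamma> where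
  one: "mat 1 \<in> spin_group \<Gamma>"
| mult: "s \<in> spin_group \<Gamma> \<Longrightarrow> norm v = 1 \<Longrightarrow> norm w = 1 \<Longrightarrow> slash \<Gamma> v ** slash \<Gamma> w ** s \<in> spin_group \<Gamma>"

text \<open>A spin structure: orthonormal frames over an open cover whose transition matrices are
  lifted to a \<open>Spin(5)\<close>-valued cocycle \<open>S\<close>.  That \<open>S i j p\<close> covers the transition matrix also
  forces the latter into \<open>SO(5)\<close>, so an orientation is included.\<close>

definition spin_structure ::
  "'p::topological_space chart set \<Rightarrow> ('p \<Rightarrow> 'p tvec \<Rightarrow> 'p tvec \<Rightarrow> real) \<Rightarrow> (5 \<Rightarrow> complex^4^4) \<Rightarrow>
     ('i \<Rightarrow> 'p set) \<Rightarrow> ('i \<Rightarrow> 5 \<Rightarrow> 'p vfield) \<Rightarrow> ('i \<Rightarrow> 'i \<Rightarrow> 'p \<Rightarrow> complex^4^4) \<Rightarrow> bool" where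
  "spin_structure A g \<Gamma> U e S \<longleftrightarrow>
     orthonormal_frames A g U e \<and>
     (\<forall>i j. smooth_fn A (U i \<inter> U j) (S i j)) \<and>
     (\<forall>i j. \<forall>p\<in>U i \<inter> U j. S i j p \<in> spin_group \<Gamma> \<and>
        (\<forall>b. S i j p ** \<Gamma> b = (\<Sum>a\<in>UNIV. (frame_transition g e i j p $ a $ b) *\<^sub>R \<Gamma> a) ** S i j p)) \<and>
     (\<forall>i j k. \<forall>p\<in>U i \<inter> U j \<inter> U k. S i j p ** S j k p = S i k p)"

definition spinor_field ::
  "'p::topological_space chart set \<Rightarrow> ('i \<Rightarrow> 'p set) \<Rightarrow> ('i \<Rightarrow> 'i \<Rightarrow> 'p \<Rightarrow> complex^4^4) \<Rightarrow>
     ('i \<Rightarrow> 'p \<Rightarrow> complex^4) \<Rightarrow> bool" where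
  "spinor_field A U S \<epsilon> \<longleftrightarrow>
     (\<forall>i. smooth_fn A (U i) (\<epsilon> i)) \<and>
     (\<forall>i j. \<forall>p\<in>U i \<inter> U j. \<epsilon> i p = S i j p *v \<epsilon> j p)"

text \<open>The covariant derivative induced on spinors by a metric connection with connection forms
  \<open>w\<close>: \<open>\<nabla>\<^sub>v \<epsilon> = v(\<epsilon>) + 1/4 \<omega>\<^sup>b\<^sub>c(v) \<Gamma>\<^sup>b\<^sup>c \<epsilon>\<close>.  With \<open>\<Gamma>\<^sup>b \<Gamma>\<^sup>c + \<Gamma>\<^sup>c \<Gamma>\<^sup>b = 2 \<delta>\<^sup>b\<^sup>c\<close> this is the sign for which
  Clifford multiplication is parallel: \<open>[1/4 \<omega>\<^sup>b\<^sub>c \<Gamma>\<^sup>b\<^sup>c, \<Gamma>\<^sub>k] = \<omega>\<^sup>s\<^sub>k \<Gamma>\<^sub>s\<close>.\<close>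

definition spin_nabla ::
  "(5 \<Rightarrow> complex^4^4) \<Rightarrow> ('p \<Rightarrow> 'p tvec \<Rightarrow> real^5^5) \<Rightarrow> 'p \<Rightarrow> 'p tvec \<Rightarrow> ('p \<Rightarrow> complex^4) \<Rightarrow> complex^4" where
  "spin_nabla \<Gamma> w p v s = spinor_deriv v s +
     (1/4) *\<^sub>R ((\<Sum>b\<in>UNIV. \<Sum>c\<in>UNIV. (w p v $ b $ c) *\<^sub>R gamma2 \<Gamma> b c) *v s p)"

text \<open>Clifford multiplication \<open>X\<cdot> = \<surd>-1 X\<^sub>m \<Gamma>\<^sup>m\<close> at \<open>p\<close> in the orthonormal frame \<open>E\<close>.\<close>

definition cliff ::
  "('p \<Rightarrow> 'p tvec \<Rightarrow> 'p tvec \<Rightarrow> real) \<Rightarrow> (5 \<Rightarrow> complex^4^4) \<Rightarrow> (5 \<Rightarrow> 'p vfield) \<Rightarrow> 'p \<Rightarrow>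
     'p tvec \<Rightarrow> complex^4 \<Rightarrow> complex^4" where
  "cliff g \<Gamma> E p X s = \<i> *s (slash \<Gamma> (\<chi> m. g p X (E m p)) *v s)"


section \<open>The almost contact metric structure determined by the spinor\<close>

definition almost_contact_metric ::
  "'p::topological_space chart set \<Rightarrow> ('p \<Rightarrow> 'p tvec \<Rightarrow> 'p tvec \<Rightarrow> real) \<Rightarrow> 'p vfield \<Rightarrow>
     ('p \<Rightarrow> 'p tvec \<Rightarrow> 'p tvec) \<Rightarrow> bool" where
  "almost_contact_metric A g \<xi> \<psi> \<longleftrightarrow>
     (\<forall>p. \<xi> p \<in> tspace A p \<and> g p (\<xi> p) (\<xi> p) = 1 \<and> \<psi> p (\<xi> p) = (\<lambda>f. 0) \<and>
       (\<forall>X\<in>tspace A p. \<psi> p X \<in> tspace A p \<and>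
          \<psi> p (\<psi> p X) = (\<lambda>f. - X f + g p (\<xi> p) X * \<xi> p f) \<and>
          (\<forall>Y\<in>tspace A p.
             g p (\<psi> p X) (\<psi> p Y) = g p X Y - g p (\<xi> p) X * g p (\<xi> p) Y \<and>
             (\<forall>c d. \<psi> p (\<lambda>f. c * X f + d * Y f) = (\<lambda>f. c * \<psi> p X f + d * \<psi> p Y f)))))"

text \<open>Since Clifford multiplication by real tangent vectors on a nonzero spinor is injective,
  the two equations determine \<open>\<xi>\<close> and \<open>\<psi>\<close> uniquely on each tangent space.\<close>

definition determined_by_spinor ::
  "'p::topological_space chart set \<Rightarrow> ('p \<Rightarrow> 'p tvec \<Rightarrow> 'p tvec \<Rightarrow> real) \<Rightarrow> (5 \<Rightarrow> complex^4^4) \<Rightarrow>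
     ('i \<Rightarrow> 'p set) \<Rightarrow> ('i \<Rightarrow> 5 \<Rightarrow> 'p vfield) \<Rightarrow> ('i \<Rightarrow> 'p \<Rightarrow> complex^4) \<Rightarrow>
     'p vfield \<Rightarrow> ('p \<Rightarrow> 'p tvec \<Rightarrow> 'p tvec) \<Rightarrow> bool" where
  "determined_by_spinor A g \<Gamma> U e \<epsilon> \<xi> \<psi> \<longleftrightarrow>
     almost_contact_metric A g \<xi> \<psi> \<and>
     (\<forall>i. \<forall>p\<in>U i. let cl = cliff g \<Gamma> (e i) p in
        cl (\<xi> p) (\<epsilon> i p) = \<i> *s \<epsilon> i p \<and>
        (\<forall>X\<in>tspace A p.
           (-2) *s cl (\<psi> p X) (\<epsilon> i p) + cl (\<xi> p) (cl X (\<epsilon> i p)) = \<i> *s cl X (\<epsilon> i p)))"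

definition fundamental_form ::
  "('p \<Rightarrow> 'p tvec \<Rightarrow> 'p tvec \<Rightarrow> real) \<Rightarrow> ('p \<Rightarrow> 'p tvec \<Rightarrow> 'p tvec) \<Rightarrow> 'p \<Rightarrow> 'p tvec \<Rightarrow> 'p tvec \<Rightarrow> real" where
  "fundamental_form g \<psi> p X Y = g p X (\<psi> p Y)"

text \<open>\<open>frame_endo g E \<psi> p s n\<close> is \<open>\<psi>\<^sup>s\<^sub>n\<close>, the \<open>E\<^sub>s\<close>-component of \<open>\<psi> E\<^sub>n\<close>.\<close>

definition frame_endo ::
  "('p \<Rightarrow> 'p tvec \<Rightarrow> 'p tvec \<Rightarrow> real) \<Rightarrow> (5 \<Rightarrow> 'p vfield) \<Rightarrow> ('p \<Rightarrow> 'p tvec \<Rightarrow> 'p tvec) \<Rightarrow> 'p \<Rightarrow>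
     5 \<Rightarrow> 5 \<Rightarrow> real" where
  "frame_endo g E \<psi> p s n = g p (\<psi> p (E n p)) (E s p)"


section \<open>Killing spinor equations, anomaly cancellation, Einstein equation\<close>

text \<open>In the rest \<open>(U, e)\<close> are the frames of the spin structure, \<open>wg\<close>, \<open>w\<close> and \<open>wA\<close> are the
  connection forms of the Levi-Civita connection, of the connection on the tangent bundle and
  of the connection on the bundle over the cover \<open>V\<close>.\<close>

definition gravitino_eq ::
  "(5 \<Rightarrow> complex^4^4) \<Rightarrow> ('i \<Rightarrow> 'p set) \<Rightarrow> ('i \<Rightarrow> 5 \<Rightarrow> 'p vfield) \<Rightarrow>
     ('p \<Rightarrow> 'p tvec \<Rightarrow> 'p tvec \<Rightarrow> 'p tvec \<Rightarrow> real) \<Rightarrow>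
     ('i \<Rightarrow> 'p \<Rightarrow> 'p tvec \<Rightarrow> real^5^5) \<Rightarrow> ('i \<Rightarrow> 'p \<Rightarrow> complex^4) \<Rightarrow> bool" where
  "gravitino_eq \<Gamma> U e H wg \<epsilon> \<longleftrightarrow>
     (\<forall>i. \<forall>p\<in>U i. \<forall>m. spin_nabla \<Gamma> (plus_connection H e wg i) p (e i m p) (\<epsilon> i) = 0)"

definition dilatino_eq ::
  "(5 \<Rightarrow> complex^4^4) \<Rightarrow> ('i \<Rightarrow> 'p set) \<Rightarrow> ('i \<Rightarrow> 5 \<Rightarrow> 'p vfield) \<Rightarrow>
     ('p \<Rightarrow> 'p tvec \<Rightarrow> 'p tvec \<Rightarrow> 'p tvec \<Rightarrow> real) \<Rightarrow> ('p \<Rightarrow> real) \<Rightarrow> ('i \<Rightarrow> 'p \<Rightarrow> complex^4) \<Rightarrow> bool" where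
  "dilatino_eq \<Gamma> U e H \<phi> \<epsilon> \<longleftrightarrow>
     (\<forall>i. \<forall>p\<in>U i.
        ((\<Sum>m\<in>UNIV. (e i m p \<phi>) *\<^sub>R \<Gamma> m)
         - (1/12) *\<^sub>R (\<Sum>m\<in>UNIV. \<Sum>n\<in>UNIV. \<Sum>q\<in>UNIV.
              H p (e i m p) (e i n p) (e i q p) *\<^sub>R gamma3 \<Gamma> m n q)) *v \<epsilon> i p = 0)"

definition gaugino_eq ::
  "'p::topological_space chart set \<Rightarrow> (5 \<Rightarrow> complex^4^4) \<Rightarrow> ('i \<Rightarrow> 'p set) \<Rightarrow> ('i \<Rightarrow> 5 \<Rightarrow> 'p vfield) \<Rightarrow>
     ('j \<Rightarrow> 'p set) \<Rightarrow> ('j \<Rightarrow> 'p \<Rightarrow> 'p tvec \<Rightarrow> real^'r^'r) \<Rightarrow> ('i \<Rightarrow> 'p \<Rightarrow> complex^4) \<Rightarrow> bool" where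
  "gaugino_eq A \<Gamma> U e V wA \<epsilon> \<longleftrightarrow>
     (\<forall>i j. \<forall>p\<in>U i \<inter> V j. \<forall>x y.
        (\<Sum>m\<in>UNIV. \<Sum>n\<in>UNIV. curv_comp A (e i) (wA j) p m n x y *\<^sub>R gamma2 \<Gamma> m n) *v \<epsilon> i p = 0)"

text \<open>Wedge product of two-forms, normalized as the sum over shuffles.\<close>

definition wedge22 :: "('a \<Rightarrow> 'a \<Rightarrow> real) \<Rightarrow> ('a \<Rightarrow> 'a \<Rightarrow> real) \<Rightarrow> 'a \<Rightarrow> 'a \<Rightarrow> 'a \<Rightarrow> 'a \<Rightarrow> real" where
  "wedge22 \<alpha> \<beta> a b c d =
     \<alpha> a b * \<beta> c d - \<alpha> a c * \<beta> b d + \<alpha> a d * \<beta> b c + \<alpha> b c * \<beta> a d - \<alpha> b d * \<beta> a c + \<alpha> c d * \<beta> a b"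

text \<open>\<open>Tr(\<Omega> \<and> \<Omega>) = \<Sum>\<^sub>x\<^sub><\<^sub>y \<Omega>\<^sup>x\<^sub>y \<and> \<Omega>\<^sup>x\<^sub>y\<close>, the sum over pairs of distinct indices with a positive sign,
  and with the same normalization \<open>\<Sum>\<^sub>m \<Sum>\<^sub>x\<^sub><\<^sub>y \<Omega>\<^sub>a\<^sub>m\<^sub>x\<^sub>y \<Omega>\<^sub>b\<^sub>m\<^sub>x\<^sub>y\<close>.\<close>

definition tr_wedge :: "('a \<Rightarrow> 'a \<Rightarrow> 'r::{finite,linorder} \<Rightarrow> 'r \<Rightarrow> real) \<Rightarrow> 'a \<Rightarrow> 'a \<Rightarrow> 'a \<Rightarrow> 'a \<Rightarrow> real"
  where "tr_wedge R a b c d =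
    (\<Sum>(x, y)\<in>{(x, y). x < y}. wedge22 (\<lambda>m n. R m n y x) (\<lambda>m n. R m n y x) a b c d)"

definition curv_square :: "('a::finite \<Rightarrow> 'a \<Rightarrow> 'r::{finite,linorder} \<Rightarrow> 'r \<Rightarrow> real) \<Rightarrow> 'a \<Rightarrow> 'a \<Rightarrow> real" where
  "curv_square R a b =
    (\<Sum>m\<in>UNIV. \<Sum>(x, y)\<in>{(x, y). x < y}. R a m x y * R b m x y)"

definition anomaly_cancellation ::
  "'p::topological_space chart set \<Rightarrow> real \<Rightarrow> ('i \<Rightarrow> 'p set) \<Rightarrow> ('i \<Rightarrow> 5 \<Rightarrow> 'p vfield) \<Rightarrow>
     ('p \<Rightarrow> 'p tvec \<Rightarrow> 'p tvec \<Rightarrow> 'p tvec \<Rightarrow> real) \<Rightarrow> ('i \<Rightarrow> 'p \<Rightarrow> 'p tvec \<Rightarrow> real^5^5) \<Rightarrow>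
     ('j \<Rightarrow> 'p set) \<Rightarrow> ('j \<Rightarrow> 'p \<Rightarrow> 'p tvec \<Rightarrow> real^'r::{finite,linorder}^'r::{finite,linorder}) \<Rightarrow> bool" where
  "anomaly_cancellation A \<alpha> U e H w V wA \<longleftrightarrow>
     (\<forall>i j. \<forall>p\<in>U i \<inter> V j. \<forall>a b c d.
        ext_deriv3 A H (e i a) (e i b) (e i c) (e i d) p =
          \<alpha> / 4 * (tr_wedge (curv_comp A (e i) (w i) p) a b c d
                    - tr_wedge (curv_comp A (e i) (wA j) p) a b c d))"

text \<open>The Ricci tensor is \<open>Ric(Y,Z) = tr (X \<mapsto> R(X,Y)Z)\<close>, positive on round spheres.\<close>

definition ricci ::
  "'p::topological_space chart set \<Rightarrow> (5 \<Rightarrow> 'p vfield) \<Rightarrow> ('p \<Rightarrow> 'p tvec \<Rightarrow> real^5^5) \<Rightarrow> 'p \<Rightarrow>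
     5 \<Rightarrow> 5 \<Rightarrow> real" where
  "ricci A E w p a b = (\<Sum>m\<in>UNIV. curv_comp A E w p m a b m)"

definition hessian ::
  "(5 \<Rightarrow> 'p vfield) \<Rightarrow> ('p \<Rightarrow> 'p tvec \<Rightarrow> real^5^5) \<Rightarrow> ('p \<Rightarrow> real) \<Rightarrow> 'p \<Rightarrow> 5 \<Rightarrow> 5 \<Rightarrow> real" where
  "hessian E w \<phi> p a b = E a p (\<lambda>q. E b q \<phi>) - (\<Sum>s\<in>UNIV. w p (E a p) $ s $ b * E s p \<phi>)"

definition einstein_eq ::
  "'p::topological_space chart set \<Rightarrow> real \<Rightarrow> ('i \<Rightarrow> 'p set) \<Rightarrow> ('i \<Rightarrow> 5 \<Rightarrow> 'p vfield) \<Rightarrow>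
     ('i \<Rightarrow> 'p \<Rightarrow> 'p tvec \<Rightarrow> real^5^5) \<Rightarrow>
     ('p \<Rightarrow> 'p tvec \<Rightarrow> 'p tvec \<Rightarrow> 'p tvec \<Rightarrow> real) \<Rightarrow> ('p \<Rightarrow> real) \<Rightarrow>
     ('i \<Rightarrow> 'p \<Rightarrow> 'p tvec \<Rightarrow> real^5^5) \<Rightarrow>
     ('j \<Rightarrow> 'p set) \<Rightarrow> ('j \<Rightarrow> 'p \<Rightarrow> 'p tvec \<Rightarrow> real^'r::{finite,linorder}^'r::{finite,linorder}) \<Rightarrow> bool" where
  "einstein_eq A \<alpha> U e wg H \<phi> w V wA \<longleftrightarrow>
     (\<forall>i j. \<forall>p\<in>U i \<inter> V j. \<forall>a b.
        ricci A (e i) (wg i) p a b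
        - (1/4) * (\<Sum>m\<in>UNIV. \<Sum>n\<in>UNIV.
             H p (e i a p) (e i m p) (e i n p) * H p (e i b p) (e i m p) (e i n p))
        + 2 * hessian (e i) (wg i) \<phi> p a b
        - \<alpha> / 4 * (curv_square (curv_comp A (e i) (wA j) p) a b
                   - curv_square (curv_comp A (e i) (w i) p) a b) = 0)"

definition quadratic_identity ::
  "'p::topological_space chart set \<Rightarrow> ('p \<Rightarrow> 'p tvec \<Rightarrow> 'p tvec \<Rightarrow> real) \<Rightarrow> ('i \<Rightarrow> 'p set) \<Rightarrow>
     ('i \<Rightarrow> 5 \<Rightarrow> 'p vfield) \<Rightarrow> ('i \<Rightarrow> 'p \<Rightarrow> 'p tvec \<Rightarrow> real^5^5) \<Rightarrow>
     ('p \<Rightarrow> 'p tvec \<Rightarrow> 'p tvec) \<Rightarrow> bool" where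
  "quadratic_identity A g U e w \<psi> \<longleftrightarrow>
     (\<forall>l. \<forall>p\<in>U l. let R = curv_comp A (e l) (w l) p;
                      F = (\<lambda>t r. fundamental_form g \<psi> p (e l t p) (e l r p));
                      P = frame_endo g (e l) \<psi> p in
        \<forall>m n.
        (1/2) * (\<Sum>s\<in>UNIV. \<Sum>t\<in>UNIV. \<Sum>r\<in>UNIV. \<Sum>i\<in>UNIV. \<Sum>j\<in>UNIV.
            (R m s i j * R t r i j + R m t i j * R r s i j + R m r i j * R s t i j) * F t r * P s n)
        = (\<Sum>s\<in>UNIV. \<Sum>t\<in>UNIV. \<Sum>r\<in>UNIV. R m s t r * R n s t r))"

text \<open>The two conditions \<open>\<Omega>(\<psi>X,\<psi>Y) = \<Omega>(X,Y)\<close> and \<open>\<Sum>\<^sub>k \<Omega>(E\<^sub>k, \<psi>E\<^sub>k) = 0\<close>, with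
  \<open>\<psi>E\<^sub>a = \<psi>\<^sup>c\<^sub>a E\<^sub>c\<close> expanded in the form indices.\<close>

definition instanton ::
  "'p::topological_space chart set \<Rightarrow> ('p \<Rightarrow> 'p tvec \<Rightarrow> 'p tvec \<Rightarrow> real) \<Rightarrow> ('i \<Rightarrow> 'p set) \<Rightarrow>
     ('i \<Rightarrow> 5 \<Rightarrow> 'p vfield) \<Rightarrow> ('i \<Rightarrow> 'p \<Rightarrow> 'p tvec \<Rightarrow> real^5^5) \<Rightarrow>
     ('p \<Rightarrow> 'p tvec \<Rightarrow> 'p tvec) \<Rightarrow> bool" where
  "instanton A g U e w \<psi> \<longleftrightarrow>
     (\<forall>l. \<forall>p\<in>U l. let R = curv_comp A (e l) (w l) p; P = frame_endo g (e l) \<psi> p in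
        \<forall>m n.
        (\<forall>a b. (\<Sum>c\<in>UNIV. \<Sum>d\<in>UNIV. P c a * P d b * R c d m n) = R a b m n) \<and>
        (\<Sum>k\<in>UNIV. \<Sum>c\<in>UNIV. P c k * R k c m n) = 0)"

end

theory Submission
  imports Defs
begin

text \<open>The spinor \<open>\<epsilon>\<close> is annihilated by the curvature of \<open>\<nabla>\<^sup>+\<close>.  Contracting this with a gamma matrix and
  using the first Bianchi identity of \<open>\<nabla>\<^sup>+\<close> together with the \<open>\<nabla>\<^sup>+\<close>-derivative of the dilatino equation gives
  \<open>Q\<^sub>a\<^sub>b \<Gamma>\<^sup>b \<epsilon> + 1/12 (dH)\<^sub>a\<^sub>c\<^sub>s\<^sub>b \<Gamma>\<^sup>c\<^sup>s\<^sup>b \<epsilon> = 0\<close> with \<open>Q = Ric\<^sup>+ + 2 \<nabla>\<^sup>+ d\<phi>\<close>, whose symmetric part is the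
  gravitational part of the Einstein equation.  In a frame adapted to \<open>(\<xi>, \<psi>)\<close> this spinor equation
  forces \<open>\<xi>\<close> to contract \<open>dH\<close> to zero, \<open>Q\<close> to be symmetric, and
  \<open>Q\<^sub>m\<^sub>n = - 1/4 (dH)\<^sub>m\<^sub>s\<^sub>t\<^sub>r F\<^sup>t\<^sup>r \<psi>\<^sup>s\<^sub>n\<close>.  Anomaly cancellation expresses the right-hand side through the two
  curvatures.  For an instanton the contraction of \<open>Tr (R \<and> R)\<close> with \<open>F\<close> and \<open>\<psi>\<close> is four times the quadratic
  curvature term; by the gaugino equation this applies to \<open>F\<^sup>A\<close>, and what remains of the Einstein
  equation is the same relation for \<open>R\<close>, that is, the quadratic identity.\<close>

section \<open>Clifford modules\<close>

text \<open>\<open>Q\<close> is not symmetric a priori: its skew part is, up to a factor, the field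
  equation of \<open>H\<close>. The spinor equation thus contains more than the Einstein equation,
  and only after \<open>Q\<close> is known to be symmetric does it say something about the
  Levi-Civita expression alone. The adapted frame serves to avoid components of spinors: there every
  product of gamma matrices applied to \<epsilon> is a complex multiple of one of four independent
  vectors, so a spinor equation becomes eight real ones. The constants fit as follows. The
  gravitational part is \<open>-1/4\<close> times the contraction of
  \<open>\<alpha>/4 (Tr (R \<and> R) - Tr (F^A \<and> F^A))\<close>. With the factor four for the
  gauge field its contribution is \<open>+\<alpha>/4\<close> times the quadratic term of
  \<open>F^A\<close>, which is exactly what the Einstein equation subtracts. All of this is algebra
  at a point. Derivatives enter through 1-jets, and the facts about them that cost work are the
  Jacobi identity of the frame, which becomes the first Bianchi identity, and the commutator of two
  derivatives of the spinor, which becomes the curvature condition.\<close>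

lemma sum3_rotate:
  fixes f :: "'n::finite \<Rightarrow> 'n \<Rightarrow> 'n \<Rightarrow> 'v::comm_monoid_add"
  shows "(\<Sum>a\<in>UNIV. \<Sum>b\<in>UNIV. \<Sum>c\<in>UNIV. f b c a) = (\<Sum>a\<in>UNIV. \<Sum>b\<in>UNIV. \<Sum>c\<in>UNIV. f a b c)"
proof -
  have "(\<Sum>a\<in>UNIV. \<Sum>b\<in>UNIV. \<Sum>c\<in>UNIV. f b c a) = (\<Sum>b\<in>UNIV. \<Sum>a\<in>UNIV. \<Sum>c\<in>UNIV. f b c a)"
    by (rule sum.swap)
  also have "\<dots> = (\<Sum>b\<in>UNIV. \<Sum>c\<in>UNIV. \<Sum>a\<in>UNIV. f b c a)"
    by (rule sum.cong[OF refl], rule sum.swap)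
  finally show ?thesis .
qed

text \<open>The operators are abstract and act on a real vector space because two families are fed
  into the same lemmas: the gamma matrices and their rotations \<open>cl (f i)\<close> into an
  adapted frame.\<close>

locale clifford_module =
  fixes G :: "'n::finite \<Rightarrow> 'v::real_vector \<Rightarrow> 'v"
  assumes G_linear: "linear (G a)"
    and G_anti: "G a (G b x) + G b (G a x) = (if a = b then 2 else 0) *\<^sub>R x"
begin

lemmas G_add = linear_add[OF G_linear]
lemmas G_diff = linear_diff[OF G_linear]
lemmas G_neg = linear_neg[OF G_linear]
lemmas G_zero = linear_0[OF G_linear]
lemmas G_scale = linear_scale[OF G_linear]
lemmas G_sum = linear_sum[OF G_linear]

lemma G_swap: "G a (G b x) = (if a = b then 2 else 0) *\<^sub>R x - G b (G a x)"
  using G_anti[of a b x] by (simp add: algebra_simps)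

lemma G_square: "G a (G a x) = x"
proof -
  have "2 *\<^sub>R G a (G a x) = 2 *\<^sub>R x"
    using G_anti[of a a x] by (simp add: scaleR_2)
  then show ?thesis by simp
qed

definition cl :: "('n \<Rightarrow> real) \<Rightarrow> 'v \<Rightarrow> 'v" where
  "cl x v = (\<Sum>a\<in>UNIV. x a *\<^sub>R G a v)"

definition cl2 :: "('n \<Rightarrow> 'n \<Rightarrow> real) \<Rightarrow> 'v \<Rightarrow> 'v" where
  "cl2 X v = (\<Sum>a\<in>UNIV. \<Sum>b\<in>UNIV. X a b *\<^sub>R G a (G b v))"

text \<open>The products are not antisymmetrized. For totally skew coefficients this makes no
  difference, but a curvature tensor with one index fixed is skew in one pair only, and its traces
  then contribute to \<open>cl3\<close>.\<close>

definition cl3 :: "('n \<Rightarrow> 'n \<Rightarrow> 'n \<Rightarrow> real) \<Rightarrow> 'v \<Rightarrow> 'v" where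
  "cl3 X v = (\<Sum>a\<in>UNIV. \<Sum>b\<in>UNIV. \<Sum>c\<in>UNIV. X a b c *\<^sub>R G a (G b (G c v)))"

lemma linear_cl: "linear (cl x)"
  by (intro linearI) (simp_all add: cl_def G_add G_scale scaleR_add_right sum.distrib scaleR_sum_right mult.commute)

lemma linear_cl2: "linear (cl2 x)"
  by (intro linearI) (simp_all add: cl2_def G_add G_scale scaleR_add_right sum.distrib scaleR_sum_right mult.commute)

lemma linear_cl3: "linear (cl3 x)"
  by (intro linearI) (simp_all add: cl3_def G_add G_scale scaleR_add_right sum.distrib scaleR_sum_right mult.commute)

lemmas cl_simps = linear_add[OF linear_cl] linear_diff[OF linear_cl] linear_neg[OF linear_cl]
  linear_0[OF linear_cl] linear_scale[OF linear_cl] linear_sum[OF linear_cl]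
lemmas cl2_simps = linear_add[OF linear_cl2] linear_diff[OF linear_cl2] linear_neg[OF linear_cl2]
  linear_0[OF linear_cl2] linear_scale[OF linear_cl2] linear_sum[OF linear_cl2]
lemmas cl3_simps = linear_add[OF linear_cl3] linear_diff[OF linear_cl3] linear_neg[OF linear_cl3]
  linear_0[OF linear_cl3] linear_scale[OF linear_cl3] linear_sum[OF linear_cl3]

lemma cl_vec_add: "cl (\<lambda>a. x a + y a) v = cl x v + cl y v"
  by (simp add: cl_def scaleR_add_left sum.distrib)
lemma cl_vec_diff: "cl (\<lambda>a. x a - y a) v = cl x v - cl y v"
  by (simp add: cl_def scaleR_diff_left sum_subtractf)
lemma cl_vec_scale: "cl (\<lambda>a. c * x a) v = c *\<^sub>R cl x v"
  by (simp add: cl_def scaleR_sum_right)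
lemma cl_vec_sum: "cl (\<lambda>a. \<Sum>i\<in>I. x i a) v = (\<Sum>i\<in>I. cl (x i) v)"
  unfolding cl_def by (subst sum.swap) (simp add: scaleR_sum_left)

lemma cl3_add: "cl3 (\<lambda>a b c. X a b c + Y a b c) v = cl3 X v + cl3 Y v"
  by (simp add: cl3_def scaleR_add_left sum.distrib)
lemma cl3_scale: "cl3 (\<lambda>a b c. k * X a b c) v = k *\<^sub>R cl3 X v"
  by (simp add: cl3_def scaleR_sum_right)

lemma G_cl_anti: "G a (cl x v) + cl x (G a v) = (2 * x a) *\<^sub>R v"
proof -
  have "G a (cl x v) + cl x (G a v) = (\<Sum>b\<in>UNIV. x b *\<^sub>R (G a (G b v) + G b (G a v)))"
    by (simp add: cl_def G_sum G_scale sum.distrib scaleR_add_right)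
  also have "\<dots> = (\<Sum>b\<in>UNIV. if a = b then (2 * x b) *\<^sub>R v else 0)"
    by (intro sum.cong) (simp_all add: G_anti)
  finally show ?thesis by simp
qed

lemma cl_anti: "cl x (cl y v) + cl y (cl x v) = (2 * (\<Sum>a\<in>UNIV. x a * y a)) *\<^sub>R v"
proof -
  have "cl x (cl y v) + cl y (cl x v) = (\<Sum>a\<in>UNIV. x a *\<^sub>R (G a (cl y v) + cl y (G a v)))"
    by (simp add: cl_def[of x] cl_simps sum.distrib scaleR_add_right)
  also have "\<dots> = (\<Sum>a\<in>UNIV. (2 * (x a * y a)) *\<^sub>R v)"
    by (simp add: G_cl_anti mult.left_commute)
  finally show ?thesis by (simp add: sum_distrib_left scaleR_sum_left)
qed

lemma cl_square: "cl x (cl x v) = (\<Sum>a\<in>UNIV. x a * x a) *\<^sub>R v"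
proof -
  have "2 *\<^sub>R cl x (cl x v) = 2 *\<^sub>R ((\<Sum>a\<in>UNIV. x a * x a) *\<^sub>R v)"
    using cl_anti[of x x v] by (simp add: scaleR_2)
  then show ?thesis using scaleR_cancel_left[of 2] by (metis zero_neq_numeral)
qed

text \<open>Rotating a product of three gamma matrices cyclically costs only trace terms, so
  \<open>cl3 X\<close> and a third of \<open>cl3\<close> of the cyclic sum differ by a vector. For a
  curvature tensor that vector is a Ricci trace, and the cyclic sum is what the Bianchi identity
  computes.\<close>

lemma cl3_cyclic:
  assumes skew: "\<And>c s b. X c s b = - X c b s"
  shows "cl3 X v = 2 *\<^sub>R cl (\<lambda>b. \<Sum>c\<in>UNIV. X c c b) v
    + (1/3) *\<^sub>R cl3 (\<lambda>c s b. X c s b + X s b c + X b c s) v"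
proof -
  define t where "t = cl (\<lambda>b. \<Sum>c\<in>UNIV. X c c b) v"
  have t1: "(\<Sum>a\<in>UNIV. \<Sum>b\<in>UNIV. \<Sum>c\<in>UNIV. (if c = a then X a b c else 0) *\<^sub>R G b v) = - t"
  proof -
    have "(\<Sum>a\<in>UNIV. \<Sum>b\<in>UNIV. \<Sum>c\<in>UNIV. (if c = a then X a b c else 0) *\<^sub>R G b v)
       = (\<Sum>a\<in>UNIV. \<Sum>b\<in>UNIV. X a b a *\<^sub>R G b v)"
      by (intro sum.cong refl) (simp add: if_distrib[of "\<lambda>r. r *\<^sub>R _"] cong: if_cong)
    also have "\<dots> = (\<Sum>a\<in>UNIV. \<Sum>b\<in>UNIV. - (X a a b *\<^sub>R G b v))"
      by (intro sum.cong refl) (subst skew, simp)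
    also have "\<dots> = - t"
      unfolding t_def cl_def scaleR_sum_left by (subst (2) sum.swap) (simp add: sum_negf)
    finally show ?thesis .
  qed
  have t2: "(\<Sum>a\<in>UNIV. \<Sum>b\<in>UNIV. \<Sum>c\<in>UNIV. (if b = a then X a b c else 0) *\<^sub>R G c v) = t"
  proof -
    have "(\<Sum>a\<in>UNIV. \<Sum>b\<in>UNIV. \<Sum>c\<in>UNIV. (if b = a then X a b c else 0) *\<^sub>R G c v)
       = (\<Sum>a\<in>UNIV. \<Sum>c\<in>UNIV. \<Sum>b\<in>UNIV. (if b = a then X a b c else 0) *\<^sub>R G c v)"
      by (rule sum.cong[OF refl], rule sum.swap)
    also have "\<dots> = (\<Sum>a\<in>UNIV. \<Sum>c\<in>UNIV. X a a c *\<^sub>R G c v)"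
      by (intro sum.cong refl) (simp add: if_distrib[of "\<lambda>r. r *\<^sub>R _"] cong: if_cong)
    also have "\<dots> = t"
      unfolding t_def cl_def scaleR_sum_left by (rule sum.swap)
    finally show ?thesis .
  qed
  have skew0: "X c b b = 0" for c b
    using skew[of c b b] by simp
  have r1: "G c (G a (G b v)) = G a (G b (G c v)) + (if c = a then 2 else 0) *\<^sub>R G b v
      - (if c = b then 2 else 0) *\<^sub>R G a v" for a b c
  proof -
    have "G c (G a (G b v)) = (if c = a then 2 else 0) *\<^sub>R G b v - G a (G c (G b v))"
      by (rule G_swap)
    also have "G a (G c (G b v)) = G a ((if c = b then 2 else 0) *\<^sub>R v - G b (G c v))"
      by (simp only: G_swap[of c b v])
    finally show ?thesis by (simp add: G_diff G_scale)
  qed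
  have r2: "G b (G c (G a v)) = G a (G b (G c v)) + (if c = a then 2 else 0) *\<^sub>R G b v
      - (if b = a then 2 else 0) *\<^sub>R G c v" for a b c
  proof -
    have "G b (G c (G a v)) = G b ((if c = a then 2 else 0) *\<^sub>R v - G a (G c v))"
      by (simp only: G_swap[of c a v])
    moreover have "G b (G a (G c v)) = (if b = a then 2 else 0) *\<^sub>R G c v - G a (G b (G c v))"
      by (rule G_swap)
    ultimately show ?thesis by (simp add: G_diff G_scale)
  qed
  \<comment> \<open>The contraction of the last two indices vanishes by skewness, so this rotation
    leaves one trace; the rotation in \<open>e2\<close> leaves two.\<close>
  have e1: "cl3 (\<lambda>c s b. X s b c) v = cl3 X v - 2 *\<^sub>R t"
  proof -
    have "cl3 (\<lambda>c s b. X s b c) v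
      = (\<Sum>a\<in>UNIV. \<Sum>b\<in>UNIV. \<Sum>c\<in>UNIV. X a b c *\<^sub>R G c (G a (G b v)))"
      unfolding cl3_def
      by (rule sum3_rotate[of "\<lambda>a b c. X a b c *\<^sub>R G c (G a (G b v))"])
    also have "\<dots> = (\<Sum>a\<in>UNIV. \<Sum>b\<in>UNIV. \<Sum>c\<in>UNIV. X a b c *\<^sub>R G a (G b (G c v))
        + 2 *\<^sub>R ((if c = a then X a b c else 0) *\<^sub>R G b v))"
      by (intro sum.cong refl) (subst r1, auto simp: skew0 algebra_simps)
    also have "\<dots> = cl3 X v + 2 *\<^sub>R (- t)"
      by (simp only: sum.distrib scaleR_sum_right[symmetric] t1 cl3_def)
    finally show ?thesis by simp
  qed
  have e2: "cl3 (\<lambda>c s b. X b c s) v = cl3 X v - 4 *\<^sub>R t"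
  proof -
    have "cl3 (\<lambda>c s b. X b c s) v
      = (\<Sum>a\<in>UNIV. \<Sum>b\<in>UNIV. \<Sum>c\<in>UNIV. X a b c *\<^sub>R G b (G c (G a v)))"
      unfolding cl3_def
      by (rule sum3_rotate[of "\<lambda>a b c. X c a b *\<^sub>R G a (G b (G c v))", symmetric])
    also have "\<dots> = (\<Sum>a\<in>UNIV. \<Sum>b\<in>UNIV. \<Sum>c\<in>UNIV. X a b c *\<^sub>R G a (G b (G c v))
        + (2 *\<^sub>R ((if c = a then X a b c else 0) *\<^sub>R G b v)
        - 2 *\<^sub>R ((if b = a then X a b c else 0) *\<^sub>R G c v)))"
      by (intro sum.cong refl) (subst r2, auto simp: algebra_simps)
    also have "\<dots> = cl3 X v + (2 *\<^sub>R (- t) - 2 *\<^sub>R t)"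
      by (simp only: sum.distrib sum_subtractf scaleR_sum_right[symmetric] t1 t2 cl3_def)
    also have "\<dots> = cl3 X v - 4 *\<^sub>R t"
      using scaleR_add_left[of 2 2 t] by simp
    finally show ?thesis .
  qed
  have "cl3 (\<lambda>c s b. X c s b + X s b c + X b c s) v = 3 *\<^sub>R cl3 X v - 6 *\<^sub>R t"
  proof -
    have "cl3 (\<lambda>c s b. X c s b + X s b c + X b c s) v
       = cl3 X v + (cl3 X v - 2 *\<^sub>R t) + (cl3 X v - 4 *\<^sub>R t)"
      by (simp only: cl3_add e1 e2)
    also have "\<dots> = (1 + 1 + 1) *\<^sub>R cl3 X v - (2 + 4) *\<^sub>R t"
      by (simp only: scaleR_add_left scaleR_one) (simp add: algebra_simps)
    finally show ?thesis by simp
  qed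
  then show ?thesis
    by (simp add: t_def[symmetric] scaleR_diff_right)
qed

text \<open>The spin representation of the Lie algebra of skew matrices. The factor 1/4 is the one
  for which the commutator with \<open>G k\<close> is Clifford multiplication by the image of the
  k-th basis vector under \<open>A\<close>.\<close>

definition spin_act :: "('n \<Rightarrow> 'n \<Rightarrow> real) \<Rightarrow> 'v \<Rightarrow> 'v" where
  "spin_act A v = (1/4) *\<^sub>R cl2 A v"

lemma linear_spin_act: "linear (spin_act A)"
  unfolding spin_act_def by (intro linearI) (simp_all add: cl2_simps scaleR_add_right)

lemmas spin_act_simps = linear_add[OF linear_spin_act] linear_diff[OF linear_spin_act]
  linear_neg[OF linear_spin_act] linear_0[OF linear_spin_act] linear_scale[OF linear_spin_act]
  linear_sum[OF linear_spin_act]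

lemma spin_act_G:
  assumes skew: "\<And>a b. A a b = - A b a"
  shows "spin_act A (G k v) = G k (spin_act A v) + cl (\<lambda>s. A s k) v"
proof -
  have r: "G a (G b (G k v)) = G k (G a (G b v)) + (if b = k then 2 else 0) *\<^sub>R G a v
      - (if a = k then 2 else 0) *\<^sub>R G b v" for a b
  proof -
    have "G a (G b (G k v)) = G a ((if b = k then 2 else 0) *\<^sub>R v - G k (G b v))"
      by (simp only: G_swap[of b k v])
    moreover have "G a (G k (G b v)) = (if a = k then 2 else 0) *\<^sub>R G b v - G k (G a (G b v))"
      by (rule G_swap)
    ultimately show ?thesis by (simp add: G_diff G_scale)
  qed
  have "cl2 A (G k v) = (\<Sum>a\<in>UNIV. \<Sum>b\<in>UNIV. A a b *\<^sub>R G k (G a (G b v))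
      + (2 *\<^sub>R ((if b = k then A a b else 0) *\<^sub>R G a v) - 2 *\<^sub>R ((if a = k then A a b else 0) *\<^sub>R G b v)))"
    unfolding cl2_def by (intro sum.cong refl) (subst r, auto simp: algebra_simps)
  also have "\<dots> = G k (cl2 A v) + (2 *\<^sub>R (\<Sum>a\<in>UNIV. \<Sum>b\<in>UNIV. (if b = k then A a b else 0) *\<^sub>R G a v)
       - 2 *\<^sub>R (\<Sum>a\<in>UNIV. \<Sum>b\<in>UNIV. (if a = k then A a b else 0) *\<^sub>R G b v))"
    by (simp only: sum.distrib sum_subtractf scaleR_sum_right[symmetric] cl2_def G_sum G_scale)
  also have "(\<Sum>a\<in>UNIV. \<Sum>b\<in>UNIV. (if b = k then A a b else 0) *\<^sub>R G a v) = cl (\<lambda>s. A s k) v"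
    unfolding cl_def by (intro sum.cong refl) (simp add: if_distrib[of "\<lambda>r. r *\<^sub>R _"] cong: if_cong)
  also have "(\<Sum>a\<in>UNIV. \<Sum>b\<in>UNIV. (if a = k then A a b else 0) *\<^sub>R G b v) = cl (\<lambda>s. A k s) v"
    unfolding cl_def by (subst sum.swap, intro sum.cong refl) (simp add: if_distrib[of "\<lambda>r. r *\<^sub>R _"] cong: if_cong)
  also have "cl (\<lambda>s. A k s) v = - cl (\<lambda>s. A s k) v"
    unfolding cl_def sum_negf[symmetric] by (intro sum.cong refl) (subst skew, simp)
  finally have "cl2 A (G k v) = G k (cl2 A v) + (2 *\<^sub>R cl (\<lambda>s. A s k) v + 2 *\<^sub>R cl (\<lambda>s. A s k) v)"
    by simp
  then have "cl2 A (G k v) = G k (cl2 A v) + 4 *\<^sub>R cl (\<lambda>s. A s k) v"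
    by (simp only: scaleR_add_left[symmetric]) simp
  then show ?thesis
    by (simp add: spin_act_def scaleR_add_right G_scale)
qed

lemma spin_act_cl:
  assumes skew: "\<And>a b. A a b = - A b a"
  shows "spin_act A (cl x v) = cl x (spin_act A v) + cl (\<lambda>s. \<Sum>t\<in>UNIV. A s t * x t) v"
proof -
  have "spin_act A (cl x v) = (\<Sum>t\<in>UNIV. x t *\<^sub>R (G t (spin_act A v) + cl (\<lambda>s. A s t) v))"
    by (simp add: cl_def[of x] spin_act_simps spin_act_G[OF skew])
  also have "\<dots> = cl x (spin_act A v) + (\<Sum>t\<in>UNIV. cl (\<lambda>s. x t * A s t) v)"
    by (simp add: cl_def[of x] scaleR_add_right sum.distrib cl_vec_scale)
  finally show ?thesis by (simp add: cl_vec_sum[symmetric] mult.commute)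
qed

text \<open>As a derivation, \<open>spin_act A\<close> rotates the two indices of \<open>B\<close>
  in turn, and the two contributions are the two halves of the matrix commutator. For connection
  forms this is the quadratic term of the curvature.\<close>

lemma spin_act_commutator:
  assumes skewA: "\<And>a b. A a b = - A b a"
  shows "spin_act A (spin_act B v) - spin_act B (spin_act A v)
    = spin_act (\<lambda>a b. (\<Sum>t\<in>UNIV. A a t * B t b - B a t * A t b)) v"
proof -
  have "spin_act A (G a (G b v)) = G a (G b (spin_act A v)) + G a (cl (\<lambda>s. A s b) v)
      + cl (\<lambda>s. A s a) (G b v)" for a b
    by (simp add: spin_act_G[OF skewA] G_add)
  then have "spin_act A (cl2 B v) = (\<Sum>a\<in>UNIV. \<Sum>b\<in>UNIV. B a b *\<^sub>R G a (G b (spin_act A v))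
      + B a b *\<^sub>R G a (cl (\<lambda>s. A s b) v) + B a b *\<^sub>R cl (\<lambda>s. A s a) (G b v))"
    by (simp add: cl2_def spin_act_simps scaleR_add_right)
  also have "\<dots> = cl2 B (spin_act A v) + (\<Sum>a\<in>UNIV. \<Sum>b\<in>UNIV. B a b *\<^sub>R G a (cl (\<lambda>s. A s b) v))
      + (\<Sum>a\<in>UNIV. \<Sum>b\<in>UNIV. B a b *\<^sub>R cl (\<lambda>s. A s a) (G b v))"
    by (simp only: sum.distrib cl2_def)
  also have "(\<Sum>a\<in>UNIV. \<Sum>b\<in>UNIV. B a b *\<^sub>R G a (cl (\<lambda>s. A s b) v))
      = cl2 (\<lambda>a b. \<Sum>t\<in>UNIV. - (B a t * A t b)) v"
  proof -
    have "(\<Sum>a\<in>UNIV. \<Sum>b\<in>UNIV. B a b *\<^sub>R G a (cl (\<lambda>s. A s b) v))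
      = (\<Sum>a\<in>UNIV. \<Sum>b\<in>UNIV. \<Sum>s\<in>UNIV. (B a b * A s b) *\<^sub>R G a (G s v))"
      by (simp add: cl_def G_sum G_scale scaleR_sum_right)
    also have "\<dots> = (\<Sum>a\<in>UNIV. \<Sum>s\<in>UNIV. \<Sum>b\<in>UNIV. (B a b * A s b) *\<^sub>R G a (G s v))"
      by (rule sum.cong[OF refl], rule sum.swap)
    also have "\<dots> = cl2 (\<lambda>a b. \<Sum>t\<in>UNIV. - (B a t * A t b)) v"
      unfolding cl2_def scaleR_sum_left by (intro sum.cong refl) (subst skewA, simp)
    finally show ?thesis .
  qed
  also have "(\<Sum>a\<in>UNIV. \<Sum>b\<in>UNIV. B a b *\<^sub>R cl (\<lambda>s. A s a) (G b v))
      = cl2 (\<lambda>a b. \<Sum>t\<in>UNIV. A a t * B t b) v"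
  proof -
    have "(\<Sum>a\<in>UNIV. \<Sum>b\<in>UNIV. B a b *\<^sub>R cl (\<lambda>s. A s a) (G b v))
      = (\<Sum>a\<in>UNIV. \<Sum>b\<in>UNIV. \<Sum>s\<in>UNIV. (A s a * B a b) *\<^sub>R G s (G b v))"
      by (simp add: cl_def scaleR_sum_right mult.commute)
    also have "\<dots> = (\<Sum>s\<in>UNIV. \<Sum>b\<in>UNIV. \<Sum>a\<in>UNIV. (A s a * B a b) *\<^sub>R G s (G b v))"
      by (subst sum3_rotate[of "\<lambda>s b a. (A s a * B a b) *\<^sub>R G s (G b v)", symmetric])
         (rule sum.cong[OF refl], rule sum.swap)
    finally show ?thesis
      unfolding cl2_def scaleR_sum_left by simp
  qed
  finally have "spin_act A (cl2 B v) = cl2 B (spin_act A v)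
     + cl2 (\<lambda>a b. (\<Sum>t\<in>UNIV. A a t * B t b - B a t * A t b)) v"
    by (simp add: cl2_def scaleR_add_left[symmetric] sum.distrib[symmetric] add.assoc)
  then have "spin_act A ((1/4) *\<^sub>R cl2 B v) = (1/4) *\<^sub>R cl2 B (spin_act A v)
     + (1/4) *\<^sub>R cl2 (\<lambda>a b. (\<Sum>t\<in>UNIV. A a t * B t b - B a t * A t b)) v"
    by (simp add: spin_act_simps scaleR_add_right)
  then show ?thesis
    by (simp add: spin_act_def[of B] spin_act_def[of "\<lambda>a b. (\<Sum>t\<in>UNIV. A a t * B t b - B a t * A t b)"])
qed

text \<open>The derivation property on products of three gamma matrices. The correction terms are
  the connection terms in the covariant derivative of a three-form.\<close>

lemma spin_act_cl3:
  assumes skew: "\<And>a b. A a b = - A b a"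
  shows "spin_act A (cl3 X v) = cl3 X (spin_act A v)
    + cl3 (\<lambda>a b c. \<Sum>t\<in>UNIV. A a t * X t b c + A b t * X a t c + A c t * X a b t) v"
proof -
  let ?S = "\<lambda>f :: 'n \<Rightarrow> 'n \<Rightarrow> 'n \<Rightarrow> 'v. \<Sum>a\<in>UNIV. \<Sum>b\<in>UNIV. \<Sum>c\<in>UNIV. X a b c *\<^sub>R f a b c"
  have s: "spin_act A (G a (G b (G c v))) = G a (G b (G c (spin_act A v)))
      + cl (\<lambda>s. A s a) (G b (G c v)) + G a (cl (\<lambda>s. A s b) (G c v)) + G a (G b (cl (\<lambda>s. A s c) v))" for a b c
    by (simp add: spin_act_G[OF skew] G_add)
  have "spin_act A (cl3 X v) = cl3 X (spin_act A v)
     + ?S (\<lambda>a b c. cl (\<lambda>s. A s a) (G b (G c v)))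
     + ?S (\<lambda>a b c. G a (cl (\<lambda>s. A s b) (G c v)))
     + ?S (\<lambda>a b c. G a (G b (cl (\<lambda>s. A s c) v)))"
    by (simp only: cl3_def spin_act_simps s scaleR_add_right sum.distrib)
  also have "?S (\<lambda>a b c. cl (\<lambda>s. A s a) (G b (G c v)))
      = cl3 (\<lambda>a b c. \<Sum>t\<in>UNIV. A a t * X t b c) v"
  proof -
    have "?S (\<lambda>a b c. cl (\<lambda>s. A s a) (G b (G c v)))
       = (\<Sum>a\<in>UNIV. \<Sum>b\<in>UNIV. \<Sum>c\<in>UNIV. \<Sum>s\<in>UNIV. (A s a * X a b c) *\<^sub>R G s (G b (G c v)))"
      by (simp add: cl_def scaleR_sum_right mult.commute)
    also have "\<dots> = (\<Sum>b\<in>UNIV. \<Sum>c\<in>UNIV. \<Sum>a\<in>UNIV. \<Sum>s\<in>UNIV. (A s a * X a b c) *\<^sub>R G s (G b (G c v)))"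
      by (rule sum3_rotate)
    also have "\<dots> = (\<Sum>b\<in>UNIV. \<Sum>c\<in>UNIV. \<Sum>s\<in>UNIV. \<Sum>a\<in>UNIV. (A s a * X a b c) *\<^sub>R G s (G b (G c v)))"
      by (rule sum.cong[OF refl], rule sum.cong[OF refl], rule sum.swap)
    also have "\<dots> = (\<Sum>s\<in>UNIV. \<Sum>b\<in>UNIV. \<Sum>c\<in>UNIV. \<Sum>a\<in>UNIV. (A s a * X a b c) *\<^sub>R G s (G b (G c v)))"
      by (rule sum3_rotate[symmetric])
    finally show ?thesis
      unfolding cl3_def scaleR_sum_left .
  qed
  also have "?S (\<lambda>a b c. G a (cl (\<lambda>s. A s b) (G c v)))
      = cl3 (\<lambda>a b c. \<Sum>t\<in>UNIV. A b t * X a t c) v"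
  proof -
    have "(\<Sum>b\<in>UNIV. \<Sum>c\<in>UNIV. X a b c *\<^sub>R G a (cl (\<lambda>s. A s b) (G c v)))
       = (\<Sum>s\<in>UNIV. \<Sum>c\<in>UNIV. \<Sum>b\<in>UNIV. (A s b * X a b c) *\<^sub>R G a (G s (G c v)))" for a
    proof -
      have "(\<Sum>b\<in>UNIV. \<Sum>c\<in>UNIV. X a b c *\<^sub>R G a (cl (\<lambda>s. A s b) (G c v)))
         = (\<Sum>b\<in>UNIV. \<Sum>c\<in>UNIV. \<Sum>s\<in>UNIV. (A s b * X a b c) *\<^sub>R G a (G s (G c v)))"
        by (simp add: cl_def G_sum G_scale scaleR_sum_right mult.commute)
      also have "\<dots> = (\<Sum>b\<in>UNIV. \<Sum>s\<in>UNIV. \<Sum>c\<in>UNIV. (A s b * X a b c) *\<^sub>R G a (G s (G c v)))"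
        by (rule sum.cong[OF refl], rule sum.swap)
      also have "\<dots> = (\<Sum>s\<in>UNIV. \<Sum>b\<in>UNIV. \<Sum>c\<in>UNIV. (A s b * X a b c) *\<^sub>R G a (G s (G c v)))"
        by (rule sum.swap)
      also have "\<dots> = (\<Sum>s\<in>UNIV. \<Sum>c\<in>UNIV. \<Sum>b\<in>UNIV. (A s b * X a b c) *\<^sub>R G a (G s (G c v)))"
        by (rule sum.cong[OF refl], rule sum.swap)
      finally show ?thesis .
    qed
    then show ?thesis
      unfolding cl3_def scaleR_sum_left by simp
  qed
  also have "?S (\<lambda>a b c. G a (G b (cl (\<lambda>s. A s c) v)))
      = cl3 (\<lambda>a b c. \<Sum>t\<in>UNIV. A c t * X a b t) v"
  proof -
    have "(\<Sum>c\<in>UNIV. X a b c *\<^sub>R G a (G b (cl (\<lambda>s. A s c) v)))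
       = (\<Sum>s\<in>UNIV. \<Sum>c\<in>UNIV. (A s c * X a b c) *\<^sub>R G a (G b (G s v)))" for a b
      by (subst sum.swap) (simp add: cl_def G_sum G_scale scaleR_sum_right mult.commute)
    then show ?thesis
      unfolding cl3_def scaleR_sum_left by simp
  qed
  finally show ?thesis
    by (simp only: cl3_add[symmetric] sum.distrib add.assoc)
qed

end

section \<open>Clifford modules with a complex structure\<close>

locale complex_clifford_module = clifford_module G
  for G :: "'n::finite \<Rightarrow> 'v::real_vector \<Rightarrow> 'v" +
  fixes J :: "'v \<Rightarrow> 'v"
  assumes J_linear: "linear J" and J_J: "J (J x) = - x" and J_G: "J (G a x) = G a (J x)"
begin

lemmas J_simps = linear_add[OF J_linear] linear_diff[OF J_linear] linear_neg[OF J_linear]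
  linear_0[OF J_linear] linear_scale[OF J_linear] linear_sum[OF J_linear]

lemma J_cl: "J (cl x v) = cl x (J v)"
  by (simp add: cl_def J_simps J_G)

lemma J_cl2: "J (cl2 X v) = cl2 X (J v)"
  by (simp add: cl2_def J_simps J_G)

lemma J_spin_act: "J (spin_act A v) = spin_act A (J v)"
  by (simp add: spin_act_def J_simps J_cl2)

lemma cl_swap: "cl x (cl y v) = (2 * (\<Sum>a\<in>UNIV. x a * y a)) *\<^sub>R v - cl y (cl x v)"
  using cl_anti[of x y v] by (simp add: eq_diff_eq)

text \<open>Using the equation twice and \<open>J (J v) = - v\<close> shows that the sum of the
  squares of \<open>c\<close> and \<open>d\<close> annihilates \<open>v\<close>.\<close>

lemma J_indep:
  assumes "c *\<^sub>R v = d *\<^sub>R J v" "v \<noteq> 0"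
  shows "c = 0" "d = 0"
proof -
  have "c *\<^sub>R (c *\<^sub>R v) = d *\<^sub>R (c *\<^sub>R J v)"
    by (simp only: assms(1) scaleR_left_commute[of d c])
  also have "\<dots> = d *\<^sub>R J (c *\<^sub>R v)"
    by (simp only: J_simps(5))
  also have "\<dots> = - (d * d) *\<^sub>R v"
    by (simp add: assms(1) J_simps J_J)
  finally have "(c * c + d * d) *\<^sub>R v = 0"
    by (simp add: scaleR_add_left)
  then have "c * c + d * d = 0"
    using assms(2) by simp
  then show "c = 0" "d = 0"
    by (simp_all add: sum_squares_eq_zero_iff)
qed

text \<open>A real vector squares to a nonnegative scalar and \<open>d J\<close> to a nonpositive
  one, so on a nonzero spinor they agree only if both vanish. This is what allows equations between
  vectors to be read off from equations between spinors.\<close>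

lemma cl_J_indep:
  assumes "cl x v = d *\<^sub>R J v" "v \<noteq> 0"
  shows "x a = 0" "d = 0"
proof -
  have "(\<Sum>a\<in>UNIV. x a * x a) *\<^sub>R v = cl x (d *\<^sub>R J v)"
    by (simp add: cl_square[symmetric] assms(1))
  also have "\<dots> = - (d * d) *\<^sub>R v"
    by (simp add: cl_simps J_cl[symmetric] assms(1) J_simps J_J)
  finally have "((\<Sum>a\<in>UNIV. x a * x a) + d * d) *\<^sub>R v = 0"
    by (simp add: scaleR_add_left)
  then have z: "(\<Sum>a\<in>UNIV. x a * x a) + d * d = 0"
    using assms(2) by simp
  have nn: "(\<Sum>a\<in>UNIV. x a * x a) \<ge> 0" by (simp add: sum_nonneg)
  have "d * d \<ge> 0" by simp
  with z nn have "d * d = 0" "(\<Sum>a\<in>UNIV. x a * x a) = 0" by linarith+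
  then show "d = 0" "x a = 0"
    by (simp_all add: sum_nonneg_eq_0_iff)
qed

lemma cl_eq_0: "cl x v = 0 \<Longrightarrow> v \<noteq> 0 \<Longrightarrow> x a = 0"
  using cl_J_indep(1)[of x v 0 a] by simp

end

text \<open>The wedge square consists of three pairings of the four indices. The pairing that puts
  \<open>P t r\<close> on a single factor \<beta> is a trace and vanishes. The other two agree by
  skewness of \<open>P\<close> and reduce to the quadratic term, because the invariance of \<beta>
  says that \<open>P \<beta> P = - \<beta>\<close>. The 4 is the 2 of a wedge square times these two
  pairings.\<close>

lemma asd_wedge_contraction:
  fixes P \<beta> :: "'n::finite \<Rightarrow> 'n \<Rightarrow> real"
  assumes P_skew: "\<And>a b. P a b = - P b a" and b_skew: "\<And>a b. \<beta> a b = - \<beta> b a"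
    and inv: "\<And>a b. (\<Sum>c\<in>UNIV. \<Sum>d\<in>UNIV. P c a * P d b * \<beta> c d) = \<beta> a b"
    and tr: "(\<Sum>k\<in>UNIV. \<Sum>c\<in>UNIV. P c k * \<beta> k c) = 0"
  shows "(\<Sum>s\<in>UNIV. \<Sum>t\<in>UNIV. \<Sum>r\<in>UNIV. wedge22 \<beta> \<beta> m s t r * P t r * P s n)
    = 4 * (\<Sum>s\<in>UNIV. \<beta> m s * \<beta> n s)"
proof -
  have inv': "(\<Sum>c\<in>UNIV. \<Sum>d\<in>UNIV. P a c * \<beta> c d * P d b) = - \<beta> a b" for a b
  proof -
    have "(\<Sum>c\<in>UNIV. \<Sum>d\<in>UNIV. P a c * \<beta> c d * P d b) = - (\<Sum>c\<in>UNIV. \<Sum>d\<in>UNIV. P c a * P d b * \<beta> c d)"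
      unfolding sum_negf[symmetric] by (intro sum.cong refl) (subst P_skew, simp)
    then show ?thesis by (simp add: inv)
  qed
  have w: "wedge22 \<beta> \<beta> m s t r = 2 * (\<beta> m s * \<beta> t r - \<beta> m t * \<beta> s r + \<beta> m r * \<beta> s t)" for s t r
    by (simp add: wedge22_def)
  have tr': "(\<Sum>t\<in>UNIV. \<Sum>r\<in>UNIV. \<beta> t r * P t r) = 0"
  proof -
    have "(\<Sum>t\<in>UNIV. \<Sum>r\<in>UNIV. \<beta> t r * P t r) = - (\<Sum>k\<in>UNIV. \<Sum>c\<in>UNIV. P c k * \<beta> k c)"
      unfolding sum_negf[symmetric] by (intro sum.cong refl) (subst P_skew, simp)
    then show ?thesis by (simp add: tr)
  qed
  have A: "(\<Sum>s\<in>UNIV. \<Sum>t\<in>UNIV. \<Sum>r\<in>UNIV. \<beta> m s * \<beta> t r * P t r * P s n) = 0"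
  proof -
    have "(\<Sum>s\<in>UNIV. \<Sum>t\<in>UNIV. \<Sum>r\<in>UNIV. \<beta> m s * \<beta> t r * P t r * P s n)
      = (\<Sum>s\<in>UNIV. \<beta> m s * P s n * (\<Sum>t\<in>UNIV. \<Sum>r\<in>UNIV. \<beta> t r * P t r))"
      by (simp add: sum_distrib_left mult_ac)
    then show ?thesis by (simp add: tr')
  qed
  have B: "(\<Sum>s\<in>UNIV. \<Sum>t\<in>UNIV. \<Sum>r\<in>UNIV. \<beta> m r * \<beta> s t * P t r * P s n) = (\<Sum>s\<in>UNIV. \<beta> m s * \<beta> n s)"
  proof -
    have "(\<Sum>s\<in>UNIV. \<Sum>t\<in>UNIV. \<Sum>r\<in>UNIV. \<beta> m r * \<beta> s t * P t r * P s n)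
       = (\<Sum>r\<in>UNIV. \<Sum>s\<in>UNIV. \<Sum>t\<in>UNIV. \<beta> m r * \<beta> s t * P t r * P s n)"
      by (rule sum3_rotate[symmetric])
    also have "\<dots> = (\<Sum>r\<in>UNIV. \<Sum>s\<in>UNIV. \<Sum>t\<in>UNIV. - (\<beta> m r * (P n s * \<beta> s t * P t r)))"
      by (intro sum.cong refl) (subst (2) P_skew, simp)
    also have "\<dots> = (\<Sum>r\<in>UNIV. \<beta> m r * - (\<Sum>s\<in>UNIV. \<Sum>t\<in>UNIV. P n s * \<beta> s t * P t r))"
      by (simp add: sum_distrib_left sum_negf)
    finally show ?thesis by (simp add: inv')
  qed
  have C: "(\<Sum>s\<in>UNIV. \<Sum>t\<in>UNIV. \<Sum>r\<in>UNIV. \<beta> m t * \<beta> s r * P t r * P s n)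
     = - (\<Sum>s\<in>UNIV. \<Sum>t\<in>UNIV. \<Sum>r\<in>UNIV. \<beta> m r * \<beta> s t * P t r * P s n)"
    unfolding sum_negf[symmetric]
    by (rule sum.cong[OF refl], subst sum.swap, intro sum.cong refl, subst P_skew) simp
  have "(\<Sum>s\<in>UNIV. \<Sum>t\<in>UNIV. \<Sum>r\<in>UNIV. wedge22 \<beta> \<beta> m s t r * P t r * P s n)
    = 2 * ((\<Sum>s\<in>UNIV. \<Sum>t\<in>UNIV. \<Sum>r\<in>UNIV. \<beta> m s * \<beta> t r * P t r * P s n)
      - (\<Sum>s\<in>UNIV. \<Sum>t\<in>UNIV. \<Sum>r\<in>UNIV. \<beta> m t * \<beta> s r * P t r * P s n)
      + (\<Sum>s\<in>UNIV. \<Sum>t\<in>UNIV. \<Sum>r\<in>UNIV. \<beta> m r * \<beta> s t * P t r * P s n))"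
    unfolding w sum_subtractf[symmetric] sum.distrib[symmetric] sum_distrib_left
    by (simp only: algebra_simps)
  then show ?thesis by (simp add: A B C)
qed

text \<open>Clifford multiplication by \<open>X\<close> is \<open>J (cl X v)\<close>, so
  \<open>\<xi> \<cdot> \<epsilon> = \<i> \<epsilon>\<close> loses its factor \<open>\<i>\<close>. In
  the equation for \<psi> the vector \<xi> has been moved past \<open>X\<close>, which solves it for
  \<psi>. The skewness of \<open>P\<close> and its square are derived below from these two
  equations.\<close>

locale contact_spinor = complex_clifford_module G J
  for G :: "'n::finite \<Rightarrow> 'v::real_vector \<Rightarrow> 'v" and J +
  fixes \<epsilon> :: 'v and \<xi> :: "'n \<Rightarrow> real" and P :: "'n \<Rightarrow> 'n \<Rightarrow> real"
  assumes nonzero: "\<epsilon> \<noteq> 0" and xi_spinor: "cl \<xi> \<epsilon> = \<epsilon>"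
    and P_spinor: "J (cl (\<lambda>s. P s n) \<epsilon>) = G n \<epsilon> - \<xi> n *\<^sub>R \<epsilon>"
begin

lemma xi_unit: "(\<Sum>a\<in>UNIV. \<xi> a * \<xi> a) = 1"
proof -
  have "((\<Sum>a\<in>UNIV. \<xi> a * \<xi> a) - 1) *\<^sub>R \<epsilon> = 0"
    unfolding scaleR_diff_left cl_square[symmetric] by (simp add: xi_spinor)
  then show ?thesis using nonzero by simp
qed

text \<open>\<open>h n\<close> is the part of the n-th basis vector orthogonal to \<xi>. With it
  \<open>P_spinor\<close> says that \<open>J\<close> carries the n-th column of \<open>P\<close>,
  acting on \<epsilon>, to \<open>h n\<close> acting on \<epsilon>.\<close>

definition h :: "'n \<Rightarrow> 'n \<Rightarrow> real" where
  "h n s = (if s = n then 1 else 0) - \<xi> n * \<xi> s"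

lemma cl_h: "cl (h n) \<epsilon> = G n \<epsilon> - \<xi> n *\<^sub>R \<epsilon>"
proof -
  have "cl (\<lambda>s. if s = n then 1 else 0) \<epsilon> = G n \<epsilon>"
    by (simp add: cl_def if_distrib[of "\<lambda>r. r *\<^sub>R _"] cong: if_cong)
  then show ?thesis
    by (simp add: h_def[abs_def] cl_vec_diff cl_vec_scale xi_spinor)
qed

lemma h_dot: "(\<Sum>s\<in>UNIV. x s * h n s) = x n - \<xi> n * (\<Sum>s\<in>UNIV. x s * \<xi> s)"
proof -
  have "x s * h n s = (if s = n then x s else 0) - \<xi> n * (x s * \<xi> s)" for s
    by (simp add: h_def algebra_simps)
  then show ?thesis by (simp add: sum_subtractf sum_distrib_left)
qed

text \<open>Since \<open>h n\<close> is orthogonal to \<xi>, multiplication by \<xi> changes the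
  sign of \<open>cl (h n) \<epsilon>\<close>. Computed through the column of \<open>P\<close>
  instead, it changes the sign up to a multiple of \<open>J \<epsilon>\<close>, whose coefficient is
  twice the product in question.\<close>

lemma xi_P: "(\<Sum>s\<in>UNIV. \<xi> s * P s n) = 0"
proof -
  define y where "y = (\<lambda>s. P s n)"
  have e: "J (cl y \<epsilon>) = cl (h n) \<epsilon>"
    by (simp add: cl_h y_def P_spinor)
  have "cl \<xi> (J (cl y \<epsilon>)) = J ((2 * (\<Sum>s\<in>UNIV. \<xi> s * y s)) *\<^sub>R \<epsilon> - cl y \<epsilon>)"
    by (simp only: J_cl[symmetric] cl_swap[of \<xi> y] xi_spinor)
  also have "\<dots> = (2 * (\<Sum>s\<in>UNIV. \<xi> s * y s)) *\<^sub>R J \<epsilon> - cl (h n) \<epsilon>"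
    by (simp add: J_simps e)
  finally have 1: "cl \<xi> (cl (h n) \<epsilon>) = (2 * (\<Sum>s\<in>UNIV. \<xi> s * y s)) *\<^sub>R J \<epsilon> - cl (h n) \<epsilon>"
    by (simp add: e)
  have "(\<Sum>s\<in>UNIV. \<xi> s * h n s) = 0"
    by (simp add: h_dot xi_unit)
  then have "cl \<xi> (cl (h n) \<epsilon>) = - cl (h n) \<epsilon>"
    using cl_anti[of \<xi> "h n" \<epsilon>] by (simp add: xi_spinor eq_neg_iff_add_eq_0)
  with 1 have "0 *\<^sub>R \<epsilon> = (2 * (\<Sum>s\<in>UNIV. \<xi> s * y s)) *\<^sub>R J \<epsilon>"
    by simp
  from J_indep(2)[OF this nonzero] show ?thesis
    by (simp add: y_def)
qed

text \<open>Rewriting \<open>h m\<close> and \<open>h n\<close> through the columns of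
  \<open>P\<close> turns their product on \<epsilon> into the product of the columns plus a multiple
  of \<open>J \<epsilon>\<close>. After symmetrization both products are real scalars, so the
  \<open>J \<epsilon>\<close> terms must cancel; their coefficient is the symmetric part of
  \<open>P\<close>.\<close>

lemma P_skew: "P m n = - P n m"
proof -
  define y z where "y = (\<lambda>s. P s m)" and "z = (\<lambda>s. P s n)"
  have e: "J (cl y \<epsilon>) = cl (h m) \<epsilon>" "J (cl z \<epsilon>) = cl (h n) \<epsilon>"
    by (simp_all add: cl_h y_def z_def P_spinor)
  have key: "cl (h m) (cl (h n) \<epsilon>) = cl z (cl y \<epsilon>) + (2 * (\<Sum>s\<in>UNIV. z s * h m s)) *\<^sub>R J \<epsilon>"
    if "J (cl y \<epsilon>) = cl (h m) \<epsilon>" "J (cl z \<epsilon>) = cl (h n) \<epsilon>" for y z m n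
  proof -
    have "cl (h m) (cl (h n) \<epsilon>) = J (cl (h m) (cl z \<epsilon>))"
      by (simp add: that(2)[symmetric] J_cl)
    also have "\<dots> = J ((2 * (\<Sum>s\<in>UNIV. z s * h m s)) *\<^sub>R \<epsilon> - cl z (cl (h m) \<epsilon>))"
      by (simp only: cl_swap[of "h m" z] mult.commute)
    also have "\<dots> = (2 * (\<Sum>s\<in>UNIV. z s * h m s)) *\<^sub>R J \<epsilon> - J (cl z (J (cl y \<epsilon>)))"
      by (simp add: J_simps that(1))
    also have "J (cl z (J (cl y \<epsilon>))) = - cl z (cl y \<epsilon>)"
      by (simp add: J_cl[symmetric] J_J)
    finally show ?thesis by simp
  qed
  have "(2 * (\<Sum>s\<in>UNIV. h m s * h n s)) *\<^sub>R \<epsilon> = (2 * (\<Sum>s\<in>UNIV. z s * y s)) *\<^sub>R \<epsilon>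
     + (2 * (\<Sum>s\<in>UNIV. z s * h m s) + 2 * (\<Sum>s\<in>UNIV. y s * h n s)) *\<^sub>R J \<epsilon>"
    unfolding cl_anti[symmetric]
    using key[OF e] key[OF e(2,1)] by (simp add: scaleR_add_left)
  then have "(2 * (\<Sum>s\<in>UNIV. h m s * h n s) - 2 * (\<Sum>s\<in>UNIV. z s * y s)) *\<^sub>R \<epsilon>
     = (2 * (\<Sum>s\<in>UNIV. z s * h m s) + 2 * (\<Sum>s\<in>UNIV. y s * h n s)) *\<^sub>R J \<epsilon>"
    by (simp add: scaleR_diff_left)
  from J_indep(2)[OF this nonzero]
  have "(\<Sum>s\<in>UNIV. z s * h m s) + (\<Sum>s\<in>UNIV. y s * h n s) = 0"
    by linarith
  moreover have "(\<Sum>s\<in>UNIV. z s * \<xi> s) = 0" "(\<Sum>s\<in>UNIV. y s * \<xi> s) = 0"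
    using xi_P by (simp_all add: y_def z_def mult.commute)
  ultimately show ?thesis
    by (simp add: h_dot y_def z_def)
qed

lemma P_spinor_vec: "J (cl (\<lambda>s. \<Sum>n\<in>UNIV. P s n * x n) \<epsilon>) = cl x \<epsilon> - (\<Sum>n\<in>UNIV. \<xi> n * x n) *\<^sub>R \<epsilon>"
proof -
  have "J (cl (\<lambda>s. \<Sum>n\<in>UNIV. P s n * x n) \<epsilon>) = (\<Sum>n\<in>UNIV. J (cl (\<lambda>s. x n * P s n) \<epsilon>))"
    by (simp add: cl_vec_sum J_simps mult.commute)
  also have "\<dots> = (\<Sum>n\<in>UNIV. x n *\<^sub>R (G n \<epsilon> - \<xi> n *\<^sub>R \<epsilon>))"
    by (simp add: cl_vec_scale J_simps P_spinor)
  finally show ?thesis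
    by (simp add: cl_def scaleR_diff_right sum_subtractf scaleR_sum_left mult.commute)
qed

lemma P_square: "(\<Sum>k\<in>UNIV. P a k * P k n) = - h n a"
proof -
  have "J (cl (\<lambda>s. \<Sum>k\<in>UNIV. P s k * P k n) \<epsilon>) = cl (\<lambda>s. P s n) \<epsilon>"
    by (simp add: P_spinor_vec xi_P)
  then have "cl (h n) \<epsilon> = - cl (\<lambda>s. \<Sum>k\<in>UNIV. P s k * P k n) \<epsilon>"
    using J_J[of "cl (\<lambda>s. \<Sum>k\<in>UNIV. P s k * P k n) \<epsilon>"] by (simp add: P_spinor cl_h)
  then have "cl (\<lambda>s. (\<Sum>k\<in>UNIV. P s k * P k n) + h n s) \<epsilon> = 0"
    by (simp only: cl_vec_add) simp
  from cl_eq_0[OF this nonzero] show ?thesis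
    by (simp add: eq_neg_iff_add_eq_0)
qed

lemma P_xi: "(\<Sum>k\<in>UNIV. P a k * \<xi> k) = 0"
proof -
  have "(\<Sum>k\<in>UNIV. P a k * \<xi> k) = - (\<Sum>k\<in>UNIV. \<xi> k * P k a)"
    unfolding sum_negf[symmetric] by (intro sum.cong refl) (subst P_skew, simp)
  then show ?thesis by (simp add: xi_P)
qed

text \<open>\<open>\<beta>\<close> annihilates \<open>\<epsilon>\<close> but rotates the vectors in the equations defining \<open>\<xi>\<close> and \<open>P\<close>, so acting
  with it on these equations shows that \<open>\<beta>\<close> is compatible with them.\<close>

lemma instanton_of_cl2:
  assumes b_skew: "\<And>a b. \<beta> a b = - \<beta> b a" and kill: "cl2 \<beta> \<epsilon> = 0"
  shows "(\<Sum>c\<in>UNIV. \<Sum>d\<in>UNIV. P c a * P d b * \<beta> c d) = \<beta> a b"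
    and "(\<Sum>k\<in>UNIV. \<Sum>c\<in>UNIV. P c k * \<beta> k c) = 0"
proof -
  have sp: "spin_act \<beta> \<epsilon> = 0"
    by (simp add: spin_act_def kill)
  have bxi: "(\<Sum>t\<in>UNIV. \<beta> s t * \<xi> t) = 0" for s
  proof -
    have "cl (\<lambda>s. \<Sum>t\<in>UNIV. \<beta> s t * \<xi> t) \<epsilon> = 0"
      using spin_act_cl[where A = \<beta> and x = \<xi> and v = \<epsilon>, OF b_skew] by (simp add: xi_spinor sp cl_simps)
    then show ?thesis by (rule cl_eq_0) (rule nonzero)
  qed
  have 1: "J (cl (\<lambda>s. \<Sum>t\<in>UNIV. \<beta> s t * P t n) \<epsilon>) = cl (\<lambda>s. \<beta> s n) \<epsilon>" for n
  proof -
    have "spin_act \<beta> (J (cl (\<lambda>s. P s n) \<epsilon>)) = J (cl (\<lambda>s. \<Sum>t\<in>UNIV. \<beta> s t * P t n) \<epsilon>)"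
      by (simp add: J_spin_act[symmetric] spin_act_cl[OF b_skew] sp cl_simps)
    moreover have "spin_act \<beta> (G n \<epsilon> - \<xi> n *\<^sub>R \<epsilon>) = cl (\<lambda>s. \<beta> s n) \<epsilon>"
      by (simp add: spin_act_simps spin_act_G[OF b_skew] sp G_zero)
    ultimately show ?thesis by (simp add: P_spinor)
  qed
  have xb: "(\<Sum>s\<in>UNIV. \<xi> s * (\<Sum>t\<in>UNIV. \<beta> s t * P t n)) = 0" for n
  proof -
    have "(\<Sum>s\<in>UNIV. \<xi> s * (\<Sum>t\<in>UNIV. \<beta> s t * P t n)) = (\<Sum>t\<in>UNIV. \<Sum>s\<in>UNIV. \<xi> s * (\<beta> s t * P t n))"
      by (simp only: sum_distrib_left) (rule sum.swap)
    also have "\<dots> = (\<Sum>t\<in>UNIV. - (P t n * (\<Sum>s\<in>UNIV. \<beta> t s * \<xi> s)))"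
      unfolding sum_distrib_left sum_negf[symmetric]
      by (intro sum.cong refl) (subst b_skew, simp)
    finally show ?thesis by (simp add: bxi)
  qed
  have pbp: "(\<Sum>c\<in>UNIV. P a c * (\<Sum>d\<in>UNIV. \<beta> c d * P d b)) = - \<beta> a b" for a b
  proof -
    have "J (J (cl (\<lambda>s. \<Sum>c\<in>UNIV. P s c * (\<Sum>d\<in>UNIV. \<beta> c d * P d b)) \<epsilon>))
       = J (cl (\<lambda>s. \<Sum>t\<in>UNIV. \<beta> s t * P t b) \<epsilon>)"
      by (simp only: P_spinor_vec xb) simp
    then have "cl (\<lambda>s. \<beta> s b) \<epsilon> = - cl (\<lambda>s. \<Sum>c\<in>UNIV. P s c * (\<Sum>d\<in>UNIV. \<beta> c d * P d b)) \<epsilon>"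
      by (simp only: J_J 1)
    then have "cl (\<lambda>s. (\<Sum>c\<in>UNIV. P s c * (\<Sum>d\<in>UNIV. \<beta> c d * P d b)) + \<beta> s b) \<epsilon> = 0"
      by (simp only: cl_vec_add) simp
    from cl_eq_0[OF this nonzero] show ?thesis
      by (simp add: eq_neg_iff_add_eq_0)
  qed
  show "(\<Sum>c\<in>UNIV. \<Sum>d\<in>UNIV. P c a * P d b * \<beta> c d) = \<beta> a b" for a b
  proof -
    have "(\<Sum>c\<in>UNIV. \<Sum>d\<in>UNIV. P c a * P d b * \<beta> c d) = - (\<Sum>c\<in>UNIV. P a c * (\<Sum>d\<in>UNIV. \<beta> c d * P d b))"
      unfolding sum_distrib_left sum_negf[symmetric] by (intro sum.cong refl) (subst P_skew, simp)
    then show ?thesis by (simp add: pbp)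
  qed
  define M where "M a b = (\<Sum>d\<in>UNIV. \<beta> a d * P d b)" for a b
  \<comment> \<open>\<open>P\<close> commutes with \<beta>: multiply
    \<open>P \<beta> P = - \<beta>\<close> by \<open>P\<close> from the right and use that
    \<open>P\<close> squares to \<open>- h\<close> while \<beta> annihilates \<xi>. Two skew
    matrices that commute have a symmetric product.\<close>
  have comm: "(\<Sum>c\<in>UNIV. P a c * \<beta> c b) = M a b" for a b
  proof -
    have "(\<Sum>b\<in>UNIV. (\<Sum>c\<in>UNIV. P a c * M c b) * P b n) = (\<Sum>c\<in>UNIV. P a c * (\<Sum>d\<in>UNIV. \<beta> c d * (\<Sum>b\<in>UNIV. P d b * P b n)))" for n
    proof -
      have inner: "(\<Sum>b\<in>UNIV. M c b * P b n) = (\<Sum>d\<in>UNIV. \<beta> c d * (\<Sum>b\<in>UNIV. P d b * P b n))" for c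
        unfolding M_def sum_distrib_left sum_distrib_right by (subst sum.swap) (simp add: mult.assoc)
      have "(\<Sum>b\<in>UNIV. (\<Sum>c\<in>UNIV. P a c * M c b) * P b n)
         = (\<Sum>c\<in>UNIV. P a c * (\<Sum>b\<in>UNIV. M c b * P b n))"
        unfolding sum_distrib_left sum_distrib_right by (subst sum.swap) (simp add: mult.assoc)
      then show ?thesis by (simp only: inner)
    qed
    from this[of b] have "M a b = (\<Sum>c\<in>UNIV. P a c * (\<Sum>d\<in>UNIV. \<beta> c d * h b d))"
      by (simp only: P_square pbp[folded M_def]) (simp add: sum_negf M_def)
    then show ?thesis by (simp add: h_dot bxi)
  qed
  have M_sym: "M a b = M b a" for a b
  proof -
    have "M a b = (\<Sum>d\<in>UNIV. P b d * \<beta> d a)"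
      unfolding M_def by (intro sum.cong refl) (subst b_skew, subst P_skew, simp)
    then show ?thesis by (simp add: comm)
  qed
  have symsum: "2 *\<^sub>R cl2 M \<epsilon> = (2 * (\<Sum>a\<in>UNIV. M a a)) *\<^sub>R \<epsilon>"
  proof -
    have "cl2 M \<epsilon> = (\<Sum>a\<in>UNIV. \<Sum>b\<in>UNIV. M a b *\<^sub>R G b (G a \<epsilon>))"
      unfolding cl2_def by (subst sum.swap) (simp add: M_sym)
    then have "2 *\<^sub>R cl2 M \<epsilon> = (\<Sum>a\<in>UNIV. \<Sum>b\<in>UNIV. M a b *\<^sub>R (G a (G b \<epsilon>) + G b (G a \<epsilon>)))"
      by (simp add: scaleR_2 cl2_def sum.distrib scaleR_add_right)
    also have "\<dots> = (\<Sum>a\<in>UNIV. \<Sum>b\<in>UNIV. if a = b then (2 * M a b) *\<^sub>R \<epsilon> else 0)"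
      by (intro sum.cong refl) (simp add: G_anti)
    finally show ?thesis by (simp add: sum_distrib_left scaleR_sum_left)
  qed
  \<comment> \<open>Replacing the inner \<open>G b \<epsilon>\<close> by means of
    \<open>P_spinor\<close> turns \<open>cl2 \<beta> \<epsilon>\<close> into
    \<open>- J (cl2 M \<epsilon>)\<close>, and the symmetric \<open>M\<close> acts through its
    trace.\<close>
  have "cl2 \<beta> \<epsilon> = (\<Sum>a\<in>UNIV. \<Sum>b\<in>UNIV. \<beta> a b *\<^sub>R G a (J (cl (\<lambda>s. P s b) \<epsilon>)))
      + (\<Sum>a\<in>UNIV. \<Sum>b\<in>UNIV. (\<beta> a b * \<xi> b) *\<^sub>R G a \<epsilon>)"
    by (simp add: cl2_def P_spinor G_diff G_scale sum.distrib[symmetric] algebra_simps)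
  also have "(\<Sum>a\<in>UNIV. \<Sum>b\<in>UNIV. (\<beta> a b * \<xi> b) *\<^sub>R G a \<epsilon>) = 0"
    by (simp add: scaleR_sum_left[symmetric] bxi)
  also have "(\<Sum>a\<in>UNIV. \<Sum>b\<in>UNIV. \<beta> a b *\<^sub>R G a (J (cl (\<lambda>s. P s b) \<epsilon>)))
      = J (\<Sum>a\<in>UNIV. \<Sum>b\<in>UNIV. \<Sum>s\<in>UNIV. (\<beta> a b * P s b) *\<^sub>R G a (G s \<epsilon>))"
    by (simp add: cl_def J_simps J_G G_sum G_scale scaleR_sum_right)
  also have "(\<Sum>a\<in>UNIV. \<Sum>b\<in>UNIV. \<Sum>s\<in>UNIV. (\<beta> a b * P s b) *\<^sub>R G a (G s \<epsilon>)) = - cl2 M \<epsilon>"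
  proof -
    have "(\<Sum>b\<in>UNIV. \<Sum>s\<in>UNIV. (\<beta> a b * P s b) *\<^sub>R G a (G s \<epsilon>)) = (\<Sum>s\<in>UNIV. - (M a s *\<^sub>R G a (G s \<epsilon>)))" for a
    proof -
      have "(\<Sum>b\<in>UNIV. \<Sum>s\<in>UNIV. (\<beta> a b * P s b) *\<^sub>R G a (G s \<epsilon>))
        = (\<Sum>s\<in>UNIV. \<Sum>b\<in>UNIV. (\<beta> a b * P s b) *\<^sub>R G a (G s \<epsilon>))"
        by (rule sum.swap)
      also have "\<dots> = (\<Sum>s\<in>UNIV. - (M a s *\<^sub>R G a (G s \<epsilon>)))"
        unfolding M_def scaleR_sum_left sum_negf[symmetric]
        by (intro sum.cong refl) (subst P_skew, simp)
      finally show ?thesis .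
    qed
    then show ?thesis by (simp add: cl2_def sum_negf)
  qed
  finally have "cl2 M \<epsilon> = 0"
    using J_J[of "cl2 M \<epsilon>"] kill by (simp add: J_simps)
  then have "(\<Sum>a\<in>UNIV. M a a) = 0"
    using symsum nonzero by simp
  then show "(\<Sum>k\<in>UNIV. \<Sum>c\<in>UNIV. P c k * \<beta> k c) = 0"
    by (simp add: M_def mult.commute)
qed

end

section \<open>Four-forms on a Clifford module of dimension five\<close>

lemma exhaust_5:
  fixes x :: 5
  shows "x = 1 \<or> x = 2 \<or> x = 3 \<or> x = 4 \<or> x = 5"
proof (induct x)
  case (of_int z)
  \<comment> \<open>In this type \<open>5 = 0\<close>, so the representative 0 is the fifth
    index.\<close>
  then have "z = 0 \<or> z = 1 \<or> z = 2 \<or> z = 3 \<or> z = 4" by fastforce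
  then show ?case by auto
qed

lemma UNIV_5: "UNIV = {1, 2, 3, 4, 5::5}"
  using exhaust_5 by auto

lemma sum_5: "sum f (UNIV::5 set) = f 1 + f 2 + f 3 + f 4 + f 5"
  unfolding UNIV_5 by (simp add: ac_simps)

lemma unit_orthogonal_exists:
  fixes S :: "'a::euclidean_space set"
  assumes "finite S" "card S < DIM('a)"
  obtains u where "norm u = 1" "\<And>y. y \<in> S \<Longrightarrow> u \<bullet> y = 0"
proof -
  have "dim S < DIM('a)"
    using assms dim_le_card'[of S] by linarith
  then obtain x where x: "x \<noteq> 0" "\<And>y. y \<in> span S \<Longrightarrow> orthogonal x y"
    using orthogonal_to_subspace_exists by blast
  show ?thesis
  proof
    show "norm (x /\<^sub>R norm x) = 1" using x(1) by simp
    show "(x /\<^sub>R norm x) \<bullet> y = 0" if "y \<in> S" for y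
      using x(2)[OF span_base[OF that]] by (simp add: orthogonal_def)
  qed
qed

context complex_clifford_module
begin

lemma J_indep_sum:
  assumes "a *\<^sub>R w + b *\<^sub>R J w = 0" "w \<noteq> 0"
  shows "a = 0" "b = 0"
  using J_indep[of a w "- b"] assms by (simp_all add: eq_neg_iff_add_eq_0)

text \<open>The involutions \<open>J G\<^sub>1 G\<^sub>2\<close> and \<open>J G\<^sub>3 G\<^sub>4\<close> commute and separate the four vectors by their
  joint eigenvalues.\<close>

lemma adapted_indep:
  assumes distinct: "i \<noteq> j" "i \<noteq> k" "i \<noteq> l" "j \<noteq> k" "j \<noteq> l" "k \<noteq> l" and nz: "\<epsilon> \<noteq> 0"
    and g: "G j \<epsilon> = - J (G i \<epsilon>)" "G l \<epsilon> = - J (G k \<epsilon>)"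
    and z: "a0 *\<^sub>R \<epsilon> + b0 *\<^sub>R J \<epsilon> + (a1 *\<^sub>R G i \<epsilon> + b1 *\<^sub>R J (G i \<epsilon>))
      + (a2 *\<^sub>R G k \<epsilon> + b2 *\<^sub>R J (G k \<epsilon>)) + (a3 *\<^sub>R G i (G k \<epsilon>) + b3 *\<^sub>R J (G i (G k \<epsilon>))) = 0"
  shows "a0 = 0 \<and> b0 = 0 \<and> a1 = 0 \<and> b1 = 0 \<and> a2 = 0 \<and> b2 = 0 \<and> a3 = 0 \<and> b3 = 0"
proof -
  define A where "A v = J (G i (G j v))" for v
  define B where "B v = J (G k (G l v))" for v
  have lin: "linear A" "linear B"
    unfolding A_def B_def by (auto intro!: linearI simp: J_simps G_add G_scale)
  have AJ: "A (J v) = J (A v)" "B (J v) = J (B v)" for v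
    by (simp_all add: A_def B_def J_G)
  have anti: "G x (G y v) = - G y (G x v)" if "x \<noteq> y" for x y v
    using G_swap[of x y v] that by simp
  have A0: "A \<epsilon> = \<epsilon>" "B \<epsilon> = \<epsilon>"
    by (simp_all add: A_def B_def g G_neg J_simps J_G[symmetric] J_J G_square)
  have AG: "A (G i v) = - G i (A v)" "A (G k v) = G k (A v)" for v
    using distinct
    by (simp_all add: A_def J_G[symmetric] G_neg J_simps anti[of j i] anti[of j k] anti[of i k])
  have BG: "B (G i v) = G i (B v)" "B (G k v) = - G k (B v)" for v
    using distinct
    by (simp_all add: B_def J_G[symmetric] G_neg J_simps anti[of l i] anti[of k i] anti[of l k])
  define p0 where "p0 = a0 *\<^sub>R \<epsilon> + b0 *\<^sub>R J \<epsilon>"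
  define p1 where "p1 = a1 *\<^sub>R G i \<epsilon> + b1 *\<^sub>R J (G i \<epsilon>)"
  define p2 where "p2 = a2 *\<^sub>R G k \<epsilon> + b2 *\<^sub>R J (G k \<epsilon>)"
  define p3 where "p3 = a3 *\<^sub>R G i (G k \<epsilon>) + b3 *\<^sub>R J (G i (G k \<epsilon>))"
  note ls = linear_add[OF lin(1)] linear_add[OF lin(2)] linear_scale[OF lin(1)] linear_scale[OF lin(2)]
    linear_neg[OF lin(1)] linear_neg[OF lin(2)]
  have Ap: "A p0 = p0" "A p1 = - p1" "A p2 = p2" "A p3 = - p3"
    by (simp_all add: p0_def p1_def p2_def p3_def ls AJ AG A0 J_simps)
  have Bp: "B p0 = p0" "B p1 = p1" "B p2 = - p2" "B p3 = - p3"
    by (simp_all add: p0_def p1_def p2_def p3_def ls AJ BG A0 J_simps G_neg)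
  have z0: "p0 + p1 + p2 + p3 = 0"
    using z by (simp add: p0_def p1_def p2_def p3_def)
  have S: "A (p0 + p1 + p2 + p3) = p0 - p1 + p2 - p3" "B (p0 + p1 + p2 + p3) = p0 + p1 - p2 - p3"
    "B (p0 - p1 + p2 - p3) = p0 - p1 - p2 + p3"
    using linear_diff[OF lin(2)] by (simp_all add: ls Ap Bp)
  have z1: "p0 - p1 + p2 - p3 = 0" "p0 + p1 - p2 - p3 = 0"
    using S(1,2) by (simp_all only: z0 linear_0[OF lin(1)] linear_0[OF lin(2)])
  moreover have "p0 - p1 - p2 + p3 = 0"
    using S(3) by (simp only: z1 linear_0[OF lin(2)])
  ultimately have z1: "p0 - p1 + p2 - p3 = 0" "p0 + p1 - p2 - p3 = 0" "p0 - p1 - p2 + p3 = 0"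
    by blast+
  have "4 *\<^sub>R p0 = (p0 + p1 + p2 + p3) + (p0 - p1 + p2 - p3) + (p0 + p1 - p2 - p3) + (p0 - p1 - p2 + p3)"
    using scaleR_add_left[of 2 2 p0] by (simp add: scaleR_2)
  then have p0: "p0 = 0" by (simp only: z0 z1) simp
  have "4 *\<^sub>R p1 = (p0 + p1 + p2 + p3) - (p0 - p1 + p2 - p3) + (p0 + p1 - p2 - p3) - (p0 - p1 - p2 + p3)"
    using scaleR_add_left[of 2 2 p1] by (simp add: scaleR_2)
  then have p1: "p1 = 0" by (simp only: z0 z1) simp
  have "4 *\<^sub>R p2 = (p0 + p1 + p2 + p3) + (p0 - p1 + p2 - p3) - (p0 + p1 - p2 - p3) - (p0 - p1 - p2 + p3)"
    using scaleR_add_left[of 2 2 p2] by (simp add: scaleR_2)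
  then have p2: "p2 = 0" by (simp only: z0 z1) simp
  have p3: "p3 = 0" using z0 p0 p1 p2 by simp
  have Gnz: "G x v \<noteq> 0" if "v \<noteq> 0" for x v
    using that G_square[of x v] G_zero by fastforce
  show ?thesis
    using J_indep_sum[OF p0[unfolded p0_def] nz] J_indep_sum[OF p1[unfolded p1_def] Gnz[OF nz]]
      J_indep_sum[OF p2[unfolded p2_def] Gnz[OF nz]] J_indep_sum[OF p3[unfolded p3_def] Gnz[OF Gnz[OF nz]]]
    by simp
qed

end

text \<open>The relations for \<open>G 2\<close>, \<open>G 4\<close> and \<open>G 5\<close> reduce
  every product on \<epsilon> to a complex multiple of \<open>\<epsilon>\<close>,
  \<open>G 1 \<epsilon>\<close>, \<open>G 3 \<epsilon>\<close> or
  \<open>G 1 (G 3 \<epsilon>)\<close>, so by \<open>adapted_indep\<close> the spinor equation splits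
  into eight real ones. The 1/2 is 6/12: each component of \<open>X\<close> occurs in six
  orders.\<close>

lemma adapted_three_form:
  fixes G :: "5 \<Rightarrow> 'v \<Rightarrow> 'v::real_vector" and X :: "5 \<Rightarrow> 5 \<Rightarrow> 5 \<Rightarrow> real"
  assumes "complex_clifford_module G J" and nz: "\<epsilon> \<noteq> 0"
    and g5: "G 5 \<epsilon> = \<epsilon>" and g: "G 2 \<epsilon> = - J (G 1 \<epsilon>)" "G 4 \<epsilon> = - J (G 3 \<epsilon>)"
    and X: "\<And>a b c. X a b c = - X b a c" "\<And>a b c. X a b c = - X a c b"
    and eq: "clifford_module.cl G q \<epsilon> + (1/12) *\<^sub>R clifford_module.cl3 G X \<epsilon> = 0"
  shows "q 5 = 0 \<and> X 1 2 5 + X 3 4 5 = 0 \<and> q 1 = X 2 3 4 / 2 \<and> q 2 = - X 1 3 4 / 2 \<and>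
    q 3 = X 1 2 4 / 2 \<and> q 4 = - X 1 2 3 / 2 \<and> X 1 3 5 = X 2 4 5 \<and> X 1 4 5 = - X 2 3 5"
proof -
  interpret complex_clifford_module G J by fact
  have X0: "X a a c = 0" "X a c c = 0" "X a c a = 0" for a c
    using X(1)[of a a c] X(2)[of a c c] X(2)[of a c a] X(1)[of a a c] by simp_all
  have anti: "G x (G y v) = - G y (G x v)" if "x \<noteq> y" for x y v
    using G_swap[of x y v] that by simp
  note Gs = anti[of 2 1] anti[of 3 1] anti[of 4 1] anti[of 5 1] anti[of 3 2] anti[of 4 2] anti[of 5 2]
    anti[of 4 3] anti[of 5 3] anti[of 5 4]
  note Xs = X(1)[of 2 1] X(1)[of 3 1] X(1)[of 4 1] X(1)[of 5 1] X(1)[of 3 2] X(1)[of 4 2] X(1)[of 5 2]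
    X(1)[of 4 3] X(1)[of 5 3] X(1)[of 5 4]
    X(2)[of _ 2 1] X(2)[of _ 3 1] X(2)[of _ 4 1] X(2)[of _ 5 1] X(2)[of _ 3 2] X(2)[of _ 4 2] X(2)[of _ 5 2]
    X(2)[of _ 4 3] X(2)[of _ 5 3] X(2)[of _ 5 4]
  have g23: "G 2 (G 3 \<epsilon>) = - J (G 1 (G 3 \<epsilon>))"
  proof -
    have "G 2 (G 3 \<epsilon>) = - G 3 (G 2 \<epsilon>)" by (rule anti) simp
    also have "\<dots> = J (G 3 (G 1 \<epsilon>))" by (simp add: g G_neg J_G)
    also have "G 3 (G 1 \<epsilon>) = - G 1 (G 3 \<epsilon>)" by (rule anti) simp
    finally show ?thesis by (simp add: J_simps)
  qed
  have exp: "cl3 X \<epsilon> = 6 *\<^sub>R (X 1 2 3 *\<^sub>R G 1 (G 2 (G 3 \<epsilon>)) + X 1 2 4 *\<^sub>R G 1 (G 2 (G 4 \<epsilon>))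
     + X 1 2 5 *\<^sub>R G 1 (G 2 (G 5 \<epsilon>)) + X 1 3 4 *\<^sub>R G 1 (G 3 (G 4 \<epsilon>)) + X 1 3 5 *\<^sub>R G 1 (G 3 (G 5 \<epsilon>))
     + X 1 4 5 *\<^sub>R G 1 (G 4 (G 5 \<epsilon>)) + X 2 3 4 *\<^sub>R G 2 (G 3 (G 4 \<epsilon>)) + X 2 3 5 *\<^sub>R G 2 (G 3 (G 5 \<epsilon>))
     + X 2 4 5 *\<^sub>R G 2 (G 4 (G 5 \<epsilon>)) + X 3 4 5 *\<^sub>R G 3 (G 4 (G 5 \<epsilon>)))"
  proof -
    have six: "6 *\<^sub>R v = v + v + v + v + v + v" for v :: 'v
    proof -
      have "6 *\<^sub>R v = (1 + 1 + 1 + 1 + 1 + 1) *\<^sub>R v" by simp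
      then show ?thesis by (simp only: scaleR_add_left scaleR_one)
    qed
    show ?thesis
      unfolding cl3_def sum_5 six
      by (simp add: X0 Xs Gs G_neg)
  qed
  have "q 5 *\<^sub>R \<epsilon> + (- (X 1 2 5 + X 3 4 5) / 2) *\<^sub>R J \<epsilon> 
      + ((q 1 - X 2 3 4 / 2) *\<^sub>R G 1 \<epsilon> + (- q 2 - X 1 3 4 / 2) *\<^sub>R J (G 1 \<epsilon>))
      + ((q 3 - X 1 2 4 / 2) *\<^sub>R G 3 \<epsilon> + (- q 4 - X 1 2 3 / 2) *\<^sub>R J (G 3 \<epsilon>))
      + (((X 1 3 5 - X 2 4 5) / 2) *\<^sub>R G 1 (G 3 \<epsilon>) + (- (X 1 4 5 + X 2 3 5) / 2) *\<^sub>R J (G 1 (G 3 \<epsilon>))) = 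
      cl q \<epsilon> + (1/12) *\<^sub>R cl3 X \<epsilon>" (is "?v = _")
    unfolding exp cl_def sum_5
    by (simp add: g5 g g23 G_neg J_G[symmetric] J_simps J_J G_square scaleR_add_left scaleR_diff_left
        scaleR_add_right scaleR_diff_right add_divide_distrib diff_divide_distrib)
  then have "?v = 0" by (simp only: eq)
  from adapted_indep[OF _ _ _ _ _ _ nz g this] show ?thesis
    by (simp add: field_simps)
qed

text \<open>The matrix of \<psi> in a frame of the form
  \<open>u, \<psi> u, w, \<psi> w, \<xi>\<close>; column \<open>n\<close> is the image of the n-th
  vector.\<close>

definition adapted_endo :: "5 \<Rightarrow> 5 \<Rightarrow> real" where
  "adapted_endo s n = (if s = 2 \<and> n = 1 \<or> s = 4 \<and> n = 3 then 1
     else if s = 1 \<and> n = 2 \<or> s = 3 \<and> n = 4 then - 1 else 0)"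

text \<open>Skewness in the first index couples the equations for the five three-forms
  \<open>T a\<close>. They force every component with an index 5 to vanish, so
  \<open>T 1 2 3 4\<close> is the only one left, and \<open>Q\<close> is half of it times the
  projection orthogonal to the fifth vector. The contraction on the right has the same
  value.\<close>

lemma adapted_four_form:
  fixes G :: "5 \<Rightarrow> 'v \<Rightarrow> 'v::real_vector" and T :: "5 \<Rightarrow> 5 \<Rightarrow> 5 \<Rightarrow> 5 \<Rightarrow> real"
  assumes mod: "complex_clifford_module G J" and nz: "\<epsilon> \<noteq> 0"
    and g5: "G 5 \<epsilon> = \<epsilon>" and g: "G 2 \<epsilon> = - J (G 1 \<epsilon>)" "G 4 \<epsilon> = - J (G 3 \<epsilon>)"
    and T: "\<And>a b c d. T a b c d = - T b a c d" "\<And>a b c d. T a b c d = - T a c b d"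
      "\<And>a b c d. T a b c d = - T a b d c"
    and eq: "\<And>a. clifford_module.cl G (Q a) \<epsilon> + (1/12) *\<^sub>R clifford_module.cl3 G (T a) \<epsilon> = 0"
  shows "Q m n = - (\<Sum>s\<in>UNIV. \<Sum>t\<in>UNIV. \<Sum>r\<in>UNIV. T m s t r * adapted_endo t r * adapted_endo s n) / 4"
    and "Q m n = Q n m"
proof -
  note R = adapted_three_form[OF mod nz g5 g T(2,3) eq]
  have T0: "T a a c d = 0" "T a b b d = 0" "T a b c c = 0" "T a b a d = 0" "T a b c b = 0" "T a b c a = 0" for a b c d
    using T(1)[of a a c d] T(2)[of a b b d] T(3)[of a b c c] T(2)[of a b a d] T(3)[of a b c b]
      T(3)[of a b c a] T(2)[of a b a c] T(1)[of a a b d] T(2)[of a b b c] T(1)[of a a b c] by simp_all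
  note Ts = T(1)[of 2 1] T(1)[of 3 1] T(1)[of 4 1] T(1)[of 5 1] T(1)[of 3 2] T(1)[of 4 2] T(1)[of 5 2]
    T(1)[of 4 3] T(1)[of 5 3] T(1)[of 5 4]
    T(2)[of _ 2 1] T(2)[of _ 3 1] T(2)[of _ 4 1] T(2)[of _ 5 1] T(2)[of _ 3 2] T(2)[of _ 4 2] T(2)[of _ 5 2]
    T(2)[of _ 4 3] T(2)[of _ 5 3] T(2)[of _ 5 4]
    T(3)[of _ _ 2 1] T(3)[of _ _ 3 1] T(3)[of _ _ 4 1] T(3)[of _ _ 5 1] T(3)[of _ _ 3 2] T(3)[of _ _ 4 2] T(3)[of _ _ 5 2]
    T(3)[of _ _ 4 3] T(3)[of _ _ 5 3] T(3)[of _ _ 5 4]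
  have v: "T 1 3 4 5 = 0" "T 1 2 3 5 = 0" "T 1 2 4 5 = 0" "T 2 3 4 5 = 0"
    using R[of 1] R[of 2] by (simp_all add: T0 Ts)
  have Qv: "Q a b = (if a = b \<and> a \<noteq> 5 then T 1 2 3 4 / 2 else 0)" for a b
    using R[of a] exhaust_5[of a] exhaust_5[of b] by (elim disjE) (simp_all add: T0 Ts v)
  show "Q m n = Q n m" by (auto simp: Qv)
  have c: "(\<Sum>t\<in>UNIV. \<Sum>r\<in>UNIV. T m s t r * adapted_endo t r * y) = - 2 * y * (T m s 1 2 + T m s 3 4)" for s y
    by (simp add: sum_5 adapted_endo_def Ts algebra_simps)
  show "Q m n = - (\<Sum>s\<in>UNIV. \<Sum>t\<in>UNIV. \<Sum>r\<in>UNIV. T m s t r * adapted_endo t r * adapted_endo s n) / 4"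
    unfolding c using exhaust_5[of m] exhaust_5[of n]
    by (elim disjE) (simp_all add: Qv sum_5 adapted_endo_def T0 Ts v)
qed

section \<open>Adapted frames and change of frame\<close>

lemma (in contact_spinor) mult_P_P: "(\<Sum>n\<in>UNIV. P s n * (\<Sum>k\<in>UNIV. P n k * x k)) = - x s + (\<Sum>k\<in>UNIV. \<xi> k * x k) * \<xi> s"
proof -
  have "(\<Sum>n\<in>UNIV. P s n * (\<Sum>k\<in>UNIV. P n k * x k)) = (\<Sum>k\<in>UNIV. (\<Sum>n\<in>UNIV. P s n * P n k) * x k)"
    unfolding sum_distrib_left sum_distrib_right by (subst sum.swap) (simp add: mult.assoc)
  also have "\<dots> = (\<Sum>k\<in>UNIV. (if s = k then - x k else 0) + \<xi> s * (\<xi> k * x k))"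
    unfolding P_square by (intro sum.cong refl) (simp add: h_def algebra_simps)
  finally show ?thesis
    by (simp add: sum.distrib sum_distrib_left mult.commute)
qed

lemma (in contact_spinor) P_adjoint:
  "(\<Sum>s\<in>UNIV. x s * (\<Sum>n\<in>UNIV. P s n * y n)) = - (\<Sum>s\<in>UNIV. (\<Sum>n\<in>UNIV. P s n * x n) * y s)"
proof -
  have "(\<Sum>s\<in>UNIV. x s * (\<Sum>n\<in>UNIV. P s n * y n)) = (\<Sum>n\<in>UNIV. \<Sum>s\<in>UNIV. x s * (P s n * y n))"
    unfolding sum_distrib_left by (rule sum.swap)
  also have "\<dots> = - (\<Sum>s\<in>UNIV. (\<Sum>n\<in>UNIV. P s n * x n) * y s)"
    unfolding sum_distrib_right sum_negf[symmetric]
    by (intro sum.cong refl) (subst P_skew, simp)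
  finally show ?thesis .
qed

text \<open>Take a unit vector \<open>u\<close> orthogonal to \<xi> and a unit vector
  \<open>w\<close> orthogonal to \<xi>, \<open>u\<close> and \<open>P u\<close>. Skewness of
  \<open>P\<close> and its square make \<open>u, P u, w, P w, \<xi>\<close> orthonormal. Both
  orthogonality relations are recorded: one gives the Clifford relations of the rotated gamma
  matrices, the other gives Parseval.\<close>

lemma adapted_frame_exists:
  fixes P :: "5 \<Rightarrow> 5 \<Rightarrow> real"
  assumes "contact_spinor G J \<epsilon> \<xi> P"
  shows "\<exists>f :: 5 \<Rightarrow> 5 \<Rightarrow> real.
    (\<forall>i j. (\<Sum>a\<in>UNIV. f i a * f j a) = (if i = j then 1 else 0)) \<and>
    (\<forall>a b. (\<Sum>i\<in>UNIV. f i a * f i b) = (if a = b then 1 else 0)) \<and>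
    f 5 = \<xi> \<and> (\<forall>s n. (\<Sum>k\<in>UNIV. P s k * f n k) = (\<Sum>i\<in>UNIV. adapted_endo i n * f i s))"
proof -
  interpret contact_spinor G J \<epsilon> \<xi> P by fact
  define X :: "real^5" where "X = (\<chi> a. \<xi> a)"
  define Q :: "real^5 \<Rightarrow> real^5" where "Q x = (\<chi> s. \<Sum>n\<in>UNIV. P s n * x $ n)" for x
  have adj: "x \<bullet> Q y = - (Q x \<bullet> y)" for x y
    using P_adjoint[of "\<lambda>s. x $ s" "\<lambda>s. y $ s"] by (simp add: inner_vec_def Q_def)
  have QQ: "Q (Q x) = - x + (X \<bullet> x) *\<^sub>R X" for x
    by (simp add: vec_eq_iff Q_def X_def mult_P_P inner_vec_def)
  have QX: "Q X = 0"
    by (simp add: vec_eq_iff Q_def X_def P_xi)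
  have XX: "X \<bullet> X = 1"
    by (simp add: X_def inner_vec_def xi_unit)
  have XQ: "X \<bullet> Q x = 0" for x
    by (simp add: adj QX)
  have self: "x \<bullet> Q x = 0" for x
    using adj[of x x] by (simp add: inner_commute)
  obtain u where u: "norm u = 1" "u \<bullet> X = 0"
    using unit_orthogonal_exists[of "{X}"] by auto
  have "card {X, u, Q u} < DIM(real^5)"
    using card_length[of "[X, u, Q u]"] by simp
  then obtain w where "norm w = 1" "\<And>y. y \<in> {X, u, Q u} \<Longrightarrow> w \<bullet> y = 0"
    using unit_orthogonal_exists[of "{X, u, Q u}"] by blast
  then have w: "norm w = 1" "w \<bullet> X = 0" "w \<bullet> u = 0" "w \<bullet> Q u = 0"
    by simp_all
  have uu: "u \<bullet> u = 1" "w \<bullet> w = 1"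
    using u(1) w(1) by (simp_all add: norm_eq_1)
  define F where "F i = (if i = 1 then u else if i = 2 then Q u else if i = 3 then w
     else if i = 4 then Q w else X)" for i :: 5
  have ips: "Q u \<bullet> Q u = 1" "Q w \<bullet> Q w = 1" "Q u \<bullet> Q w = 0" "u \<bullet> Q w = 0"
    using adj[of "Q u" u] adj[of "Q w" w] adj[of "Q u" w] adj[of u w] u w uu
    by (simp_all add: QQ inner_diff_left inner_add_left inner_commute)
  have orth: "F i \<bullet> F j = (if i = j then 1 else 0)" for i j
    using exhaust_5[of i] exhaust_5[of j] u(2) w(2-) uu ips XX XQ[of u] XQ[of w] self[of u] self[of w]
    by (elim disjE) (simp_all add: F_def inner_commute)
  define f where "f i a = F i $ a" for i a
  have o1: "(\<Sum>a\<in>UNIV. f i a * f j a) = (if i = j then 1 else 0)" for i j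
    using orth[of i j] by (simp add: f_def inner_vec_def)
  define M :: "real^5^5" where "M = (\<chi> i a. f i a)"
  have "M ** transpose M = mat 1"
    by (simp add: vec_eq_iff matrix_matrix_mult_def transpose_def M_def o1 mat_def)
  then have "transpose M ** M = mat 1"
    by (simp add: matrix_left_right_inverse)
  then have o2: "(\<Sum>i\<in>UNIV. f i a * f i b) = (if a = b then 1 else 0)" for a b
    by (simp add: vec_eq_iff matrix_matrix_mult_def transpose_def M_def mat_def)
  have act: "Q (F n) = (\<Sum>i\<in>UNIV. adapted_endo i n *\<^sub>R F i)" for n
    using exhaust_5[of n] u(2) w(2)
    by (elim disjE) (simp_all add: sum_5 adapted_endo_def F_def QQ QX inner_commute)
  have "f 5 = \<xi>" by (simp add: fun_eq_iff f_def F_def X_def)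
  moreover have "(\<Sum>k\<in>UNIV. P s k * f n k) = (\<Sum>i\<in>UNIV. adapted_endo i n * f i s)" for s n
    using act[of n] by (simp add: vec_eq_iff f_def Q_def)
  ultimately show ?thesis using o1 o2 by (intro exI[of _ f]) simp
qed

text \<open>\<open>L\<close> stands for the gamma matrices to the left of the contracted one, so
  that the indices of a product can be rotated one at a time.\<close>

lemma parseval_linear:
  fixes f :: "'n::finite \<Rightarrow> 'm::finite \<Rightarrow> real" and L :: "'v::real_vector \<Rightarrow> 'w::real_vector"
  assumes f: "\<And>a b. (\<Sum>i\<in>UNIV. f i a * f i b) = (if a = b then 1 else 0)"
    and L: "linear L"
  shows "(\<Sum>i\<in>UNIV. (\<Sum>a\<in>UNIV. f i a * x a) *\<^sub>R L (\<Sum>a\<in>UNIV. f i a *\<^sub>R y a)) = (\<Sum>a\<in>UNIV. x a *\<^sub>R L (y a))"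
proof -
  have "(\<Sum>i\<in>UNIV. (\<Sum>a\<in>UNIV. f i a * x a) *\<^sub>R L (\<Sum>a\<in>UNIV. f i a *\<^sub>R y a))
     = (\<Sum>i\<in>UNIV. \<Sum>a\<in>UNIV. \<Sum>b\<in>UNIV. (f i a * f i b * x a) *\<^sub>R L (y b))"
    unfolding scaleR_sum_left
    by (simp add: linear_sum[OF L] linear_scale[OF L] scaleR_sum_right mult_ac)
  also have "\<dots> = (\<Sum>a\<in>UNIV. \<Sum>b\<in>UNIV. \<Sum>i\<in>UNIV. (f i a * f i b * x a) *\<^sub>R L (y b))"
    by (subst sum.swap, rule sum.cong[OF refl], rule sum.swap)
  also have "\<dots> = (\<Sum>a\<in>UNIV. \<Sum>b\<in>UNIV. if a = b then x a *\<^sub>R L (y b) else 0)"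
    by (intro sum.cong refl) (simp add: scaleR_sum_left[symmetric] sum_distrib_right[symmetric] f)
  finally show ?thesis by simp
qed

lemma parseval:
  fixes f :: "'n::finite \<Rightarrow> 'm::finite \<Rightarrow> real"
  assumes f: "\<And>a b. (\<Sum>i\<in>UNIV. f i a * f i b) = (if a = b then 1 else 0)"
  shows "(\<Sum>i\<in>UNIV. (\<Sum>a\<in>UNIV. f i a * x a) * (\<Sum>a\<in>UNIV. f i a * y a)) = (\<Sum>a\<in>UNIV. x a * y a)"
  using parseval_linear[where L = "\<lambda>r::real. r" and x = x and y = y, OF f linear_ident]
  unfolding real_scaleR_def .

text \<open>Both conclusions are tensor equations and may be checked in an adapted frame. The
  rotated operators \<open>cl (f i)\<close> again satisfy the Clifford relations, so
  \<open>adapted_four_form\<close> applies to the rotated \<open>Q\<close> and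
  \<open>T\<close>.\<close>

lemma einstein_of_spinor:
  fixes G :: "5 \<Rightarrow> 'v \<Rightarrow> 'v::real_vector" and T :: "5 \<Rightarrow> 5 \<Rightarrow> 5 \<Rightarrow> 5 \<Rightarrow> real"
  assumes contact: "contact_spinor G J \<epsilon> \<xi> P"
    and T: "\<And>a b c d. T a b c d = - T b a c d" "\<And>a b c d. T a b c d = - T a c b d"
      "\<And>a b c d. T a b c d = - T a b d c"
    and eq: "\<And>a. clifford_module.cl G (Q a) \<epsilon> + (1/12) *\<^sub>R clifford_module.cl3 G (T a) \<epsilon> = 0"
  shows "Q m n = - (\<Sum>s\<in>UNIV. \<Sum>t\<in>UNIV. \<Sum>r\<in>UNIV. T m s t r * P t r * P s n) / 4"
    and "Q m n = Q n m"
proof -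
  interpret contact_spinor G J \<epsilon> \<xi> P by fact
  obtain f :: "5 \<Rightarrow> 5 \<Rightarrow> real" where
    f: "\<forall>i j. (\<Sum>a\<in>UNIV. f i a * f j a) = (if i = j then 1 else 0)"
      "\<forall>a b. (\<Sum>i\<in>UNIV. f i a * f i b) = (if a = b then 1 else 0)"
      "\<forall>s n. (\<Sum>k\<in>UNIV. P s k * f n k) = (\<Sum>i\<in>UNIV. adapted_endo i n * f i s)"
    and f5: "f 5 = \<xi>"
    using adapted_frame_exists[OF contact] by - (elim exE conjE, rule that; assumption)
  note o1 = f(1)[rule_format] and o2 = f(2)[rule_format] and fP = f(3)[rule_format]
  define G' where "G' i = cl (f i)" for i
  have mod: "complex_clifford_module G' J"
    by (intro complex_clifford_module.intro clifford_module.intro complex_clifford_module_axioms.intro)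
      (simp_all add: G'_def linear_cl cl_anti o1 J_linear J_J J_cl)
  then interpret A: complex_clifford_module G' J .
  have orth5: "(\<Sum>a\<in>UNIV. \<xi> a * f i a) = (if i = 5 then 1 else 0)" for i
    using o1[of 5 i] by (simp add: f5 eq_commute)
  have PG: "J (cl (\<lambda>s. \<Sum>i\<in>UNIV. adapted_endo i n * f i s) \<epsilon>) = G' n \<epsilon> - (if n = 5 then 1 else 0) *\<^sub>R \<epsilon>" for n
    using P_spinor_vec[of "f n"] by (simp add: fP orth5 G'_def)
  have g5: "G' 5 \<epsilon> = \<epsilon>" by (simp add: G'_def f5 xi_spinor)
  have g24: "J (G' 2 \<epsilon>) = G' 1 \<epsilon>" "J (G' 4 \<epsilon>) = G' 3 \<epsilon>"
    using PG[of 1] PG[of 3] by (simp_all add: sum_5 adapted_endo_def G'_def)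
  have g: "G' 2 \<epsilon> = - J (G' 1 \<epsilon>)" "G' 4 \<epsilon> = - J (G' 3 \<epsilon>)"
    by (simp_all add: g24[symmetric] J_J)
  \<comment> \<open>Contraction of one index with the i-th adapted vector; every change of frame
    below is an iteration of it.\<close>
  define N where "N i x = (\<Sum>a\<in>UNIV. f i a * x a)" for i and x :: "5 \<Rightarrow> real"
  have N_lin: "N i (\<lambda>a. - x a) = - N i x" "N i (\<lambda>a. x a * c) = N i x * c" "N i (\<lambda>a. c * x a) = c * N i x" for i x c
    by (simp_all add: N_def sum_negf sum_distrib_left sum_distrib_right mult_ac)
  have N_swap: "N i (\<lambda>a. N j (\<lambda>b. x a b)) = N j (\<lambda>b. N i (\<lambda>a. x a b))" for i j x
    unfolding N_def sum_distrib_left by (subst sum.swap) (simp add: mult.left_commute)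
  have N_sum: "N k (\<lambda>a. \<Sum>t\<in>UNIV. z a t) = (\<Sum>t\<in>UNIV. N k (\<lambda>a. z a t))" for k and z :: "5 \<Rightarrow> 5 \<Rightarrow> real"
    unfolding N_def sum_distrib_left by (rule sum.swap)
  \<comment> \<open>The outermost contraction belongs to the last index, whose gamma matrix acts
    first on \<epsilon>. In this order \<open>PL\<close> can undo the rotations one after the
    other.\<close>
  define T' where "T' i j k l = N l (\<lambda>d. N k (\<lambda>c. N j (\<lambda>b. N i (\<lambda>a. T a b c d))))" for i j k l
  define Q' where "Q' i j = N j (\<lambda>b. N i (\<lambda>a. Q a b))" for i j
  have T'_skew: "T' i j k l = - T' j i k l" "T' i j k l = - T' i k j l" "T' i j k l = - T' i j l k" for i j k l
  proof -
    have "T' j i k l = N l (\<lambda>d. N k (\<lambda>c. N j (\<lambda>b. N i (\<lambda>a. T b a c d))))"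
      unfolding T'_def by (subst (3) N_swap) (rule refl)
    also have "\<dots> = - T' i j k l"
      unfolding T'_def N_lin(1)[symmetric] by (subst T(1)) (rule refl)
    finally show "T' i j k l = - T' j i k l" by simp
    have "T' i k j l = N l (\<lambda>d. N k (\<lambda>c. N j (\<lambda>b. N i (\<lambda>a. T a c b d))))"
      unfolding T'_def by (subst (2) N_swap) (rule refl)
    also have "\<dots> = - T' i j k l"
      unfolding T'_def N_lin(1)[symmetric] by (subst T(2)) (rule refl)
    finally show "T' i j k l = - T' i k j l" by simp
    have "T' i j l k = N l (\<lambda>d. N k (\<lambda>c. N j (\<lambda>b. N i (\<lambda>a. T a b d c))))"
      unfolding T'_def by (subst N_swap) (rule refl)
    also have "\<dots> = - T' i j k l"
      unfolding T'_def N_lin(1)[symmetric] by (subst T(3)) (rule refl)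
    finally show "T' i j k l = - T' i j l k" by simp
  qed
  have PL: "(\<Sum>i\<in>UNIV. N i x *\<^sub>R L (G' i v)) = (\<Sum>a\<in>UNIV. x a *\<^sub>R L (G a v))" if "linear L" for x L v
    unfolding N_def G'_def cl_def by (rule parseval_linear[OF o2 that])
  have eq': "A.cl (Q' i) \<epsilon> + (1/12) *\<^sub>R A.cl3 (T' i) \<epsilon> = 0" for i
  proof -
    have q: "A.cl (Q' i) \<epsilon> = cl (\<lambda>b. N i (\<lambda>a. Q a b)) \<epsilon>"
      unfolding A.cl_def cl_def Q'_def by (simp only: PL[OF linear_ident])
    have "A.cl3 (T' i) \<epsilon> = (\<Sum>j\<in>UNIV. \<Sum>k\<in>UNIV. \<Sum>d\<in>UNIV. N k (\<lambda>c. N j (\<lambda>b. N i (\<lambda>a. T a b c d))) *\<^sub>R G' j (G' k (G d \<epsilon>)))"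
      unfolding A.cl3_def T'_def
      by (intro sum.cong refl PL linearI) (simp_all add: A.G_add A.G_scale)
    also have "\<dots> = (\<Sum>j\<in>UNIV. \<Sum>d\<in>UNIV. \<Sum>k\<in>UNIV. N k (\<lambda>c. N j (\<lambda>b. N i (\<lambda>a. T a b c d))) *\<^sub>R G' j (G' k (G d \<epsilon>)))"
      by (rule sum.cong[OF refl], rule sum.swap)
    also have "\<dots> = (\<Sum>j\<in>UNIV. \<Sum>d\<in>UNIV. \<Sum>c\<in>UNIV. N j (\<lambda>b. N i (\<lambda>a. T a b c d)) *\<^sub>R G' j (G c (G d \<epsilon>)))"
      by (intro sum.cong refl PL linearI) (simp_all add: A.G_add A.G_scale)
    also have "\<dots> = (\<Sum>d\<in>UNIV. \<Sum>c\<in>UNIV. \<Sum>j\<in>UNIV. N j (\<lambda>b. N i (\<lambda>a. T a b c d)) *\<^sub>R G' j (G c (G d \<epsilon>)))"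
      by (subst sum.swap, rule sum.cong[OF refl], rule sum.swap)
    also have "\<dots> = (\<Sum>d\<in>UNIV. \<Sum>c\<in>UNIV. \<Sum>b\<in>UNIV. N i (\<lambda>a. T a b c d) *\<^sub>R G b (G c (G d \<epsilon>)))"
      by (simp only: PL[OF linear_ident])
    also have "\<dots> = cl3 (\<lambda>b c d. N i (\<lambda>a. T a b c d)) \<epsilon>"
    proof -
      have "(\<Sum>d\<in>UNIV. \<Sum>c\<in>UNIV. \<Sum>b\<in>UNIV. N i (\<lambda>a. T a b c d) *\<^sub>R G b (G c (G d \<epsilon>)))
         = (\<Sum>d\<in>UNIV. \<Sum>b\<in>UNIV. \<Sum>c\<in>UNIV. N i (\<lambda>a. T a b c d) *\<^sub>R G b (G c (G d \<epsilon>)))"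
        by (rule sum.cong[OF refl], rule sum.swap)
      then show ?thesis
        unfolding cl3_def by (simp add: sum3_rotate[of "\<lambda>b c d. N i (\<lambda>a. T a b c d) *\<^sub>R G b (G c (G d \<epsilon>))"])
    qed
    finally have t: "A.cl3 (T' i) \<epsilon> = cl3 (\<lambda>b c d. N i (\<lambda>a. T a b c d)) \<epsilon>" .
    have s1: "cl (\<lambda>b. N i (\<lambda>a. Q a b)) \<epsilon> = (\<Sum>a\<in>UNIV. f i a *\<^sub>R cl (Q a) \<epsilon>)"
      by (simp add: N_def cl_vec_sum cl_vec_scale)
    have s2: "cl3 (\<lambda>b c d. N i (\<lambda>a. T a b c d)) \<epsilon> = (\<Sum>a\<in>UNIV. f i a *\<^sub>R cl3 (T a) \<epsilon>)"
    proof -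
      have "cl3 (\<lambda>b c d. \<Sum>a\<in>S. f i a * T a b c d) \<epsilon> = (\<Sum>a\<in>S. f i a *\<^sub>R cl3 (T a) \<epsilon>)" if "finite S" for S
        using that
      proof induction
        case empty show ?case by (simp add: cl3_def)
      next
        case (insert x S)
        then show ?case by (simp add: cl3_add cl3_scale)
      qed
      then show ?thesis by (simp add: N_def)
    qed
    have "A.cl (Q' i) \<epsilon> + (1/12) *\<^sub>R A.cl3 (T' i) \<epsilon>
       = (\<Sum>a\<in>UNIV. f i a *\<^sub>R (cl (Q a) \<epsilon> + (1/12) *\<^sub>R cl3 (T a) \<epsilon>))"
      by (simp add: q t s1 s2 scaleR_add_right sum.distrib scaleR_sum_right mult.commute)
    then show ?thesis by (simp add: eq)
  qed
  note core = adapted_four_form[OF mod nonzero g5 g T'_skew eq']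
  have P': "N i (\<lambda>s. N j (\<lambda>n. P s n)) = adapted_endo i j" for i j
  proof -
    have "N i (\<lambda>s. N j (\<lambda>n. P s n)) = N i (\<lambda>s. \<Sum>k\<in>UNIV. adapted_endo k j * f k s)"
      by (simp add: N_def fP mult.commute[of "f j _"])
    also have "\<dots> = (\<Sum>k\<in>UNIV. adapted_endo k j * (\<Sum>s\<in>UNIV. f i s * f k s))"
      unfolding N_def sum_distrib_left by (subst sum.swap) (simp add: mult.left_commute)
    finally show ?thesis by (simp add: o1 if_distrib cong: if_cong)
  qed
  have PS: "(\<Sum>i\<in>UNIV. N i x * N i y) = (\<Sum>a\<in>UNIV. x a * y a)" for x y
    unfolding N_def by (rule parseval[OF o2])
  have PS2: "(\<Sum>i\<in>UNIV. \<Sum>j\<in>UNIV. N j (\<lambda>b. N i (\<lambda>a. x a b)) * N i (\<lambda>a. N j (\<lambda>b. y a b)))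
     = (\<Sum>a\<in>UNIV. \<Sum>b\<in>UNIV. x a b * y a b)" for x y
  proof -
    have "(\<Sum>i\<in>UNIV. \<Sum>j\<in>UNIV. N j (\<lambda>b. N i (\<lambda>a. x a b)) * N i (\<lambda>a. N j (\<lambda>b. y a b)))
       = (\<Sum>i\<in>UNIV. \<Sum>b\<in>UNIV. N i (\<lambda>a. x a b) * N i (\<lambda>a. y a b))"
      by (subst N_swap) (simp add: PS)
    also have "\<dots> = (\<Sum>b\<in>UNIV. \<Sum>a\<in>UNIV. x a b * y a b)"
      by (subst sum.swap) (simp add: PS)
    finally show ?thesis by (subst sum.swap)
  qed
  \<comment> \<open>The defect in the first conclusion, as a tensor in the original frame. Its
    components in the adapted frame vanish, and by Parseval a tensor with that property is
    zero.\<close>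
  define D where "D a b = Q a b + (\<Sum>s\<in>UNIV. (\<Sum>t\<in>UNIV. \<Sum>r\<in>UNIV. T a s t r * P t r) * P s b) / 4" for a b
  have D': "N j (\<lambda>b. N i (\<lambda>a. D a b)) = 0" for i j
  proof -
    have tr: "(\<Sum>t\<in>UNIV. \<Sum>r\<in>UNIV. T' i s t r * adapted_endo t r)
       = N s (\<lambda>s. N i (\<lambda>a. \<Sum>t\<in>UNIV. \<Sum>r\<in>UNIV. T a s t r * P t r))" for s
    proof -
      have "(\<Sum>t\<in>UNIV. \<Sum>r\<in>UNIV. T' i s t r * adapted_endo t r)
        = (\<Sum>t\<in>UNIV. \<Sum>r\<in>UNIV. N s (\<lambda>b. N i (\<lambda>a. T a b t r)) * P t r)"
        unfolding T'_def P'[symmetric] by (rule PS2)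
      also have "\<dots> = N s (\<lambda>s. N i (\<lambda>a. \<Sum>t\<in>UNIV. \<Sum>r\<in>UNIV. T a s t r * P t r))"
        by (simp only: N_sum N_lin)
      finally show ?thesis .
    qed
    have "N j (\<lambda>b. N i (\<lambda>a. \<Sum>s\<in>UNIV. (\<Sum>t\<in>UNIV. \<Sum>r\<in>UNIV. T a s t r * P t r) * P s b))
       = (\<Sum>s\<in>UNIV. (\<Sum>t\<in>UNIV. \<Sum>r\<in>UNIV. T' i s t r * adapted_endo t r) * adapted_endo s j)"
    proof -
      have "(\<Sum>s\<in>UNIV. (\<Sum>t\<in>UNIV. \<Sum>r\<in>UNIV. T' i s t r * adapted_endo t r) * adapted_endo s j)
        = (\<Sum>s\<in>UNIV. N i (\<lambda>a. \<Sum>t\<in>UNIV. \<Sum>r\<in>UNIV. T a s t r * P t r) * N j (\<lambda>b. P s b))"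
        unfolding tr unfolding P'[symmetric] by (rule PS)
      also have "\<dots> = N j (\<lambda>b. N i (\<lambda>a. \<Sum>s\<in>UNIV. (\<Sum>t\<in>UNIV. \<Sum>r\<in>UNIV. T a s t r * P t r) * P s b))"
        by (simp only: N_sum N_lin)
      finally show ?thesis ..
    qed
    moreover have "N j (\<lambda>b. N i (\<lambda>a. D a b)) = Q' i j
        + N j (\<lambda>b. N i (\<lambda>a. \<Sum>s\<in>UNIV. (\<Sum>t\<in>UNIV. \<Sum>r\<in>UNIV. T a s t r * P t r) * P s b)) / 4"
    proof -
      have "N k (\<lambda>a. x a + y a / 4) = N k x + N k y / 4" for k x y
        by (simp add: N_def distrib_left sum.distrib sum_divide_distrib)
      then show ?thesis by (simp only: D_def Q'_def)
    qed
    moreover have "Q' i j = - (\<Sum>s\<in>UNIV. (\<Sum>t\<in>UNIV. \<Sum>r\<in>UNIV. T' i s t r * adapted_endo t r) * adapted_endo s j) / 4"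
      using core(1)[of i j] by (simp add: sum_distrib_right)
    ultimately show ?thesis by simp
  qed
  have N_inj: "x a = 0" if "\<And>i. N i x = 0" for x a
  proof -
    have "(\<Sum>a\<in>UNIV. x a * x a) = 0" using PS[of x x] that by simp
    then show ?thesis by (simp add: sum_nonneg_eq_0_iff)
  qed
  have N2_inj: "x a b = 0" if "\<And>i j. N j (\<lambda>b. N i (\<lambda>a. x a b)) = 0" for x a b
    using N_inj[of "\<lambda>a. x a b"] N_inj[of "\<lambda>b. N _ (\<lambda>a. x a b)"] that by blast
  have "D m n = 0" by (rule N2_inj) (rule D')
  then show "Q m n = - (\<Sum>s\<in>UNIV. \<Sum>t\<in>UNIV. \<Sum>r\<in>UNIV. T m s t r * P t r * P s n) / 4"
    by (simp add: D_def sum_distrib_right)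
  have "N j (\<lambda>b. N i (\<lambda>a. Q a b - Q b a)) = 0" for i j
  proof -
    have "N j (\<lambda>b. N i (\<lambda>a. Q a b - Q b a)) = Q' i j - N j (\<lambda>b. N i (\<lambda>a. Q b a))"
      by (simp add: Q'_def N_def right_diff_distrib sum_subtractf)
    also have "\<dots> = Q' i j - Q' j i"
      unfolding Q'_def by (subst (2) N_swap) (rule refl)
    finally show ?thesis
      using core(2)[of i j] by simp
  qed
  from N2_inj[of "\<lambda>a b. Q a b - Q b a", OF this] show "Q m n = Q n m" by simp
qed

section \<open>Curvature and torsion at a point\<close>

text \<open>The 1-jets, at one point and in an orthonormal frame \<open>E\<close>, of the Levi-Civita connection form, of
  the three-form and of the differential of the dilaton: \<open>w a s b = \<omega>\<^sup>s\<^sub>b(E\<^sub>a)\<close>,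
  \<open>dw c a s b = E\<^sub>c (w a s b)\<close>, and similarly for \<open>H\<close> and \<open>\<phi>\<close>.\<close>

locale torsion_jet =
  fixes w :: "'n::finite \<Rightarrow> 'n \<Rightarrow> 'n \<Rightarrow> real" and dw :: "'n \<Rightarrow> 'n \<Rightarrow> 'n \<Rightarrow> 'n \<Rightarrow> real"
    and H :: "'n \<Rightarrow> 'n \<Rightarrow> 'n \<Rightarrow> real" and dH :: "'n \<Rightarrow> 'n \<Rightarrow> 'n \<Rightarrow> 'n \<Rightarrow> real"
    and \<phi> :: "'n \<Rightarrow> real" and d\<phi> :: "'n \<Rightarrow> 'n \<Rightarrow> real"
  assumes w_skew: "w a s b = - w a b s" and dw_skew: "dw c a s b = - dw c a b s"
    and H_skew: "H a b c = - H b a c" "H a b c = - H a c b"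
    and dH_skew: "dH a b c d = - dH a c b d" "dH a b c d = - dH a b d c"
begin

definition bracket :: "'n \<Rightarrow> 'n \<Rightarrow> 'n \<Rightarrow> real" where
  "bracket a b s = w a s b - w b s a"

definition curv :: "'n \<Rightarrow> 'n \<Rightarrow> 'n \<Rightarrow> 'n \<Rightarrow> real" where
  "curv a b s c = dw a b s c - dw b a s c - (\<Sum>t\<in>UNIV. bracket a b t * w t s c)
    + (\<Sum>t\<in>UNIV. w a s t * w b t c - w b s t * w a t c)"

text \<open>The plus signs are the usual minus signs: the coefficient
  \<open>\<omega>^t_b(E_a)\<close> is \<open>w a t b\<close>, which equals
  \<open>- w a b t\<close>.\<close>

definition nabla_H :: "'n \<Rightarrow> 'n \<Rightarrow> 'n \<Rightarrow> 'n \<Rightarrow> real" where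
  "nabla_H a b c d = dH a b c d + (\<Sum>t\<in>UNIV. w a b t * H t c d + w a c t * H b t d + w a d t * H b c t)"

definition d_H :: "'n \<Rightarrow> 'n \<Rightarrow> 'n \<Rightarrow> 'n \<Rightarrow> real" where
  "d_H a b c d = nabla_H a b c d - nabla_H b a c d + nabla_H c a b d - nabla_H d a b c"

definition hess :: "'n \<Rightarrow> 'n \<Rightarrow> real" where
  "hess a b = d\<phi> a b - (\<Sum>s\<in>UNIV. w a s b * \<phi> s)"

text \<open>The last two indices of \<open>H\<close> are exchanged against those of
  \<open>w\<close>: \<open>wp a s b\<close> is the \<open>E_s\<close>-component of the derivative of
  \<open>E_b\<close>, and the torsion contributes \<open>H(E_a, E_b, E_s) / 2\<close> to it.\<close>

definition wp :: "'n \<Rightarrow> 'n \<Rightarrow> 'n \<Rightarrow> real" where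
  "wp a s b = w a s b + H a b s / 2"

definition dwp :: "'n \<Rightarrow> 'n \<Rightarrow> 'n \<Rightarrow> 'n \<Rightarrow> real" where
  "dwp c a s b = dw c a s b + dH c a b s / 2"

text \<open>The bracket is still built from \<open>w\<close>, since it is the Lie bracket of the
  frame fields; \<open>wp\<close> itself has torsion \<open>H\<close>.\<close>

definition curvp :: "'n \<Rightarrow> 'n \<Rightarrow> 'n \<Rightarrow> 'n \<Rightarrow> real" where
  "curvp a b s c = dwp a b s c - dwp b a s c - (\<Sum>t\<in>UNIV. bracket a b t * wp t s c)
    + (\<Sum>t\<in>UNIV. wp a s t * wp b t c - wp b s t * wp a t c)"

definition nablap_H :: "'n \<Rightarrow> 'n \<Rightarrow> 'n \<Rightarrow> 'n \<Rightarrow> real" where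
  "nablap_H a b c d = dH a b c d + (\<Sum>t\<in>UNIV. wp a b t * H t c d + wp a c t * H b t d + wp a d t * H b c t)"

definition nablap_d\<phi> :: "'n \<Rightarrow> 'n \<Rightarrow> real" where
  "nablap_d\<phi> a b = d\<phi> a b + (\<Sum>t\<in>UNIV. wp a b t * \<phi> t)"

definition einstein :: "'n \<Rightarrow> 'n \<Rightarrow> real" where
  "einstein a b = (\<Sum>m\<in>UNIV. curv m a m b) - (1/4) * (\<Sum>m\<in>UNIV. \<Sum>n\<in>UNIV. H a m n * H b m n) + 2 * hess a b"

lemma H_cyclic: "H a b c = H b c a" "H a b c = H c a b"
  using H_skew by metis+

lemma H_zero: "H a a b = 0" "H a b b = 0" "H a b a = 0"
  using H_skew(1)[of a a b] H_skew(2)[of a b b] H_skew(2)[of a b a] by simp_all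

lemma wp_skew: "wp a s b = - wp a b s"
  using w_skew[of a s b] H_skew(2)[of a b s] by (simp add: wp_def)

lemma curv_skew: "curv a b s c = - curv b a s c" "curv a b s c = - curv a b c s"
proof -
  show "curv a b s c = - curv b a s c"
    unfolding curv_def bracket_def by (simp add: left_diff_distrib sum_subtractf)
  have "(\<Sum>t\<in>UNIV. bracket a b t * w t s c) = - (\<Sum>t\<in>UNIV. bracket a b t * w t c s)"
    unfolding sum_negf[symmetric] by (intro sum.cong refl) (subst w_skew, simp)
  moreover have "(\<Sum>t\<in>UNIV. w a s t * w b t c - w b s t * w a t c)
      = - (\<Sum>t\<in>UNIV. w a c t * w b t s - w b c t * w a t s)"
    unfolding sum_negf[symmetric]
  proof (intro sum.cong refl)
    fix t
    show "w a s t * w b t c - w b s t * w a t c = - (w a c t * w b t s - w b c t * w a t s)"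
      using w_skew[of a s t] w_skew[of b t c] w_skew[of b s t] w_skew[of a t c] by simp
  qed
  ultimately show "curv a b s c = - curv a b c s"
    using dw_skew[of a b s c] dw_skew[of b a s c] by (simp add: curv_def)
qed

lemma curvp_skew: "curvp a b s c = - curvp a b c s"
proof -
  have "(\<Sum>t\<in>UNIV. bracket a b t * wp t s c) = - (\<Sum>t\<in>UNIV. bracket a b t * wp t c s)"
    unfolding sum_negf[symmetric] by (intro sum.cong refl) (subst wp_skew, simp)
  moreover have "(\<Sum>t\<in>UNIV. wp a s t * wp b t c - wp b s t * wp a t c)
      = - (\<Sum>t\<in>UNIV. wp a c t * wp b t s - wp b c t * wp a t s)"
    unfolding sum_negf[symmetric]
  proof (intro sum.cong refl)
    fix t
    show "wp a s t * wp b t c - wp b s t * wp a t c = - (wp a c t * wp b t s - wp b c t * wp a t s)"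
      using wp_skew[of a s t] wp_skew[of b t c] wp_skew[of b s t] wp_skew[of a t c] by simp
  qed
  ultimately show ?thesis
    using dw_skew[of a b s c] dw_skew[of b a s c] dH_skew(2)[of a b s c] dH_skew(2)[of b a s c]
    by (simp add: curvp_def dwp_def)
qed

lemma nabla_H_skew: "nabla_H a b c d = - nabla_H a c b d" "nabla_H a b c d = - nabla_H a b d c"
proof -
  have "(\<Sum>t\<in>UNIV. w a b t * H t c d + w a c t * H b t d + w a d t * H b c t)
     = - (\<Sum>t\<in>UNIV. w a c t * H t b d + w a b t * H c t d + w a d t * H c b t)"
    unfolding sum_negf[symmetric]
  proof (intro sum.cong refl)
    fix t
    show "w a b t * H t c d + w a c t * H b t d + w a d t * H b c t
      = - (w a c t * H t b d + w a b t * H c t d + w a d t * H c b t)"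
      using H_skew(1)[of t c d] H_skew(1)[of b t d] H_skew(1)[of b c t] by simp
  qed
  then show "nabla_H a b c d = - nabla_H a c b d"
    using dH_skew(1)[of a b c d] by (simp add: nabla_H_def)
  have "(\<Sum>t\<in>UNIV. w a b t * H t c d + w a c t * H b t d + w a d t * H b c t)
     = - (\<Sum>t\<in>UNIV. w a b t * H t d c + w a d t * H b t c + w a c t * H b d t)"
    unfolding sum_negf[symmetric]
  proof (intro sum.cong refl)
    fix t
    show "w a b t * H t c d + w a c t * H b t d + w a d t * H b c t
      = - (w a b t * H t d c + w a d t * H b t c + w a c t * H b d t)"
      using H_skew(2)[of t c d] H_skew(2)[of b t d] H_skew(2)[of b c t] by simp
  qed
  then show "nabla_H a b c d = - nabla_H a b d c"
    using dH_skew(2)[of a b c d] by (simp add: nabla_H_def)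
qed

lemma d_H_skew: "d_H a b c d = - d_H b a c d" "d_H a b c d = - d_H a c b d" "d_H a b c d = - d_H a b d c"
  using nabla_H_skew[of a b c d] nabla_H_skew[of b a c d] nabla_H_skew[of c a b d] nabla_H_skew[of d a b c]
    nabla_H_skew[of b c a d] nabla_H_skew[of c b a d] nabla_H_skew[of d b a c] nabla_H_skew[of c d a b]
    nabla_H_skew[of b a d c] nabla_H_skew[of d a c b] nabla_H_skew[of a c b d]
    nabla_H_skew[of a b d c]
  by (simp_all add: d_H_def)

text \<open>For a torsion-free connection the antisymmetrized covariant derivative is the exterior
  derivative: its connection terms pair up into brackets. This form matches the invariant formula
  \<open>ext_deriv3\<close>.\<close>

lemma d_H_bracket:
  "d_H a b c d = dH a b c d - dH b a c d + dH c a b d - dH d a b c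
    - (\<Sum>s\<in>UNIV. bracket a b s * H s c d) + (\<Sum>s\<in>UNIV. bracket a c s * H s b d)
    - (\<Sum>s\<in>UNIV. bracket a d s * H s b c) - (\<Sum>s\<in>UNIV. bracket b c s * H s a d)
    + (\<Sum>s\<in>UNIV. bracket b d s * H s a c) - (\<Sum>s\<in>UNIV. bracket c d s * H s a b)"
proof -
  have "(\<Sum>t\<in>UNIV. w a b t * H t c d + w a c t * H b t d + w a d t * H b c t)
    - (\<Sum>t\<in>UNIV. w b a t * H t c d + w b c t * H a t d + w b d t * H a c t)
    + (\<Sum>t\<in>UNIV. w c a t * H t b d + w c b t * H a t d + w c d t * H a b t)
    - (\<Sum>t\<in>UNIV. w d a t * H t b c + w d b t * H a t c + w d c t * H a b t)
    = - (\<Sum>s\<in>UNIV. bracket a b s * H s c d) + (\<Sum>s\<in>UNIV. bracket a c s * H s b d)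
    - (\<Sum>s\<in>UNIV. bracket a d s * H s b c) - (\<Sum>s\<in>UNIV. bracket b c s * H s a d)
    + (\<Sum>s\<in>UNIV. bracket b d s * H s a c) - (\<Sum>s\<in>UNIV. bracket c d s * H s a b)"
    unfolding sum_negf[symmetric] sum.distrib[symmetric] sum_subtractf[symmetric]
  proof (intro sum.cong refl)
    fix t
    have w: "w a b t = - w a t b" "w a c t = - w a t c" "w a d t = - w a t d"
      "w b a t = - w b t a" "w b c t = - w b t c" "w b d t = - w b t d"
      "w c a t = - w c t a" "w c b t = - w c t b" "w c d t = - w c t d"
      "w d a t = - w d t a" "w d b t = - w d t b" "w d c t = - w d t c"
      by (rule w_skew)+
    have h: "H b t d = - H t b d" "H b c t = H t b c" "H a t d = - H t a d" "H a c t = H t a c"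
      "H a b t = H t a b" "H a t c = - H t a c"
      by (rule H_skew(1) H_cyclic(2))+
    show "w a b t * H t c d + w a c t * H b t d + w a d t * H b c t -
         (w b a t * H t c d + w b c t * H a t d + w b d t * H a c t) +
         (w c a t * H t b d + w c b t * H a t d + w c d t * H a b t) -
         (w d a t * H t b c + w d b t * H a t c + w d c t * H a b t) =
         - (bracket a b t * H t c d) + bracket a c t * H t b d - bracket a d t * H t b c -
         bracket b c t * H t a d + bracket b d t * H t a c - bracket c d t * H t a b"
      unfolding bracket_def w h by (simp add: algebra_simps)
  qed
  then show ?thesis
    by (simp add: d_H_def nabla_H_def)
qed

text \<open>The products of \<open>w\<close> with \<open>H\<close>, together with the bracket term,
  complete the derivatives of \<open>H\<close> to covariant ones; the products of \<open>H\<close>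
  with itself remain.\<close>

lemma curvp_eq:
  "curvp a b s c = curv a b s c + (nabla_H a b c s - nabla_H b a c s) / 2
    + (\<Sum>t\<in>UNIV. H a t s * H b c t - H b t s * H a c t) / 4"
proof -
  have "- (\<Sum>t\<in>UNIV. bracket a b t * wp t s c) + (\<Sum>t\<in>UNIV. wp a s t * wp b t c - wp b s t * wp a t c)
    = - (\<Sum>t\<in>UNIV. bracket a b t * w t s c) + (\<Sum>t\<in>UNIV. w a s t * w b t c - w b s t * w a t c)
    + ((\<Sum>t\<in>UNIV. w a b t * H t c s + w a c t * H b t s + w a s t * H b c t)
     - (\<Sum>t\<in>UNIV. w b a t * H t c s + w b c t * H a t s + w b s t * H a c t)) / 2
    + (\<Sum>t\<in>UNIV. H a t s * H b c t - H b t s * H a c t) / 4"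
    unfolding sum_negf[symmetric] sum.distrib[symmetric] sum_subtractf[symmetric] sum_divide_distrib
  proof (intro sum.cong refl)
    fix t
    have w: "w a b t = - w a t b" "w b a t = - w b t a" "w a c t = - w a t c" "w b c t = - w b t c"
      by (rule w_skew)+
    show "- (bracket a b t * wp t s c) + (wp a s t * wp b t c - wp b s t * wp a t c) =
         - (bracket a b t * w t s c) + (w a s t * w b t c - w b s t * w a t c) +
         (w a b t * H t c s + w a c t * H b t s + w a s t * H b c t -
          (w b a t * H t c s + w b c t * H a t s + w b s t * H a c t)) / 2 +
         (H a t s * H b c t - H b t s * H a c t) / 4"
      unfolding bracket_def wp_def w by (simp add: field_simps)
  qed
  then show ?thesis
    by (simp add: curvp_def curv_def nabla_H_def dwp_def field_simps)
qed

lemma nablap_H_eq: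
  "nablap_H a b c d = nabla_H a b c d + (\<Sum>t\<in>UNIV. H a t b * H t c d + H a t c * H b t d + H a t d * H b c t) / 2"
  unfolding nablap_H_def nabla_H_def wp_def sum_divide_distrib add.assoc sum.distrib[symmetric]
  by (rule arg_cong[where f = "\<lambda>r. dH a b c d + r"], rule sum.cong[OF refl]) (simp add: field_simps)

end

text \<open>A jet at one point cannot express that the torsion vanishes nearby. What is needed of
  this are the first Bianchi identity and the commutator of two frame derivatives on the dilaton, so
  these become assumptions.\<close>

locale levi_civita_jet = torsion_jet +
  assumes bianchi: "curv a b s c + curv b c s a + curv c a s b = 0"
    and d\<phi>_bracket: "d\<phi> a b - d\<phi> b a = (\<Sum>s\<in>UNIV. bracket a b s * \<phi> s)"
begin

text \<open>The classical argument: an alternating combination of four Bianchi identities leaves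
  twice the difference of the two sides.\<close>

lemma pair_symmetry: "curv a b c d = curv c d a b"
proof -
  have "curv a b c d - curv b d a c + curv a d b c = 0"
    using bianchi[of a b c d] curv_skew(2)[of b d c a] curv_skew(1)[of d a c b] curv_skew(2)[of a d c b]
    by simp
  moreover have "- curv a b c d - curv b c a d + curv a c b d = 0"
    using bianchi[of a b d c] curv_skew(2)[of a b d c] curv_skew(2)[of b c d a]
      curv_skew(1)[of c a d b] curv_skew(2)[of a c d b]
    by simp
  moreover have "curv b c a d + curv c d a b - curv b d a c = 0"
    using bianchi[of b c a d] curv_skew(1)[of d b a c] by simp
  moreover have "curv a c b d - curv c d a b - curv a d b c = 0"
    using bianchi[of a c b d] curv_skew(2)[of c d b a] curv_skew(1)[of d a b c] by simp
  ultimately show ?thesis by linarith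
qed

lemma bianchi_last: "curv a c s b + curv a s b c + curv a b c s = 0"
  using bianchi[of s b a c] pair_symmetry[of a c s b] pair_symmetry[of a s b c] pair_symmetry[of a b c s]
  by linarith

lemma ricci_sym: "(\<Sum>m\<in>UNIV. curv m a m b) = (\<Sum>m\<in>UNIV. curv m b m a)"
  by (intro sum.cong refl) (rule pair_symmetry)

lemma hess_sym: "hess a b = hess b a"
  using d\<phi>_bracket[of a b] by (simp add: hess_def bracket_def left_diff_distrib sum_subtractf)

lemma einstein_sym: "einstein a b = einstein b a"
  by (simp add: einstein_def ricci_sym[of a b] hess_sym[of a b] mult.commute)

text \<open>The Levi-Civita part drops out by the Bianchi identity. Of the three halves of the
  covariant derivative of \<open>H\<close> along \<open>a\<close>, one completes the exterior
  derivative, and the other two combine with the quadratic terms to the derivative for the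
  connection with torsion.\<close>

lemma curvp_cyclic:
  "curvp a c s b + curvp a s b c + curvp a b c s = - nablap_H a c s b - d_H a c s b / 2"
proof -
  have "nabla_H a b s c = - nabla_H a c s b"
    using nabla_H_skew(1)[of a b s c] nabla_H_skew(2)[of a s b c] nabla_H_skew(1)[of a s c b] by linarith
  then have n: "nabla_H a c b s = - nabla_H a c s b" "nabla_H a s c b = - nabla_H a c s b"
     "nabla_H a b s c = - nabla_H a c s b" "nabla_H c a b s = - nabla_H c a s b"
     "nabla_H b a s c = - nabla_H b a c s"
    by (auto intro: nabla_H_skew)
  have "(\<Sum>t\<in>UNIV. H a t s * H c b t - H c t s * H a b t) / 4
    + (\<Sum>t\<in>UNIV. H a t b * H s c t - H s t b * H a c t) / 4
    + (\<Sum>t\<in>UNIV. H a t c * H b s t - H b t c * H a s t) / 4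
    = - ((\<Sum>t\<in>UNIV. H a t c * H t s b + H a t s * H c t b + H a t b * H c s t) / 2)"
    unfolding sum_negf[symmetric] sum.distrib[symmetric] sum_subtractf[symmetric] sum_divide_distrib
  proof (intro sum.cong refl)
    fix t
    have h: "H a b t = - H a t b" "H a c t = - H a t c" "H a s t = - H a t s"
      "H c b t = - H c t b" "H c t s = - H c s t" "H s c t = - H c s t" "H s t b = - H t s b"
      "H b s t = - H t s b" "H b t c = - H c t b"
      using H_skew H_cyclic by metis+
    show "(H a t s * H c b t - H c t s * H a b t) / 4 + (H a t b * H s c t - H s t b * H a c t) / 4 +
         (H a t c * H b s t - H b t c * H a s t) / 4 =
         - ((H a t c * H t s b + H a t s * H c t b + H a t b * H c s t) / 2)"
      unfolding h by (simp add: field_simps)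
  qed
  moreover have "curv a c s b + curv a s b c + curv a b c s = 0" by (rule bianchi_last)
  ultimately show ?thesis
    unfolding curvp_eq nablap_H_eq d_H_def
    using n by (simp add: field_simps)
qed

text \<open>The left-hand side is \<open>Q\<close>, since tracing \<open>curvp\<close> over its two
  middle indices gives minus the Ricci tensor of the connection with torsion. Besides the symmetric
  tensor \<open>einstein\<close> there remains half of
  \<open>e^(2\<phi>) \<nabla>^c (e^(-2\<phi>) H_cab)\<close>, which is skew.\<close>

lemma ricci_eq:
  "- (\<Sum>c\<in>UNIV. curvp a c c b) + 2 * nablap_d\<phi> a b
    = einstein a b + ((\<Sum>c\<in>UNIV. nabla_H c a b c) / 2 + (\<Sum>t\<in>UNIV. H a t b * \<phi> t))"
proof -
  have z: "nabla_H a c b c = 0" for c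
    using nabla_H_skew(1)[of a c c b] nabla_H_skew(2)[of a c c b] by simp
  have c: "curvp a c c b = - curv c a c b - nabla_H c a b c / 2 + (\<Sum>t\<in>UNIV. H a c t * H b c t) / 4" for c
  proof -
    have "(\<Sum>t\<in>UNIV. H a t c * H c b t - H c t c * H a b t) = (\<Sum>t\<in>UNIV. H a c t * H b c t)"
    proof (intro sum.cong refl)
      fix t
      show "H a t c * H c b t - H c t c * H a b t = H a c t * H b c t"
        using H_skew(2)[of a t c] H_skew(1)[of c b t] H_zero(3)[of c t] by simp
    qed
    then show ?thesis
      using curv_skew(1)[of a c c b] by (simp add: curvp_eq z)
  qed
  have "nablap_d\<phi> a b = hess a b + (\<Sum>t\<in>UNIV. H a t b * \<phi> t) / 2"
  proof -
    have "(\<Sum>t\<in>UNIV. wp a b t * \<phi> t) = - (\<Sum>s\<in>UNIV. w a s b * \<phi> s) + (\<Sum>t\<in>UNIV. H a t b * \<phi> t) / 2"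
      unfolding sum_negf[symmetric] sum.distrib[symmetric] sum_divide_distrib
    proof (intro sum.cong refl)
      fix t
      show "wp a b t * \<phi> t = - (w a t b * \<phi> t) + H a t b * \<phi> t / 2"
        using w_skew[of a b t] by (simp add: wp_def field_simps)
    qed
    then show ?thesis by (simp add: nablap_d\<phi>_def hess_def)
  qed
  moreover have "(\<Sum>c\<in>UNIV. curvp a c c b) = - (\<Sum>c\<in>UNIV. curv c a c b) - (\<Sum>c\<in>UNIV. nabla_H c a b c) / 2
     + (\<Sum>c\<in>UNIV. \<Sum>t\<in>UNIV. H a c t * H b c t) / 4"
    unfolding c by (simp add: sum.distrib sum_subtractf sum_negf sum_divide_distrib)
  ultimately show ?thesis
    by (simp add: einstein_def)
qed

lemma skew_part: "(\<Sum>c\<in>UNIV. nabla_H c a b c) / 2 + (\<Sum>t\<in>UNIV. H a t b * \<phi> t)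
    = - ((\<Sum>c\<in>UNIV. nabla_H c b a c) / 2 + (\<Sum>t\<in>UNIV. H b t a * \<phi> t))"
proof -
  have "(\<Sum>c\<in>UNIV. nabla_H c a b c) = - (\<Sum>c\<in>UNIV. nabla_H c b a c)"
    unfolding sum_negf[symmetric] by (intro sum.cong refl) (rule nabla_H_skew(1))
  moreover have "(\<Sum>t\<in>UNIV. H a t b * \<phi> t) = - (\<Sum>t\<in>UNIV. H b t a * \<phi> t)"
    unfolding sum_negf[symmetric]
  proof (intro sum.cong refl)
    fix t show "H a t b * \<phi> t = - (H b t a * \<phi> t)"
      using H_skew(1)[of a t b] H_cyclic(1)[of b t a] by simp
  qed
  ultimately show ?thesis by simp
qed

end

text \<open>Here \<open>d\<epsilon> a\<close> is the derivative of the spinor in the direction \<open>E\<^sub>a\<close>.\<close>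

locale killing_jet = contact_spinor G J \<epsilon> \<xi> P + levi_civita_jet w dw H dH \<phi> d\<phi>
  for G :: "5 \<Rightarrow> 'v::real_vector \<Rightarrow> 'v" and J \<epsilon> \<xi> P
    and w :: "5 \<Rightarrow> 5 \<Rightarrow> 5 \<Rightarrow> real" and dw H dH \<phi> d\<phi> +
  fixes d\<epsilon> :: "5 \<Rightarrow> 'v"
  assumes gravitino: "d\<epsilon> a = - spin_act (wp a) \<epsilon>"
    and integrability: "cl2 (curvp a b) \<epsilon> = 0"
    and dilatino: "cl \<phi> \<epsilon> = (1/12) *\<^sub>R cl3 H \<epsilon>"
    and d_dilatino: "cl (d\<phi> a) \<epsilon> + cl \<phi> (d\<epsilon> a) = (1/12) *\<^sub>R (cl3 (dH a) \<epsilon> + cl3 H (d\<epsilon> a))"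
begin

text \<open>The derivative of the dilatino equation contains terms in which \<epsilon> is
  differentiated. Letting \<open>spin_act (wp a)\<close> act on the equation itself produces the
  negatives of these terms, by the gravitino equation, and the missing connection terms as
  well.\<close>

lemma nablap_dilatino: "cl (nablap_d\<phi> a) \<epsilon> = (1/12) *\<^sub>R cl3 (nablap_H a) \<epsilon>"
proof -
  have "spin_act (wp a) (cl \<phi> \<epsilon>) = (1/12) *\<^sub>R spin_act (wp a) (cl3 H \<epsilon>)"
    by (simp add: dilatino spin_act_simps)
  then have e1: "cl \<phi> (spin_act (wp a) \<epsilon>) + cl (\<lambda>s. \<Sum>t\<in>UNIV. wp a s t * \<phi> t) \<epsilon>
     = (1/12) *\<^sub>R (cl3 H (spin_act (wp a) \<epsilon>)
       + cl3 (\<lambda>b c d. \<Sum>t\<in>UNIV. wp a b t * H t c d + wp a c t * H b t d + wp a d t * H b c t) \<epsilon>)"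
    by (simp add: spin_act_cl[where A = "wp a", OF wp_skew] spin_act_cl3[where A = "wp a", OF wp_skew])
  have e2: "cl (d\<phi> a) \<epsilon> - cl \<phi> (spin_act (wp a) \<epsilon>)
     = (1/12) *\<^sub>R (cl3 (dH a) \<epsilon> - cl3 H (spin_act (wp a) \<epsilon>))"
    using d_dilatino[of a] by (simp add: gravitino cl_simps cl3_simps)
  have "cl (d\<phi> a) \<epsilon> + cl (\<lambda>s. \<Sum>t\<in>UNIV. wp a s t * \<phi> t) \<epsilon>
    = (cl (d\<phi> a) \<epsilon> - cl \<phi> (spin_act (wp a) \<epsilon>))
      + (cl \<phi> (spin_act (wp a) \<epsilon>) + cl (\<lambda>s. \<Sum>t\<in>UNIV. wp a s t * \<phi> t) \<epsilon>)"
    by simp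
  also have "\<dots>
    = (1/12) *\<^sub>R (cl3 (dH a) \<epsilon>
       + cl3 (\<lambda>b c d. \<Sum>t\<in>UNIV. wp a b t * H t c d + wp a c t * H b t d + wp a d t * H b c t) \<epsilon>)"
    unfolding e1 e2 scaleR_add_right[symmetric] by simp
  finally show ?thesis
    by (simp add: nablap_d\<phi>_def[abs_def] nablap_H_def[abs_def] cl_vec_add cl3_add)
qed

lemma einstein_spinor:
  "cl (\<lambda>b. - (\<Sum>c\<in>UNIV. curvp a c c b) + 2 * nablap_d\<phi> a b) \<epsilon> + (1/12) *\<^sub>R cl3 (d_H a) \<epsilon> = 0"
proof -
  have "cl3 (curvp a) \<epsilon> = (\<Sum>c\<in>UNIV. G c (cl2 (curvp a c) \<epsilon>))"
    by (simp add: cl3_def cl2_def G_sum G_scale)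
  then have "0 = cl3 (curvp a) \<epsilon>"
    by (simp add: integrability G_zero)
  also have "\<dots> = 2 *\<^sub>R cl (\<lambda>b. \<Sum>c\<in>UNIV. curvp a c c b) \<epsilon>
      + (1/3) *\<^sub>R cl3 (\<lambda>c s b. curvp a c s b + curvp a s b c + curvp a b c s) \<epsilon>"
    by (rule cl3_cyclic) (rule curvp_skew)
  also have "cl3 (\<lambda>c s b. curvp a c s b + curvp a s b c + curvp a b c s) \<epsilon>
      = (- 1) *\<^sub>R cl3 (nablap_H a) \<epsilon> + (- 1/2) *\<^sub>R cl3 (d_H a) \<epsilon>"
  proof -
    have "(\<lambda>c s b. curvp a c s b + curvp a s b c + curvp a b c s)
       = (\<lambda>c s b. (- 1) * nablap_H a c s b + (- 1/2) * d_H a c s b)"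
      by (simp add: curvp_cyclic fun_eq_iff)
    then show ?thesis by (simp only: cl3_add cl3_scale)
  qed
  also have "cl3 (nablap_H a) \<epsilon> = 12 *\<^sub>R cl (nablap_d\<phi> a) \<epsilon>"
    by (simp add: nablap_dilatino)
  \<comment> \<open>The 4 is 12/3, with 12 from the dilatino equation and 1/3 from
    \<open>cl3_cyclic\<close>; the 1/6 is half of that 1/3. Multiplication by -1/2 below restores
    the normalization of \<open>Q\<close>.\<close>
  finally have e: "2 *\<^sub>R cl (\<lambda>b. \<Sum>c\<in>UNIV. curvp a c c b) \<epsilon> - 4 *\<^sub>R cl (nablap_d\<phi> a) \<epsilon> - (1/6) *\<^sub>R cl3 (d_H a) \<epsilon> = 0"
    by (simp add: scaleR_add_right scaleR_diff_right add_diff_eq)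
  have "cl (\<lambda>b. - (\<Sum>c\<in>UNIV. curvp a c c b) + 2 * nablap_d\<phi> a b) \<epsilon> + (1/12) *\<^sub>R cl3 (d_H a) \<epsilon>
     = (- 1/2) *\<^sub>R (2 *\<^sub>R cl (\<lambda>b. \<Sum>c\<in>UNIV. curvp a c c b) \<epsilon> - 4 *\<^sub>R cl (nablap_d\<phi> a) \<epsilon> - (1/6) *\<^sub>R cl3 (d_H a) \<epsilon>)"
    by (simp add: cl_vec_diff cl_vec_scale scaleR_diff_right)
  then show ?thesis by (simp only: e) simp
qed

lemma einstein_eq_d_H:
  "einstein m n = - (\<Sum>s\<in>UNIV. \<Sum>t\<in>UNIV. \<Sum>r\<in>UNIV. d_H m s t r * P t r * P s n) / 4"
proof -
  have contact: "contact_spinor G J \<epsilon> \<xi> P" ..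
  define Q where "Q a b = - (\<Sum>c\<in>UNIV. curvp a c c b) + 2 * nablap_d\<phi> a b" for a b
  have eq: "cl (Q a) \<epsilon> + (1/12) *\<^sub>R cl3 (d_H a) \<epsilon> = 0" for a
    unfolding Q_def[abs_def] by (rule einstein_spinor)
  note main = einstein_of_spinor[where Q = Q, OF contact d_H_skew eq]
  \<comment> \<open>\<open>Q\<close> differs from the symmetric \<open>einstein\<close> by a skew
    tensor. As \<open>Q\<close> is itself symmetric by \<open>main(2)\<close>, the skew tensor
    vanishes.\<close>
  have "Q m n = einstein m n"
    using ricci_eq[of m n] ricci_eq[of n m] skew_part[of m n] main(2)[of m n] einstein_sym[of m n]
    unfolding Q_def by linarith
  then show ?thesis using main(1)[of m n] by simp
qed

end

section \<open>Smooth functions and tangent vectors\<close>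

lemma Ck_on_subset: "Ck_on k S f \<Longrightarrow> T \<subseteq> S \<Longrightarrow> Ck_on k T f"
  by (induction k arbitrary: f) (auto intro: continuous_on_subset)

text \<open>On an open set the derivative at a point depends only on the values in the set, which
  carries the induction.\<close>

lemma Ck_on_cong:
  assumes "open S" "\<And>x. x \<in> S \<Longrightarrow> f x = g x" "Ck_on k S f"
  shows "Ck_on k S g"
  using assms(2,3)
proof (induction k arbitrary: f g)
  case 0
  then show ?case using continuous_on_cong[of S S f g] by simp
next
  case (Suc k)
  have d: "(g has_derivative frechet_derivative f (at x)) (at x)" if "x \<in> S" for x
  proof (rule has_derivative_transform_within_open[OF _ \<open>open S\<close> that])
    show "(f has_derivative frechet_derivative f (at x)) (at x)"
      using Suc.prems(2) that by (simp add: frechet_derivative_works[symmetric])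
  qed (use Suc.prems(1) in auto)
  have fd: "frechet_derivative f (at x) = frechet_derivative g (at x)" if "x \<in> S" for x
    using frechet_derivative_at[OF d[OF that]] .
  have "Ck_on k S (\<lambda>x. frechet_derivative g (at x) v)" for v
  proof (rule Suc.IH)
    show "Ck_on k S (\<lambda>x. frechet_derivative f (at x) v)" using Suc.prems(2) by simp
  qed (simp add: fd)
  moreover have "g differentiable at x" if "x \<in> S" for x
    using d[OF that] by (auto simp: differentiable_def)
  ultimately show ?case by simp
qed

lemma Ck_on_Suc_imp: "Ck_on (Suc k) S f \<Longrightarrow> Ck_on k S f"
proof (induction k arbitrary: f)
  case 0
  then show ?case
    by (auto intro!: continuous_at_imp_continuous_on differentiable_imp_continuous_within)
next
  case (Suc k)
  then show ?case by (auto simp del: Ck_on.simps simp add: Ck_on.simps(2))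
qed

text \<open>Lets a derivative supplied by a differentiation rule stand in for
  \<open>frechet_derivative\<close>; the closure properties below are proved this way.\<close>

lemma Ck_on_SucI:
  assumes "open S" "\<And>x. x \<in> S \<Longrightarrow> (f has_derivative D x) (at x)" "\<And>v. Ck_on k S (\<lambda>x. D x v)"
  shows "Ck_on (Suc k) S f"
proof -
  have fd: "D x = frechet_derivative f (at x)" if "x \<in> S" for x
    using frechet_derivative_at[OF assms(2)[OF that]] .
  have "Ck_on k S (\<lambda>x. frechet_derivative f (at x) v)" for v
    by (rule Ck_on_cong[OF assms(1) _ assms(3)[of v]]) (simp add: fd)
  moreover have "f differentiable at x" if "x \<in> S" for x
    using assms(2)[OF that] by (auto simp: differentiable_def)
  ultimately show ?thesis by simp
qed

lemma Ck_on_has_derivative: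
  "Ck_on (Suc k) S f \<Longrightarrow> x \<in> S \<Longrightarrow> (f has_derivative frechet_derivative f (at x)) (at x)"
  by (simp add: frechet_derivative_works[symmetric])

lemma Ck_on_const: "open S \<Longrightarrow> Ck_on k S (\<lambda>x. c)"
proof (induction k arbitrary: c)
  case (Suc k)
  then show ?case by (intro Ck_on_SucI[where D = "\<lambda>x v. 0"]) auto
qed simp

lemma Ck_on_linear:
  assumes "open S" "bounded_linear L"
  shows "Ck_on k S f \<Longrightarrow> Ck_on k S (\<lambda>x. L (f x))"
proof (induction k arbitrary: f)
  case 0
  then show ?case using bounded_linear.continuous_on[OF assms(2)] by simp
next
  case (Suc k)
  show ?case
    by (rule Ck_on_SucI[OF assms(1) bounded_linear.has_derivative[OF assms(2) Ck_on_has_derivative[OF Suc.prems]]])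
      (use Suc in auto)
qed

lemma Ck_on_add:
  assumes "open S"
  shows "Ck_on k S f \<Longrightarrow> Ck_on k S g \<Longrightarrow> Ck_on k S (\<lambda>x. f x + g x)"
proof (induction k arbitrary: f g)
  case 0
  then show ?case by (simp add: continuous_on_add)
next
  case (Suc k)
  show ?case
    by (rule Ck_on_SucI[OF assms has_derivative_add[OF Ck_on_has_derivative[OF Suc.prems(1)] Ck_on_has_derivative[OF Suc.prems(2)]]])
      (use Suc in auto)
qed

lemma Ck_on_mult:
  fixes f g :: "'a::real_normed_vector \<Rightarrow> real"
  assumes "open S"
  shows "Ck_on k S f \<Longrightarrow> Ck_on k S g \<Longrightarrow> Ck_on k S (\<lambda>x. f x * g x)"
proof (induction k arbitrary: f g)
  case 0
  then show ?case by (simp add: continuous_on_mult)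
next
  case (Suc k)
  show ?case
  proof (rule Ck_on_SucI[OF assms has_derivative_mult[OF Ck_on_has_derivative[OF Suc.prems(1)] Ck_on_has_derivative[OF Suc.prems(2)]]])
    fix v
    show "Ck_on k S (\<lambda>x. f x * frechet_derivative g (at x) v + frechet_derivative f (at x) v * g x)"
      using Suc.prems by (intro Ck_on_add[OF assms] Suc.IH) (auto intro: Ck_on_Suc_imp simp del: Ck_on.simps simp add: Ck_on.simps(2))
  qed
qed

lemma smooth_on_has_derivative:
  "smooth_on S f \<Longrightarrow> x \<in> S \<Longrightarrow> (f has_derivative frechet_derivative f (at x)) (at x)"
  unfolding smooth_on_def using Ck_on_has_derivative by blast

section \<open>Locality, linearity and Leibniz rule of tangent vectors\<close>

context
  fixes A :: "'p::topological_space chart set"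
  assumes atlas: "smooth_atlas A"
begin

lemma chart_open: "(U, x) \<in> A \<Longrightarrow> open W \<Longrightarrow> open (x ` (U \<inter> W))"
proof -
  assume c: "(U, x) \<in> A" and W: "open W"
  have U: "open U" "open (x ` U)" and h: "homeomorphism U (x ` U) x (inv_into U x)"
    using atlas c unfolding smooth_atlas_def by auto
  have "openin (top_of_set U) (U \<inter> W)"
    using W by (auto simp: openin_open)
  then have "openin (top_of_set (x ` U)) (x ` (U \<inter> W))"
    using homeomorphism_imp_open_map[OF h] by blast
  then show ?thesis using U(2) openin_open_trans by blast
qed

lemma chart_inv: "(U, x) \<in> A \<Longrightarrow> p \<in> U \<Longrightarrow> inv_into U x (x p) = p"
proof -
  assume c: "(U, x) \<in> A" and p: "p \<in> U"
  have "homeomorphism U (x ` U) x (inv_into U x)"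
    using atlas c unfolding smooth_atlas_def by auto
  then show ?thesis using p by (simp add: homeomorphism_apply1)
qed

lemma chart_exists: "\<exists>U x. (U, x) \<in> A \<and> p \<in> U"
proof -
  have "p \<in> \<Union> (fst ` A)"
    using atlas unfolding smooth_atlas_def by (elim conjE) simp
  then obtain c where "c \<in> A" "p \<in> fst c" by blast
  then show ?thesis by (metis prod.collapse)
qed

lemma smooth_fn_iff:
  "smooth_fn A W f \<longleftrightarrow> (\<forall>U x k. (U, x) \<in> A \<longrightarrow> Ck_on k (x ` (U \<inter> W)) (\<lambda>z. f (inv_into U x z)))"
proof
  assume *: "smooth_fn A W f"
  show "\<forall>U x k. (U, x) \<in> A \<longrightarrow> Ck_on k (x ` (U \<inter> W)) (\<lambda>z. f (inv_into U x z))"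
  proof (intro allI impI)
    fix U x k assume c: "(U, x) \<in> A"
    show "Ck_on k (x ` (U \<inter> W)) (\<lambda>z. f (inv_into U x z))"
      using bspec[OF *[unfolded smooth_fn_def] c] by (simp add: smooth_on_def o_def)
  qed
next
  assume *: "\<forall>U x k. (U, x) \<in> A \<longrightarrow> Ck_on k (x ` (U \<inter> W)) (\<lambda>z. f (inv_into U x z))"
  show "smooth_fn A W f"
    unfolding smooth_fn_def
  proof (clarify)
    fix U x assume "(U, x) \<in> A"
    then show "smooth_on (x ` (U \<inter> W)) (f \<circ> inv_into U x)"
      using * by (simp add: smooth_on_def o_def)
  qed
qed

lemma smooth_fn_subset:
  assumes "smooth_fn A W f" "V \<subseteq> W"
  shows "smooth_fn A V f"
  unfolding smooth_fn_iff
proof (intro allI impI)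
  fix U x k assume "(U, x) \<in> A"
  then have "Ck_on k (x ` (U \<inter> W)) (\<lambda>z. f (inv_into U x z))"
    using assms(1) unfolding smooth_fn_iff by blast
  then show "Ck_on k (x ` (U \<inter> V)) (\<lambda>z. f (inv_into U x z))"
    by (rule Ck_on_subset) (use assms(2) in blast)
qed

lemma smooth_fn_cong:
  assumes "open W" "\<And>q. q \<in> W \<Longrightarrow> f q = g q" "smooth_fn A W f"
  shows "smooth_fn A W g"
  unfolding smooth_fn_def smooth_on_def
proof (clarify)
  fix U x k assume c: "(U, x) \<in> A"
  show "Ck_on k (x ` (U \<inter> W)) (g \<circ> inv_into U x)"
  proof (rule Ck_on_cong[OF chart_open[OF c assms(1)]])
    show "Ck_on k (x ` (U \<inter> W)) (f \<circ> inv_into U x)"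
      using assms(3) c unfolding smooth_fn_def smooth_on_def by blast
  qed (auto simp: chart_inv[OF c] assms(2))
qed

lemma smooth_fn_const: "open W \<Longrightarrow> smooth_fn A W (\<lambda>q. c)"
  unfolding smooth_fn_iff by (auto intro: Ck_on_const chart_open)

lemma smooth_fn_linear: "open W \<Longrightarrow> bounded_linear L \<Longrightarrow> smooth_fn A W f \<Longrightarrow> smooth_fn A W (\<lambda>q. L (f q))"
  unfolding smooth_fn_iff by (intro allI impI, rule Ck_on_linear[where L = L]) (auto intro: chart_open)

lemma smooth_fn_add: "open W \<Longrightarrow> smooth_fn A W f \<Longrightarrow> smooth_fn A W g \<Longrightarrow> smooth_fn A W (\<lambda>q. f q + g q)"
  unfolding smooth_fn_iff by (intro allI impI, rule Ck_on_add) (auto intro: chart_open)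

lemma smooth_fn_mult:
  fixes f g :: "'p \<Rightarrow> real"
  shows "open W \<Longrightarrow> smooth_fn A W f \<Longrightarrow> smooth_fn A W g \<Longrightarrow> smooth_fn A W (\<lambda>q. f q * g q)"
  unfolding smooth_fn_iff by (intro allI impI, rule Ck_on_mult) (auto intro: chart_open)

lemma smooth_nearI: "open W \<Longrightarrow> p \<in> W \<Longrightarrow> smooth_fn A W f \<Longrightarrow> smooth_near A p f"
  unfolding smooth_near_def by blast

lemma smooth_near_cong:
  assumes "smooth_near A p f" "open W" "p \<in> W" "\<And>q. q \<in> W \<Longrightarrow> f q = g q"
  shows "smooth_near A p g"
proof -
  obtain V where V: "open V" "p \<in> V" "smooth_fn A V f"
    using assms(1) unfolding smooth_near_def by blast
  have "smooth_fn A (V \<inter> W) g"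
    by (rule smooth_fn_cong[of _ f]) (use assms V smooth_fn_subset[OF V(3), of "V \<inter> W"] in auto)
  then show ?thesis
    by (rule smooth_nearI[rotated 2]) (use V assms in auto)
qed

lemma smooth_near_const: "smooth_near A p (\<lambda>q. c)"
  by (rule smooth_nearI[of UNIV]) (auto intro: smooth_fn_const)

lemma smooth_near_common:
  assumes "smooth_near A p f" "smooth_near A p g"
  obtains W where "open W" "p \<in> W" "smooth_fn A W f" "smooth_fn A W g"
proof -
  obtain V W where V: "open V" "p \<in> V" "smooth_fn A V f" and W: "open W" "p \<in> W" "smooth_fn A W g"
    using assms unfolding smooth_near_def by blast
  show ?thesis
    by (rule that[of "V \<inter> W"]) (use V W smooth_fn_subset[OF V(3), of "V \<inter> W"] smooth_fn_subset[OF W(3), of "V \<inter> W"] in auto)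
qed

lemma smooth_near_add: "smooth_near A p f \<Longrightarrow> smooth_near A p g \<Longrightarrow> smooth_near A p (\<lambda>q. f q + g q)"
  by (erule (1) smooth_near_common) (blast intro: smooth_nearI smooth_fn_add)

lemma smooth_near_mult: "smooth_near A p f \<Longrightarrow> smooth_near A p g \<Longrightarrow> smooth_near A p (\<lambda>q. f q * g q)"
  by (erule (1) smooth_near_common) (blast intro: smooth_nearI smooth_fn_mult)

lemma smooth_near_sum:
  "(\<And>i. i \<in> I \<Longrightarrow> smooth_near A p (f i)) \<Longrightarrow> smooth_near A p (\<lambda>q. \<Sum>i\<in>I. f i q)"
  by (induction I rule: infinite_finite_induct) (simp_all add: smooth_near_const smooth_near_add)

lemma chart_rep_derivative:
  assumes c: "(U, x) \<in> A" "p \<in> U" and f: "smooth_near A p f"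
  shows "(f \<circ> inv_into U x has_derivative frechet_derivative (f \<circ> inv_into U x) (at (x p))) (at (x p))"
proof -
  obtain W where W: "open W" "p \<in> W" "smooth_fn A W f"
    using f unfolding smooth_near_def by blast
  then have "smooth_on (x ` (U \<inter> W)) (f \<circ> inv_into U x)"
    using c unfolding smooth_fn_def by blast
  then show ?thesis
    by (rule smooth_on_has_derivative) (use c W in auto)
qed

lemma tvec_smooth_near:
  assumes "v \<in> tspace A p" "\<not> smooth_near A p f"
  shows "v f = 0"
  using assms unfolding tspace_def chart_vec_def by auto

lemma tvec_rep:
  assumes "v \<in> tspace A p"
  obtains U x u where "(U, x) \<in> A" "p \<in> U"
    "\<And>f D. smooth_near A p f \<Longrightarrow> (f \<circ> inv_into U x has_derivative D) (at (x p)) \<Longrightarrow> v f = D u"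
proof -
  obtain U x u where c: "(U, x) \<in> A" "p \<in> U" and v: "v = chart_vec A (U, x) p u"
    using assms unfolding tspace_def by auto
  show ?thesis
    by (rule that[OF c, of u]) (simp add: v chart_vec_def frechet_derivative_at[symmetric])
qed

text \<open>Two cases occur because a tangent vector is zero on functions that are not smooth near
  \<open>p\<close>: by locality either both functions are smooth there or neither is.\<close>

lemma tvec_cong:
  assumes v: "v \<in> tspace A p" and W: "open W" "p \<in> W" and eq: "\<And>q. q \<in> W \<Longrightarrow> f q = g q"
  shows "v f = v g"
proof (cases "smooth_near A p f")
  case True
  have g: "smooth_near A p g" by (rule smooth_near_cong[OF True W eq])
  obtain U x u where c: "(U, x) \<in> A" "p \<in> U" and
    r: "\<And>f D. smooth_near A p f \<Longrightarrow> (f \<circ> inv_into U x has_derivative D) (at (x p)) \<Longrightarrow> v f = D u"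
    using tvec_rep[OF v] by blast
  note d = chart_rep_derivative[OF c True]
  have "(g \<circ> inv_into U x has_derivative frechet_derivative (f \<circ> inv_into U x) (at (x p))) (at (x p))"
    by (rule has_derivative_transform_within_open[OF d chart_open[OF c(1) W(1)]])
      (use c W in \<open>auto simp: chart_inv eq\<close>)
  then show ?thesis using r[OF True d] r[OF g] by simp
next
  case False
  moreover have "\<not> smooth_near A p g"
    using smooth_near_cong[OF _ W, of g f] eq False by auto
  ultimately show ?thesis using tvec_smooth_near[OF v] by simp
qed

lemma tvec_const: "v \<in> tspace A p \<Longrightarrow> v (\<lambda>q. c) = 0"
proof -
  assume v: "v \<in> tspace A p"
  obtain U x u where c: "(U, x) \<in> A" "p \<in> U" and
    r: "\<And>f D. smooth_near A p f \<Longrightarrow> (f \<circ> inv_into U x has_derivative D) (at (x p)) \<Longrightarrow> v f = D u"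
    using tvec_rep[OF v] by blast
  show ?thesis
    using r[OF smooth_near_const, of c "\<lambda>u. 0"] by (simp add: o_def)
qed

text \<open>Additivity is confined to functions smooth near \<open>p\<close>: two other functions,
  on which the vector is zero, may have a smooth sum.\<close>

lemma tvec_add:
  assumes v: "v \<in> tspace A p" and f: "smooth_near A p f" and g: "smooth_near A p g"
  shows "v (\<lambda>q. f q + g q) = v f + v g"
proof -
  obtain U x u where c: "(U, x) \<in> A" "p \<in> U" and
    r: "\<And>f D. smooth_near A p f \<Longrightarrow> (f \<circ> inv_into U x has_derivative D) (at (x p)) \<Longrightarrow> v f = D u"
    using tvec_rep[OF v] by blast
  note d = chart_rep_derivative[OF c f] chart_rep_derivative[OF c g]
  show ?thesis
    using r[OF smooth_near_add[OF f g]] has_derivative_add[OF d] r[OF f d(1)] r[OF g d(2)]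
    by (fastforce simp: o_def)
qed

lemma tvec_mult:
  assumes v: "v \<in> tspace A p" and f: "smooth_near A p f" and g: "smooth_near A p g"
  shows "v (\<lambda>q. f q * g q) = v f * g p + f p * v g"
proof -
  obtain U x u where c: "(U, x) \<in> A" "p \<in> U" and
    r: "\<And>f D. smooth_near A p f \<Longrightarrow> (f \<circ> inv_into U x has_derivative D) (at (x p)) \<Longrightarrow> v f = D u"
    using tvec_rep[OF v] by blast
  note d = chart_rep_derivative[OF c f] chart_rep_derivative[OF c g]
  have "((\<lambda>q. f q * g q) \<circ> inv_into U x has_derivative
     (\<lambda>h. f p * frechet_derivative (g \<circ> inv_into U x) (at (x p)) h
        + frechet_derivative (f \<circ> inv_into U x) (at (x p)) h * g p)) (at (x p))"
    using has_derivative_mult[OF d] by (simp add: o_def chart_inv[OF c])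
  from r[OF smooth_near_mult[OF f g] this] r[OF f d(1)] r[OF g d(2)]
  show ?thesis by simp
qed

lemma tvec_cmult: "v \<in> tspace A p \<Longrightarrow> smooth_near A p f \<Longrightarrow> v (\<lambda>q. c * f q) = c * v f"
  using tvec_mult[OF _ smooth_near_const, of v p f c] by (simp add: tvec_const)

lemma tvec_diff:
  assumes v: "v \<in> tspace A p" and f: "smooth_near A p f" and g: "smooth_near A p g"
  shows "v (\<lambda>q. f q - g q) = v f - v g"
  using tvec_add[OF v f smooth_near_mult[OF smooth_near_const[of p "-1"] g]] tvec_cmult[OF v g, of "-1"]
  by simp

lemma tvec_sum:
  assumes v: "v \<in> tspace A p"
  shows "(\<And>i. i \<in> I \<Longrightarrow> smooth_near A p (f i)) \<Longrightarrow> v (\<lambda>q. \<Sum>i\<in>I. f i q) = (\<Sum>i\<in>I. v (f i))"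
  by (induction I rule: infinite_finite_induct)
    (simp_all add: tvec_const[OF v] tvec_add[OF v] smooth_near_sum)

text \<open>By the chain rule, with \<open>u'\<close> the image of \<open>u\<close> under the
  derivative of the coordinate change. All tangent vectors at \<open>p\<close> can then be written
  in one chart, where they form a linear space.\<close>

lemma chart_vec_change:
  assumes c: "(U, x) \<in> A" "p \<in> U" and d: "(V, y) \<in> A" "p \<in> V"
  obtains u' where "chart_vec A (U, x) p u = chart_vec A (V, y) p u'"
proof -
  define D where "D = frechet_derivative (y \<circ> inv_into U x) (at (x p))"
  have "smooth_on (x ` (U \<inter> V)) (y \<circ> inv_into U x)"
    using atlas c d unfolding smooth_atlas_def by auto
  then have D: "(y \<circ> inv_into U x has_derivative D) (at (x p))"
    unfolding D_def by (rule smooth_on_has_derivative) (use c d in auto)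
  have "frechet_derivative (f \<circ> inv_into U x) (at (x p)) u
      = frechet_derivative (f \<circ> inv_into V y) (at (y p)) (D u)" if f: "smooth_near A p f" for f
  proof -
    note df = chart_rep_derivative[OF d f]
    have "((f \<circ> inv_into V y) \<circ> (y \<circ> inv_into U x) has_derivative
        frechet_derivative (f \<circ> inv_into V y) (at (y p)) \<circ> D) (at (x p))"
      by (rule diff_chain_at[OF D]) (use df chart_inv[OF c] in \<open>simp add: o_def\<close>)
    moreover have "open V"
      using atlas d unfolding smooth_atlas_def by auto
    ultimately have "(f \<circ> inv_into U x has_derivative frechet_derivative (f \<circ> inv_into V y) (at (y p)) \<circ> D) (at (x p))"
      by (rule has_derivative_transform_within_open[OF _ chart_open[OF c(1)]])
        (use c d in \<open>auto simp: chart_inv\<close>)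
    from frechet_derivative_at[OF this] show ?thesis by (metis comp_apply)
  qed
  then show ?thesis
    by (intro that[of "D u"]) (simp add: chart_vec_def fun_eq_iff)
qed

lemma tspace_chart:
  assumes d: "(V, y) \<in> A" "p \<in> V"
  shows "tspace A p = range (chart_vec A (V, y) p)"
proof
  show "tspace A p \<subseteq> range (chart_vec A (V, y) p)"
  proof
    fix v assume "v \<in> tspace A p"
    then obtain U x u where c: "(U, x) \<in> A" "p \<in> U" and v: "v = chart_vec A (U, x) p u"
      unfolding tspace_def by auto
    obtain u' where "chart_vec A (U, x) p u = chart_vec A (V, y) p u'"
      using chart_vec_change[OF c d] by blast
    then show "v \<in> range (chart_vec A (V, y) p)" by (simp add: v)
  qed
  show "range (chart_vec A (V, y) p) \<subseteq> tspace A p"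
    unfolding tspace_def using d by force
qed

lemma chart_vec_lincomb:
  assumes c: "(U, x) \<in> A" "p \<in> U"
  shows "chart_vec A (U, x) p (a *\<^sub>R u + b *\<^sub>R u') = (\<lambda>f. a * chart_vec A (U, x) p u f + b * chart_vec A (U, x) p u' f)"
proof
  fix f
  show "chart_vec A (U, x) p (a *\<^sub>R u + b *\<^sub>R u') f = a * chart_vec A (U, x) p u f + b * chart_vec A (U, x) p u' f"
  proof (cases "smooth_near A p f")
    case True
    from has_derivative_linear[OF chart_rep_derivative[OF c True]]
    interpret linear "frechet_derivative (f \<circ> inv_into U x) (at (x p))" .
    show ?thesis using True by (simp add: chart_vec_def add scale)
  qed (simp add: chart_vec_def)
qed

lemma tspace_lincomb:
  assumes "v \<in> tspace A p" "w \<in> tspace A p"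
  shows "(\<lambda>f. a * v f + b * w f) \<in> tspace A p"
proof -
  obtain U x where c: "(U, x) \<in> A" "p \<in> U" using chart_exists by blast
  show ?thesis
    using assms unfolding tspace_chart[OF c]
    by (auto simp: chart_vec_lincomb[OF c, symmetric])
qed

lemma tspace_zero: "(\<lambda>f. 0) \<in> tspace A p"
proof -
  obtain U x where c: "(U, x) \<in> A" "p \<in> U" using chart_exists by blast
  have "chart_vec A (U, x) p 0 \<in> tspace A p"
    unfolding tspace_chart[OF c] by simp
  from tspace_lincomb[OF this this, of 0 0] show ?thesis by simp
qed

lemma tspace_sum:
  assumes "\<And>i. i \<in> I \<Longrightarrow> v i \<in> tspace A p"
  shows "(\<lambda>f. \<Sum>i\<in>I. c i * v i f) \<in> tspace A p"
  using assms
proof (induction I rule: infinite_finite_induct)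
  case (insert i I)
  then show ?case
    using tspace_lincomb[of "v i" p "\<lambda>f. \<Sum>i\<in>I. c i * v i f" "c i" 1] by simp
qed (simp_all add: tspace_zero)

lemma tlinearD:
  assumes "tlinear A p \<theta>" "v \<in> tspace A p" "w \<in> tspace A p"
  shows "\<theta> (\<lambda>f. c * v f + d * w f) = c *\<^sub>R \<theta> v + d *\<^sub>R \<theta> w"
  by (rule assms(1)[unfolded tlinear_def, rule_format, OF assms(2,3)])

lemma tlinear_zero: "tlinear A p \<theta> \<Longrightarrow> \<theta> (\<lambda>f. 0) = 0"
  using tlinearD[OF _ tspace_zero tspace_zero, of p \<theta> 0 0] by simp

lemma tlinear_sum:
  assumes "tlinear A p \<theta>" "\<And>i. i \<in> I \<Longrightarrow> v i \<in> tspace A p"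
  shows "\<theta> (\<lambda>f. \<Sum>i\<in>I. c i * v i f) = (\<Sum>i\<in>I. c i *\<^sub>R \<theta> (v i))"
  using assms(2)
proof (induction I rule: infinite_finite_induct)
  case (insert i I)
  have "\<theta> (\<lambda>f. c i * v i f + 1 * (\<Sum>i\<in>I. c i * v i f)) = c i *\<^sub>R \<theta> (v i) + 1 *\<^sub>R \<theta> (\<lambda>f. \<Sum>i\<in>I. c i * v i f)"
    by (rule tlinearD[OF assms(1)]) (simp_all add: insert.prems tspace_sum)
  then show ?case using insert by simp
qed (simp_all add: tlinear_zero[OF assms(1)])

end

section \<open>Orthonormal frames\<close>

lemma (in clifford_module) cl2_vec_add: "cl2 (\<lambda>a b. X a b + Y a b) v = cl2 X v + cl2 Y v"
  by (simp add: cl2_def scaleR_add_left sum.distrib)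
lemma (in clifford_module) cl2_vec_diff: "cl2 (\<lambda>a b. X a b - Y a b) v = cl2 X v - cl2 Y v"
  by (simp add: cl2_def scaleR_diff_left sum_subtractf)
lemma (in clifford_module) cl2_vec_sum: "cl2 (\<lambda>a b. \<Sum>i\<in>I. c i * X i a b) v = (\<Sum>i\<in>I. c i *\<^sub>R cl2 (X i) v)"
proof (induction I rule: infinite_finite_induct)
  case (insert i I)
  then show ?case by (simp add: cl2_vec_add) (simp add: cl2_def scaleR_sum_right)
qed (simp_all add: cl2_def)

text \<open>In the cyclic sum the terms quadratic in \<open>w\<close> group into products of
  brackets, and the derivatives of \<open>w\<close> into derivatives of brackets. Only the structure
  functions of the frame remain, to which the Jacobi identity applies.\<close>

lemma (in torsion_jet) curv_cyclic:
  "curv a b s c + curv b c s a + curv c a s b =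
    (dw a b s c - dw a c s b) + (dw b c s a - dw b a s c) + (dw c a s b - dw c b s a)
    + ((\<Sum>t\<in>UNIV. bracket b c t * bracket a t s) + (\<Sum>t\<in>UNIV. bracket c a t * bracket b t s)
    + (\<Sum>t\<in>UNIV. bracket a b t * bracket c t s))"
proof -
  have "- (\<Sum>t\<in>UNIV. bracket a b t * w t s c) + (\<Sum>t\<in>UNIV. w a s t * w b t c - w b s t * w a t c)
    + (- (\<Sum>t\<in>UNIV. bracket b c t * w t s a) + (\<Sum>t\<in>UNIV. w b s t * w c t a - w c s t * w b t a))
    + (- (\<Sum>t\<in>UNIV. bracket c a t * w t s b) + (\<Sum>t\<in>UNIV. w c s t * w a t b - w a s t * w c t b))
    = (\<Sum>t\<in>UNIV. bracket b c t * bracket a t s) + (\<Sum>t\<in>UNIV. bracket c a t * bracket b t s)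
    + (\<Sum>t\<in>UNIV. bracket a b t * bracket c t s)"
    unfolding sum_negf[symmetric] sum.distrib[symmetric]
    by (intro sum.cong refl) (simp add: bracket_def algebra_simps)
  then show ?thesis by (simp add: curv_def)
qed

text \<open>A metric connection seen in a single frame, without the change-of-frame law. The domain
  is a free parameter so that connections given on different covers can be restricted to a common
  overlap.\<close>

definition frame_connection ::
  "'p::topological_space chart set \<Rightarrow> 'p set \<Rightarrow> ('p \<Rightarrow> 'p tvec \<Rightarrow> real^'r^'r) \<Rightarrow> bool" where
  "frame_connection A S w \<longleftrightarrow>
     (\<forall>p\<in>S. tlinear A p (w p) \<and> (\<forall>v\<in>tspace A p. transpose (w p v) = - w p v)) \<and>
     (\<forall>W X. open W \<and> W \<subseteq> S \<and> smooth_vfield A W X \<longrightarrow> smooth_fn A W (\<lambda>p. w p (X p)))"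

lemma frame_connectionD:
  assumes "frame_connection A S w"
  shows "p \<in> S \<Longrightarrow> tlinear A p (w p)"
    and "p \<in> S \<Longrightarrow> v \<in> tspace A p \<Longrightarrow> transpose (w p v) = - w p v"
    and "open V \<Longrightarrow> V \<subseteq> S \<Longrightarrow> smooth_vfield A V X \<Longrightarrow> smooth_fn A V (\<lambda>p. w p (X p))"
  using assms[unfolded frame_connection_def, THEN conjunct1, rule_format, of p]
    assms[unfolded frame_connection_def, THEN conjunct2, rule_format, of V X]
  by simp_all

lemma metric_connection_frame:
  assumes conn: "metric_connection A V \<tau> w" and S: "S \<subseteq> V j"
  shows "frame_connection A S (w j)"
  unfolding frame_connection_def
proof (intro conjI ballI allI impI)
  fix p assume "p \<in> S"
  then have "p \<in> V j" using S by auto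
  note c = conn[unfolded metric_connection_def, THEN conjunct1, rule_format, OF this]
  show "tlinear A p (w j p)" using c by simp
  fix v assume "v \<in> tspace A p"
  then show "transpose (w j p v) = - w j p v" using c by simp
next
  fix W X assume "open W \<and> W \<subseteq> S \<and> smooth_vfield A W X"
  then show "smooth_fn A W (\<lambda>p. w j p (X p))"
    using conn[unfolded metric_connection_def, THEN conjunct2, THEN conjunct1, rule_format, of W j X]
      subset_trans[OF _ S, of W] by simp
qed

lemma smooth_vfieldD:
  assumes "smooth_vfield A S X"
  shows "p \<in> S \<Longrightarrow> X p \<in> tspace A p"
    and "open V \<Longrightarrow> V \<subseteq> S \<Longrightarrow> smooth_fn A V f \<Longrightarrow> smooth_fn A V (\<lambda>p. X p f)"
  using assms[unfolded smooth_vfield_def, THEN conjunct1, rule_format, of p]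
    assms[unfolded smooth_vfield_def, THEN conjunct2, rule_format, of V f]
  by simp_all

lemma smooth_vfield_subset:
  fixes A :: "'p::topological_space chart set"
  assumes X: "smooth_vfield A S X" and sub: "T \<subseteq> S"
  shows "smooth_vfield A T X"
  unfolding smooth_vfield_def
proof (intro conjI ballI allI impI)
  fix p assume "p \<in> T"
  then show "X p \<in> tspace A p" using smooth_vfieldD(1)[OF X] sub by auto
next
  fix V and f :: "'p \<Rightarrow> real" assume "open V \<and> V \<subseteq> T \<and> smooth_fn A V f"
  then show "smooth_fn A V (\<lambda>p. X p f)" using smooth_vfieldD(2)[OF X, of V f] subset_trans[OF _ sub, of V] by simp
qed

section \<open>Calculus in one orthonormal frame\<close>

locale orthonormal_frame =
  fixes A :: "'p::topological_space chart set" and g :: "'p \<Rightarrow> 'p tvec \<Rightarrow> 'p tvec \<Rightarrow> real"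
    and S :: "'p set" and E :: "5 \<Rightarrow> 'p vfield" and W :: "'p \<Rightarrow> 'p tvec \<Rightarrow> real^5^5"
  assumes atlas: "smooth_atlas A" and metric: "riemannian_metric A g" and open_S: "open S"
    and E_smooth: "smooth_vfield A S (E a)"
    and orthonormal: "p \<in> S \<Longrightarrow> g p (E a p) (E b p) = (if a = b then 1 else 0)"
    and connection: "frame_connection A S W"
    and torsion_free: "p \<in> S \<Longrightarrow> lie_bracket A (E a) (E b) p
      = (\<lambda>f. \<Sum>s\<in>UNIV. (W p (E a p) $ s $ b - W p (E b p) $ s $ a) * E s p f)"
begin

lemma E_tspace: "p \<in> S \<Longrightarrow> E a p \<in> tspace A p"
  by (rule smooth_vfieldD(1)[OF E_smooth])

lemma E_smooth_fn:
  assumes "open V" "V \<subseteq> S" "smooth_fn A V f"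
  shows "smooth_fn A V (\<lambda>q. E a q f)"
  by (rule smooth_vfieldD(2)[OF E_smooth assms])

lemma E_smooth_near:
  assumes "p \<in> S" "smooth_near A p f"
  shows "smooth_near A p (\<lambda>q. E a q f)"
proof -
  obtain V where V: "open V" "p \<in> V" "smooth_fn A V f"
    using assms(2) unfolding smooth_near_def by blast
  have "smooth_fn A (V \<inter> S) (\<lambda>q. E a q f)"
    using V open_S smooth_fn_subset[OF atlas V(3), of "V \<inter> S"] by (intro E_smooth_fn) auto
  then show ?thesis
    by (rule smooth_nearI[OF atlas, rotated 2]) (use V assms open_S in auto)
qed

lemma bracket_apply:
  assumes "p \<in> S" "smooth_near A p f"
  shows "E a p (\<lambda>q. E b q f) - E b p (\<lambda>q. E a q f)
    = (\<Sum>s\<in>UNIV. (W p (E a p) $ s $ b - W p (E b p) $ s $ a) * E s p f)"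
  using fun_cong[OF torsion_free[OF assms(1), of a b], of f] assms(2) by (simp add: lie_bracket_def)

lemma connection_smooth_near:
  assumes "frame_connection A S w" "p \<in> S"
  shows "smooth_near A p (\<lambda>q. w q (E a q) $ s $ b)"
proof -
  have "smooth_fn A S (\<lambda>q. w q (E a q))"
    by (rule frame_connectionD(3)[OF assms(1) open_S order_refl E_smooth])
  then have "smooth_fn A S (\<lambda>q. w q (E a q) $ s $ b)"
    by (rule smooth_fn_linear[OF atlas open_S, rotated])
      (intro bounded_linear_compose[OF bounded_linear_vec_nth bounded_linear_vec_nth])
  then show ?thesis by (rule smooth_nearI[OF atlas open_S assms(2)])
qed

lemma connection_skew:
  assumes "frame_connection A S w" "p \<in> S"
  shows "w p (E a p) $ s $ b = - w p (E a p) $ b $ s"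
proof -
  have "transpose (w p (E a p)) = - w p (E a p)"
    by (rule frame_connectionD(2)[OF assms E_tspace[OF assms(2)]])
  then have "transpose (w p (E a p)) $ b $ s = (- w p (E a p)) $ b $ s" by simp
  then show ?thesis by (simp add: transpose_def)
qed

lemma deriv_connection_skew:
  assumes "frame_connection A S w" "p \<in> S"
  shows "E c p (\<lambda>q. w q (E a q) $ s $ b) = - E c p (\<lambda>q. w q (E a q) $ b $ s)"
proof -
  have "E c p (\<lambda>q. w q (E a q) $ s $ b) = E c p (\<lambda>q. - 1 * w q (E a q) $ b $ s)"
    by (rule tvec_cong[OF atlas E_tspace open_S]) (use assms connection_skew in auto)
  also have "\<dots> = - 1 * E c p (\<lambda>q. w q (E a q) $ b $ s)"
    by (rule tvec_cmult[OF atlas E_tspace connection_smooth_near]) (use assms in auto)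
  finally show ?thesis by simp
qed

lemma connection_bracket:
  assumes "frame_connection A S w" "p \<in> S"
  shows "w p (lie_bracket A (E a) (E b) p)
    = (\<Sum>s\<in>UNIV. (W p (E a p) $ s $ b - W p (E b p) $ s $ a) *\<^sub>R w p (E s p))"
  unfolding torsion_free[OF assms(2)]
  by (rule tlinear_sum[OF atlas frame_connectionD(1)[OF assms] E_tspace[OF assms(2)]])

lemma curvature_component:
  assumes "frame_connection A S w" "p \<in> S"
  shows "curvature A w (E a) (E b) p $ s $ c =
    E a p (\<lambda>q. w q (E b q) $ s $ c) - E b p (\<lambda>q. w q (E a q) $ s $ c)
    - (\<Sum>t\<in>UNIV. (W p (E a p) $ t $ b - W p (E b p) $ t $ a) * w p (E t p) $ s $ c)
    + (\<Sum>t\<in>UNIV. w p (E a p) $ s $ t * w p (E b p) $ t $ c - w p (E b p) $ s $ t * w p (E a p) $ t $ c)"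
  by (simp add: curvature_def mat_deriv_def connection_bracket[OF assms] matrix_matrix_mult_def sum_subtractf)

lemma curvature_skew_form:
  assumes "frame_connection A S w" "p \<in> S"
  shows "curvature A w (E a) (E b) p $ s $ c = - curvature A w (E b) (E a) p $ s $ c"
  by (simp add: curvature_component[OF assms] left_diff_distrib sum_subtractf)

lemma curvature_skew_endo:
  assumes "frame_connection A S w" "p \<in> S"
  shows "curvature A w (E a) (E b) p $ s $ c = - curvature A w (E a) (E b) p $ c $ s"
proof -
  let ?w = "\<lambda>a s b. w p (E a p) $ s $ b" and ?B = "\<lambda>t. W p (E a p) $ t $ b - W p (E b p) $ t $ a"
  note sk = connection_skew[OF assms]
  have "(\<Sum>t\<in>UNIV. ?B t * ?w t s c) = - (\<Sum>t\<in>UNIV. ?B t * ?w t c s)"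
    unfolding sum_negf[symmetric] by (intro sum.cong refl) (subst sk, simp)
  moreover have "(\<Sum>t\<in>UNIV. ?w a s t * ?w b t c - ?w b s t * ?w a t c)
     = - (\<Sum>t\<in>UNIV. ?w a c t * ?w b t s - ?w b c t * ?w a t s)"
    unfolding sum_negf[symmetric]
  proof (intro sum.cong refl)
    fix t
    show "?w a s t * ?w b t c - ?w b s t * ?w a t c = - (?w a c t * ?w b t s - ?w b c t * ?w a t s)"
      using sk[of a s t] sk[of b t c] sk[of b s t] sk[of a t c] by simp
  qed
  ultimately show ?thesis
    using deriv_connection_skew[OF assms, of a b s c] deriv_connection_skew[OF assms, of b a s c]
    by (simp add: curvature_component[OF assms])
qed

text \<open>Pairing with \<open>E b\<close> through the metric isolates one coefficient. Smooth test
  functions suffice, since the frame vectors vanish on all others.\<close>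

lemma frame_indep:
  assumes p: "p \<in> S" and zero: "\<And>f. smooth_near A p f \<Longrightarrow> (\<Sum>s\<in>UNIV. k s * E s p f) = 0"
  shows "k b = 0"
proof -
  have "(\<lambda>f. \<Sum>s\<in>UNIV. k s * E s p f) = (\<lambda>f. 0)"
  proof
    fix f show "(\<Sum>s\<in>UNIV. k s * E s p f) = 0"
      using zero[of f] tvec_smooth_near[OF atlas E_tspace[OF p], of f] by (cases "smooth_near A p f") simp_all
  qed
  moreover have lin: "tlinear A p (g p (E b p))"
    using metric E_tspace[OF p] unfolding riemannian_metric_def by blast
  ultimately have "0 = g p (E b p) (\<lambda>f. \<Sum>s\<in>UNIV. k s * E s p f)"
    using tlinear_zero[OF atlas lin] by simp
  also have "\<dots> = (\<Sum>s\<in>UNIV. k s *\<^sub>R g p (E b p) (E s p))"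
    by (rule tlinear_sum[OF atlas lin E_tspace[OF p]])
  also have "\<dots> = k b"
    by (simp add: orthonormal[OF p] if_distrib cong: if_cong)
  finally show ?thesis by simp
qed

text \<open>In the cyclic sum of \<open>[E_a, [E_b, E_c]] f\<close> all threefold derivatives of
  \<open>f\<close> cancel. Expanded through the structure functions \<open>B\<close>, the sum is a
  combination of the frame vectors, so its coefficients vanish by
  \<open>frame_indep\<close>.\<close>

lemma jacobi:
  assumes p: "p \<in> S"
  defines "B \<equiv> \<lambda>q a b s. W q (E a q) $ s $ b - W q (E b q) $ s $ a"
  shows "E a p (\<lambda>q. B q b c s) + E b p (\<lambda>q. B q c a s) + E c p (\<lambda>q. B q a b s)
    + ((\<Sum>t\<in>UNIV. B p b c t * B p a t s) + (\<Sum>t\<in>UNIV. B p c a t * B p b t s)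
      + (\<Sum>t\<in>UNIV. B p a b t * B p c t s)) = 0"
proof -
  have B_near: "smooth_near A p (\<lambda>q. B q a b s)" for a b s
  proof -
    have "smooth_near A p (\<lambda>q. W q (E a q) $ s $ b + - 1 * W q (E b q) $ s $ a)"
      by (intro smooth_near_add[OF atlas] smooth_near_mult[OF atlas] smooth_near_const[OF atlas]
          connection_smooth_near[OF connection p])
    then show ?thesis by (simp add: B_def)
  qed
  note Et = E_tspace[OF p]
  \<comment> \<open>The left-hand side is \<open>[E_a, [E_b, E_c]] f\<close>. The inner bracket has
    to be expanded on a whole neighbourhood before \<open>E a\<close> differentiates it.\<close>
  have J: "E a p (\<lambda>q. E b q (\<lambda>r. E c r f)) - E a p (\<lambda>q. E c q (\<lambda>r. E b r f))
      - E b p (\<lambda>q. E c q (\<lambda>r. E a r f)) + E c p (\<lambda>q. E b q (\<lambda>r. E a r f))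
      = (\<Sum>s\<in>UNIV. (E a p (\<lambda>q. B q b c s) + (\<Sum>t\<in>UNIV. B p b c t * B p a t s)) * E s p f)"
    if f: "smooth_near A p f" for f a b c
  proof -
    obtain V where V: "open V" "p \<in> V" "smooth_fn A V f"
      using f unfolding smooth_near_def by blast
    have near: "smooth_near A p (\<lambda>q. E s q f)" for s
      by (rule E_smooth_near[OF p f])
    have near2: "smooth_near A p (\<lambda>q. E t q (\<lambda>r. E s r f))" for s t
      by (rule E_smooth_near[OF p near])
    have "E a p (\<lambda>q. E b q (\<lambda>r. E c r f)) - E a p (\<lambda>q. E c q (\<lambda>r. E b r f))
       = E a p (\<lambda>q. E b q (\<lambda>r. E c r f) - E c q (\<lambda>r. E b r f))"
      by (rule tvec_diff[OF atlas Et near2 near2, symmetric])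
    also have "\<dots> = E a p (\<lambda>q. \<Sum>s\<in>UNIV. B q b c s * E s q f)"
    proof (rule tvec_cong[OF atlas Et])
      show "open (V \<inter> S)" "p \<in> V \<inter> S" using V open_S p by auto
      fix q assume q: "q \<in> V \<inter> S"
      then have "smooth_near A q f" by (intro smooth_nearI[OF atlas V(1) _ V(3)]) simp
      then show "E b q (\<lambda>r. E c r f) - E c q (\<lambda>r. E b r f) = (\<Sum>s\<in>UNIV. B q b c s * E s q f)"
        using bracket_apply[of q f b c] q by (simp add: B_def)
    qed
    also have "\<dots> = (\<Sum>s\<in>UNIV. E a p (\<lambda>q. B q b c s * E s q f))"
      by (rule tvec_sum[OF atlas Et]) (intro smooth_near_mult[OF atlas] B_near near)
    also have "\<dots> = (\<Sum>s\<in>UNIV. E a p (\<lambda>q. B q b c s) * E s p f + B p b c s * E a p (\<lambda>q. E s q f))"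
      by (intro sum.cong refl tvec_mult[OF atlas Et] B_near near)
    finally have 1: "E a p (\<lambda>q. E b q (\<lambda>r. E c r f)) - E a p (\<lambda>q. E c q (\<lambda>r. E b r f))
       = (\<Sum>s\<in>UNIV. E a p (\<lambda>q. B q b c s) * E s p f + B p b c s * E a p (\<lambda>q. E s q f))" .
    have 2: "E b p (\<lambda>q. E c q (\<lambda>r. E a r f)) - E c p (\<lambda>q. E b q (\<lambda>r. E a r f))
       = (\<Sum>s\<in>UNIV. B p b c s * E s p (\<lambda>r. E a r f))"
      using bracket_apply[OF p near, of b c a] by (simp add: B_def)
    have 3: "E a p (\<lambda>q. E t q f) - E t p (\<lambda>r. E a r f) = (\<Sum>s\<in>UNIV. B p a t s * E s p f)" for t
      using bracket_apply[OF p f, of a t] by (simp add: B_def)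
    have "E a p (\<lambda>q. E b q (\<lambda>r. E c r f)) - E a p (\<lambda>q. E c q (\<lambda>r. E b r f))
      - E b p (\<lambda>q. E c q (\<lambda>r. E a r f)) + E c p (\<lambda>q. E b q (\<lambda>r. E a r f))
      = (\<Sum>s\<in>UNIV. E a p (\<lambda>q. B q b c s) * E s p f)
        + (\<Sum>t\<in>UNIV. B p b c t * (E a p (\<lambda>q. E t q f) - E t p (\<lambda>r. E a r f)))"
      using 1 2 by (simp add: sum.distrib right_diff_distrib sum_subtractf)
    also have "(\<Sum>t\<in>UNIV. B p b c t * (E a p (\<lambda>q. E t q f) - E t p (\<lambda>r. E a r f)))
       = (\<Sum>s\<in>UNIV. (\<Sum>t\<in>UNIV. B p b c t * B p a t s) * E s p f)"
      unfolding 3 sum_distrib_left sum_distrib_right by (subst sum.swap) (simp add: mult.assoc)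
    finally show ?thesis by (simp add: distrib_right sum.distrib)
  qed
  define k where "k s = E a p (\<lambda>q. B q b c s) + (\<Sum>t\<in>UNIV. B p b c t * B p a t s)
     + (E b p (\<lambda>q. B q c a s) + (\<Sum>t\<in>UNIV. B p c a t * B p b t s))
     + (E c p (\<lambda>q. B q a b s) + (\<Sum>t\<in>UNIV. B p a b t * B p c t s))" for s
  have "(\<Sum>s\<in>UNIV. k s * E s p f) = 0" if f: "smooth_near A p f" for f
    using J[OF f, of a b c] J[OF f, of b c a] J[OF f, of c a b]
    by (simp add: k_def distrib_right[of _ _ "E _ p f"] sum.distrib)
  then have "k s = 0" by (rule frame_indep[OF p])
  then show ?thesis by (simp add: k_def)
qed

end

section \<open>Spinors\<close>

lemma linear_matrix_vector_complex: "linear ((*v) (M :: complex^'n^'m))"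
  by (intro linearI) (simp_all add: vec_eq_iff matrix_vector_mult_def scaleR_sum_right sum.distrib distrib_left)

lemma scaleR_matrix_vector_complex: "(c *\<^sub>R M) *v x = c *\<^sub>R (M *v (x :: complex^'n))"
  by (simp add: vec_eq_iff matrix_vector_mult_def scaleR_sum_right)

lemma sum_matrix_vector_complex: "(\<Sum>i\<in>I. M i) *v (x :: complex^'n) = (\<Sum>i\<in>I. M i *v x)"
  by (induction I rule: infinite_finite_induct) (simp_all add: matrix_vector_mult_add_rdistrib)

lemma gamma_clifford:
  assumes "gamma_matrices \<Gamma>"
  shows "complex_clifford_module (\<lambda>a v. \<Gamma> a *v v) (\<lambda>v. \<i> *s v)"
proof (intro complex_clifford_module.intro clifford_module.intro complex_clifford_module_axioms.intro)
  fix a b and x :: "complex^4"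
  show "linear ((*v) (\<Gamma> a))" by (rule linear_matrix_vector_complex)
  have "\<Gamma> a *v (\<Gamma> b *v x) + \<Gamma> b *v (\<Gamma> a *v x) = (\<Gamma> a ** \<Gamma> b + \<Gamma> b ** \<Gamma> a) *v x"
    by (simp add: matrix_vector_mul_assoc matrix_vector_mult_add_rdistrib)
  also have "\<Gamma> a ** \<Gamma> b + \<Gamma> b ** \<Gamma> a = (if a = b then 2 *\<^sub>R mat 1 else 0)"
    using assms unfolding gamma_matrices_def by blast
  finally show "\<Gamma> a *v (\<Gamma> b *v x) + \<Gamma> b *v (\<Gamma> a *v x) = (if a = b then 2 else 0) *\<^sub>R x"
    by (simp add: scaleR_matrix_vector_complex)
  show "linear (\<lambda>v::complex^4. \<i> *s v)"
    by (intro linearI) (simp_all add: vec_eq_iff distrib_left)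
  show "\<i> *s (\<i> *s x) = - x"
    by (simp add: vec_eq_iff)
  show "\<i> *s (\<Gamma> a *v x) = \<Gamma> a *v (\<i> *s x)"
    by (simp add: vec_eq_iff matrix_vector_mult_def sum_distrib_left mult_ac)
qed

text \<open>Tangent vectors act on real functions, so spinors are handled through the real and
  imaginary parts of their components.\<close>

definition spinor_near :: "'p::topological_space chart set \<Rightarrow> 'p \<Rightarrow> ('p \<Rightarrow> complex^4) \<Rightarrow> bool" where
  "spinor_near A p s \<longleftrightarrow> (\<forall>k. smooth_near A p (\<lambda>q. Re (s q $ k)) \<and> smooth_near A p (\<lambda>q. Im (s q $ k)))"

lemma spinor_nearD:
  "spinor_near A p s \<Longrightarrow> smooth_near A p (\<lambda>q. Re (s q $ k))"
  "spinor_near A p s \<Longrightarrow> smooth_near A p (\<lambda>q. Im (s q $ k))"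
  by (simp_all add: spinor_near_def)

context
  fixes A :: "'p::topological_space chart set"
  assumes atlas: "smooth_atlas A"
begin

lemma spinor_near_scale: "smooth_near A p c \<Longrightarrow> spinor_near A p s \<Longrightarrow> spinor_near A p (\<lambda>q. c q *\<^sub>R s q)"
  by (auto simp: spinor_near_def intro: smooth_near_mult[OF atlas])

lemma spinor_near_sum:
  "(\<And>i. i \<in> I \<Longrightarrow> spinor_near A p (s i)) \<Longrightarrow> spinor_near A p (\<lambda>q. \<Sum>i\<in>I. s i q)"
  by (auto simp: spinor_near_def sum_component Re_sum Im_sum intro: smooth_near_sum[OF atlas])

lemma spinor_near_matrix:
  assumes s: "spinor_near A p s"
  shows "spinor_near A p (\<lambda>q. M *v s q)"
proof -
  have 1: "smooth_near A p (\<lambda>q. \<Sum>l\<in>UNIV. Re (M $ k $ l) * Re (s q $ l) + - Im (M $ k $ l) * Im (s q $ l))" for k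
    by (intro smooth_near_sum[OF atlas] smooth_near_add[OF atlas] smooth_near_mult[OF atlas]
        smooth_near_const[OF atlas] spinor_nearD[OF s])
  have 2: "smooth_near A p (\<lambda>q. \<Sum>l\<in>UNIV. Re (M $ k $ l) * Im (s q $ l) + Im (M $ k $ l) * Re (s q $ l))" for k
    by (intro smooth_near_sum[OF atlas] smooth_near_add[OF atlas] smooth_near_mult[OF atlas]
        smooth_near_const[OF atlas] spinor_nearD[OF s])
  show ?thesis
    using 1 2 by (simp add: spinor_near_def matrix_vector_mult_def Re_sum Im_sum)
qed

lemma spinor_deriv_cong:
  assumes "v \<in> tspace A p" "open V" "p \<in> V" "\<And>q. q \<in> V \<Longrightarrow> s q = t q"
  shows "spinor_deriv v s = spinor_deriv v t"
proof -
  have "v (\<lambda>q. Re (s q $ k)) = v (\<lambda>q. Re (t q $ k))" "v (\<lambda>q. Im (s q $ k)) = v (\<lambda>q. Im (t q $ k))" for k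
    by (rule tvec_cong[OF atlas assms(1-3)], simp add: assms(4))+
  then show ?thesis by (simp add: spinor_deriv_def)
qed

lemma spinor_deriv_scale:
  assumes v: "v \<in> tspace A p" and c: "smooth_near A p c" and s: "spinor_near A p s"
  shows "spinor_deriv v (\<lambda>q. c q *\<^sub>R s q) = v c *\<^sub>R s p + c p *\<^sub>R spinor_deriv v s"
  by (simp add: spinor_deriv_def vec_eq_iff complex_eq_iff tvec_mult[OF atlas v c] spinor_nearD[OF s])

lemma spinor_deriv_sum:
  assumes v: "v \<in> tspace A p" and s: "\<And>i. i \<in> I \<Longrightarrow> spinor_near A p (s i)"
  shows "spinor_deriv v (\<lambda>q. \<Sum>i\<in>I. s i q) = (\<Sum>i\<in>I. spinor_deriv v (s i))"
  using spinor_nearD[OF s]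
  by (simp add: spinor_deriv_def vec_eq_iff complex_eq_iff sum_component Re_sum Im_sum tvec_sum[OF atlas v])

lemma spinor_deriv_matrix:
  assumes v: "v \<in> tspace A p" and s: "spinor_near A p s"
  shows "spinor_deriv v (\<lambda>q. M *v s q) = M *v spinor_deriv v s"
proof -
  have near: "smooth_near A p (\<lambda>q. c * Re (s q $ l))" "smooth_near A p (\<lambda>q. c * Im (s q $ l))" for c l
    by (intro smooth_near_mult[OF atlas] smooth_near_const[OF atlas] spinor_nearD[OF s])+
  have 1: "v (\<lambda>q. \<Sum>l\<in>UNIV. Re (M $ k $ l) * Re (s q $ l) - Im (M $ k $ l) * Im (s q $ l))
     = (\<Sum>l\<in>UNIV. Re (M $ k $ l) * v (\<lambda>q. Re (s q $ l)) - Im (M $ k $ l) * v (\<lambda>q. Im (s q $ l)))" for k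
  proof -
    have "v (\<lambda>q. \<Sum>l\<in>UNIV. Re (M $ k $ l) * Re (s q $ l) + - Im (M $ k $ l) * Im (s q $ l))
     = (\<Sum>l\<in>UNIV. Re (M $ k $ l) * v (\<lambda>q. Re (s q $ l)) + - Im (M $ k $ l) * v (\<lambda>q. Im (s q $ l)))"
      by (subst tvec_sum[OF atlas v])
        (simp_all only: smooth_near_add[OF atlas] near tvec_add[OF atlas v] tvec_cmult[OF atlas v] spinor_nearD[OF s])
    then show ?thesis by simp
  qed
  have 2: "v (\<lambda>q. \<Sum>l\<in>UNIV. Re (M $ k $ l) * Im (s q $ l) + Im (M $ k $ l) * Re (s q $ l))
     = (\<Sum>l\<in>UNIV. Re (M $ k $ l) * v (\<lambda>q. Im (s q $ l)) + Im (M $ k $ l) * v (\<lambda>q. Re (s q $ l)))" for k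
    by (subst tvec_sum[OF atlas v])
      (simp_all only: smooth_near_add[OF atlas] near tvec_add[OF atlas v] tvec_cmult[OF atlas v] spinor_nearD[OF s])
  show ?thesis
    using 1 2 by (simp add: spinor_deriv_def vec_eq_iff complex_eq_iff matrix_vector_mult_def Re_sum Im_sum)
qed

end

locale gamma_module =
  fixes \<Gamma> :: "5 \<Rightarrow> complex^4^4"
  assumes gamma: "gamma_matrices \<Gamma>"

sublocale gamma_module \<subseteq> complex_clifford_module "\<lambda>a v. \<Gamma> a *v v" "\<lambda>v. \<i> *s v"
  by (rule gamma_clifford[OF gamma])

context gamma_module
begin

lemma slash_cl: "slash \<Gamma> x *v v = cl (\<lambda>a. x $ a) v"
  by (simp add: slash_def cl_def sum_matrix_vector_complex scaleR_matrix_vector_complex)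

lemma gamma2_cl2:
  assumes "\<And>a b. X a b = - X b a"
  shows "(\<Sum>a\<in>UNIV. \<Sum>b\<in>UNIV. X a b *\<^sub>R gamma2 \<Gamma> a b) *v v = cl2 X v"
proof -
  have "(\<Sum>a\<in>UNIV. \<Sum>b\<in>UNIV. X a b *\<^sub>R gamma2 \<Gamma> a b) *v v
     = (1/2) *\<^sub>R (cl2 X v - (\<Sum>a\<in>UNIV. \<Sum>b\<in>UNIV. X a b *\<^sub>R (\<Gamma> b *v (\<Gamma> a *v v))))"
    by (simp add: sum_matrix_vector_complex scaleR_matrix_vector_complex gamma2_def cl2_def
        matrix_vector_mult_diff_rdistrib matrix_vector_mul_assoc scaleR_diff_right sum_subtractf scaleR_sum_right
        mult.commute)
  also have "(\<Sum>a\<in>UNIV. \<Sum>b\<in>UNIV. X a b *\<^sub>R (\<Gamma> b *v (\<Gamma> a *v v))) = - cl2 X v"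
  proof -
    have "(\<Sum>a\<in>UNIV. \<Sum>b\<in>UNIV. X a b *\<^sub>R (\<Gamma> b *v (\<Gamma> a *v v))) = (\<Sum>b\<in>UNIV. \<Sum>a\<in>UNIV. X a b *\<^sub>R (\<Gamma> b *v (\<Gamma> a *v v)))"
      by (rule sum.swap)
    also have "\<dots> = - cl2 X v"
      unfolding cl2_def sum_negf[symmetric] by (intro sum.cong refl) (subst assms, simp)
    finally show ?thesis .
  qed
  finally show ?thesis by (simp flip: scaleR_2)
qed

text \<open>Each of the six orderings in \<open>gamma3\<close> is a relabelling of the summation
  indices, and the sign of the permutation is compensated by the skewness of
  \<open>X\<close>.\<close>

lemma gamma3_cl3:
  assumes X: "\<And>a b c. X a b c = - X b a c" "\<And>a b c. X a b c = - X a c b"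
  shows "(\<Sum>a\<in>UNIV. \<Sum>b\<in>UNIV. \<Sum>c\<in>UNIV. X a b c *\<^sub>R gamma3 \<Gamma> a b c) *v v = cl3 X v"
proof -
  let ?g = "\<lambda>a b c. \<Gamma> a *v (\<Gamma> b *v (\<Gamma> c *v v))"
  let ?S = "\<lambda>f :: 5 \<Rightarrow> 5 \<Rightarrow> 5 \<Rightarrow> complex^4. \<Sum>a\<in>UNIV. \<Sum>b\<in>UNIV. \<Sum>c\<in>UNIV. X a b c *\<^sub>R f a b c"
  have r: "?S (\<lambda>a b c. ?g b c a) = cl3 X v"
    "?S (\<lambda>a b c. ?g c a b) = cl3 X v"
  proof -
    have x: "X a b c = X b c a" "X a b c = X c a b" for a b c
      using X by metis+
    show "?S (\<lambda>a b c. ?g b c a) = cl3 X v"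
      unfolding cl3_def using sum3_rotate[of "\<lambda>b c a. X b c a *\<^sub>R ?g b c a"] by (simp add: x(1)[symmetric])
    show "?S (\<lambda>a b c. ?g c a b) = cl3 X v"
      unfolding cl3_def using sum3_rotate[of "\<lambda>a b c. X a b c *\<^sub>R ?g c a b", symmetric] by (simp add: x(1)[symmetric])
  qed
  have s: "?S (\<lambda>a b c. ?g b a c) = - cl3 X v"
  proof -
    have "?S (\<lambda>a b c. ?g b a c) = (\<Sum>b\<in>UNIV. \<Sum>a\<in>UNIV. \<Sum>c\<in>UNIV. X a b c *\<^sub>R ?g b a c)"
      by (rule sum.swap)
    also have "\<dots> = - cl3 X v"
      unfolding cl3_def sum_negf[symmetric] by (intro sum.cong refl) (subst X(1), simp)
    finally show ?thesis .
  qed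
  have t: "?S (\<lambda>a b c. ?g a c b) = - cl3 X v"
  proof -
    have "(\<Sum>b\<in>UNIV. \<Sum>c\<in>UNIV. X a b c *\<^sub>R ?g a c b) = (\<Sum>c\<in>UNIV. \<Sum>b\<in>UNIV. X a b c *\<^sub>R ?g a c b)" for a
      by (rule sum.swap)
    then show ?thesis
      unfolding cl3_def sum_negf[symmetric] by simp (intro sum.cong refl, subst X(2), simp)
  qed
  have u: "?S (\<lambda>a b c. ?g c b a) = - cl3 X v"
  proof -
    have "?S (\<lambda>a b c. ?g c b a) = (\<Sum>b\<in>UNIV. \<Sum>a\<in>UNIV. \<Sum>c\<in>UNIV. X a b c *\<^sub>R ?g c b a)"
      by (rule sum.swap)
    also have "\<dots> = - ?S (\<lambda>a b c. ?g c a b)"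
      unfolding sum_negf[symmetric] by (intro sum.cong refl) (subst X(1), simp)
    finally show ?thesis by (simp only: r)
  qed
  have "(\<Sum>a\<in>UNIV. \<Sum>b\<in>UNIV. \<Sum>c\<in>UNIV. X a b c *\<^sub>R gamma3 \<Gamma> a b c) *v v
    = (1/6) *\<^sub>R (cl3 X v + ?S (\<lambda>a b c. ?g b c a)
       + ?S (\<lambda>a b c. ?g c a b)
       - ?S (\<lambda>a b c. ?g b a c)
       - ?S (\<lambda>a b c. ?g a c b)
       - ?S (\<lambda>a b c. ?g c b a))"
    unfolding cl3_def sum.distrib[symmetric] sum_subtractf[symmetric] scaleR_sum_right sum_matrix_vector_complex
    by (intro sum.cong refl)
      (simp add: scaleR_matrix_vector_complex gamma3_def matrix_vector_mult_diff_rdistrib matrix_vector_mult_add_rdistrib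
        matrix_vector_mul_assoc matrix_mul_assoc algebra_simps)
  also have "\<dots> = (1/6) *\<^sub>R (6 *\<^sub>R cl3 X v)"
  proof -
    have "6 *\<^sub>R cl3 X v = (1 + 1 + 1 + 1 + 1 + 1) *\<^sub>R cl3 X v" by simp
    then have "6 *\<^sub>R cl3 X v = cl3 X v + cl3 X v + cl3 X v + cl3 X v + cl3 X v + cl3 X v"
      by (simp only: scaleR_add_left scaleR_one)
    then show ?thesis by (simp add: r s t u)
  qed
  finally show ?thesis by simp
qed

lemma spinor_deriv_cl:
  assumes atlas: "smooth_atlas A" and v: "v \<in> tspace A p" and s: "spinor_near A p s"
    and X: "\<And>a. smooth_near A p (\<lambda>q. X q a)"
  shows "spinor_deriv v (\<lambda>q. cl (X q) (s q)) = cl (\<lambda>a. v (\<lambda>q. X q a)) (s p) + cl (X p) (spinor_deriv v s)"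
  unfolding cl_def
  by (simp add: spinor_deriv_sum[OF atlas v] spinor_near_scale[OF atlas] spinor_near_matrix[OF atlas] s X
      spinor_deriv_scale[OF atlas v] spinor_deriv_matrix[OF atlas v] sum.distrib)

lemma spinor_deriv_cl2:
  assumes atlas: "smooth_atlas A" and v: "v \<in> tspace A p" and s: "spinor_near A p s"
    and X: "\<And>a b. smooth_near A p (\<lambda>q. X q a b)"
  shows "spinor_deriv v (\<lambda>q. cl2 (X q) (s q)) = cl2 (\<lambda>a b. v (\<lambda>q. X q a b)) (s p) + cl2 (X p) (spinor_deriv v s)"
  unfolding cl2_def
  by (simp add: spinor_deriv_sum[OF atlas v] spinor_near_sum[OF atlas] spinor_near_scale[OF atlas] spinor_near_matrix[OF atlas] s X
      spinor_deriv_scale[OF atlas v] spinor_deriv_matrix[OF atlas v] sum.distrib)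

lemma spinor_deriv_cl3:
  assumes atlas: "smooth_atlas A" and v: "v \<in> tspace A p" and s: "spinor_near A p s"
    and X: "\<And>a b c. smooth_near A p (\<lambda>q. X q a b c)"
  shows "spinor_deriv v (\<lambda>q. cl3 (X q) (s q)) = cl3 (\<lambda>a b c. v (\<lambda>q. X q a b c)) (s p) + cl3 (X p) (spinor_deriv v s)"
  unfolding cl3_def
  by (simp add: spinor_deriv_sum[OF atlas v] spinor_near_sum[OF atlas] spinor_near_scale[OF atlas] spinor_near_matrix[OF atlas] s X
      spinor_deriv_scale[OF atlas v] spinor_deriv_matrix[OF atlas v] sum.distrib)

end

section \<open>Killing spinors\<close>

text \<open>All fields on one open set with one frame, and the Killing equations at every point of
  it, so that they can be differentiated. In the end \<open>S\<close> is an overlap of a tangent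
  frame and a bundle frame.\<close>

locale killing_frame = orthonormal_frame A g S E W + gamma_module \<Gamma>
  for A :: "'p::topological_space chart set" and g S E W and \<Gamma> :: "5 \<Rightarrow> complex^4^4" +
  fixes H :: "'p \<Rightarrow> 'p tvec \<Rightarrow> 'p tvec \<Rightarrow> 'p tvec \<Rightarrow> real" and \<phi> :: "'p \<Rightarrow> real"
    and \<epsilon> :: "'p \<Rightarrow> complex^4" and \<xi> :: "'p vfield" and \<psi> :: "'p \<Rightarrow> 'p tvec \<Rightarrow> 'p tvec"
  assumes H_form: "three_form A H" and \<phi>_smooth: "smooth_fn A S \<phi>"
    and \<epsilon>_smooth: "smooth_fn A S \<epsilon>" and \<epsilon>_nz: "p \<in> S \<Longrightarrow> \<epsilon> p \<noteq> 0"
    and gravitino: "p \<in> S \<Longrightarrow> spinor_deriv (E m p) \<epsilon> +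
      (1/4) *\<^sub>R ((\<Sum>b\<in>UNIV. \<Sum>c\<in>UNIV. (W p (E m p) $ b $ c + H p (E m p) (E c p) (E b p) / 2) *\<^sub>R gamma2 \<Gamma> b c) *v \<epsilon> p) = 0"
    and dilatino: "p \<in> S \<Longrightarrow> ((\<Sum>m\<in>UNIV. (E m p \<phi>) *\<^sub>R \<Gamma> m)
         - (1/12) *\<^sub>R (\<Sum>m\<in>UNIV. \<Sum>n\<in>UNIV. \<Sum>q\<in>UNIV.
              H p (E m p) (E n p) (E q p) *\<^sub>R gamma3 \<Gamma> m n q)) *v \<epsilon> p = 0"
    and contact: "almost_contact_metric A g \<xi> \<psi>"
    and \<xi>_spinor: "p \<in> S \<Longrightarrow> cliff g \<Gamma> E p (\<xi> p) (\<epsilon> p) = \<i> *s \<epsilon> p"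
    and \<psi>_spinor: "p \<in> S \<Longrightarrow> X \<in> tspace A p \<Longrightarrow>
      (-2) *s cliff g \<Gamma> E p (\<psi> p X) (\<epsilon> p) + cliff g \<Gamma> E p (\<xi> p) (cliff g \<Gamma> E p X (\<epsilon> p))
        = \<i> *s cliff g \<Gamma> E p X (\<epsilon> p)"
begin

text \<open>The digit 0 marks frame components and 1 their derivatives along the frame, with the
  differentiating index first; together they are the entries of the jet at \<open>p\<close>.\<close>

definition w0 where "w0 p a s b = W p (E a p) $ s $ b"
definition w1 where "w1 p c a s b = E c p (\<lambda>q. w0 q a s b)"
definition h0 where "h0 p a b c = H p (E a p) (E b p) (E c p)"
definition h1 where "h1 p d a b c = E d p (\<lambda>q. h0 q a b c)"
definition f0 where "f0 p a = E a p \<phi>"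
definition f1 where "f1 p a b = E a p (\<lambda>q. f0 q b)"

lemma cliff_cl: "cliff g \<Gamma> E p X s = \<i> *s cl (\<lambda>m. g p X (E m p)) s"
  by (simp add: cliff_def slash_cl)

lemma three_formD:
  assumes "u \<in> tspace A p" "v \<in> tspace A p"
  shows "tlinear A p (H p u v)"
    and "w \<in> tspace A p \<Longrightarrow> H p v u w = - H p u v w"
    and "w \<in> tspace A p \<Longrightarrow> H p u w v = - H p u v w"
proof -
  note f = H_form[unfolded three_form_def, THEN conjunct1, rule_format, OF assms]
  show "tlinear A p (H p u v)" by (rule f[THEN conjunct1])
  assume w: "w \<in> tspace A p"
  show "H p v u w = - H p u v w" by (rule bspec[OF f[THEN conjunct2] w, THEN conjunct1])
  show "H p u w v = - H p u v w" by (rule bspec[OF f[THEN conjunct2] w, THEN conjunct2])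
qed

lemma h0_skew:
  assumes "p \<in> S"
  shows "h0 p a b c = - h0 p b a c" "h0 p a b c = - h0 p a c b"
  unfolding h0_def
  by (rule three_formD(2)[OF E_tspace[OF assms] E_tspace[OF assms] E_tspace[OF assms]],
      rule three_formD(3)[OF E_tspace[OF assms] E_tspace[OF assms] E_tspace[OF assms]])

lemma h0_near:
  assumes "p \<in> S"
  shows "smooth_near A p (\<lambda>q. h0 q a b c)"
proof -
  have "smooth_fn A S (\<lambda>q. h0 q a b c)"
    using H_form[unfolded three_form_def, THEN conjunct2, rule_format, of S "E a" "E b" "E c"] open_S E_smooth
    by (simp add: h0_def)
  then show ?thesis by (rule smooth_nearI[OF atlas open_S assms])
qed

lemma h1_skew:
  assumes p: "p \<in> S"
  shows "h1 p d a b c = - h1 p d b a c" "h1 p d a b c = - h1 p d a c b"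
proof -
  have neg: "E d p (\<lambda>q. - 1 * h0 q a b c) = - 1 * h1 p d a b c" for a b c
    unfolding h1_def by (rule tvec_cmult[OF atlas E_tspace[OF p] h0_near[OF p]])
  have "h1 p d b a c = E d p (\<lambda>q. - 1 * h0 q a b c)"
    unfolding h1_def by (rule tvec_cong[OF atlas E_tspace[OF p] open_S p]) (simp add: h0_skew(1)[of _ b a c])
  then show "h1 p d a b c = - h1 p d b a c" using neg[of a b c] by linarith
  have "h1 p d a c b = E d p (\<lambda>q. - 1 * h0 q a b c)"
    unfolding h1_def by (rule tvec_cong[OF atlas E_tspace[OF p] open_S p]) (simp add: h0_skew(2)[of _ a c b])
  then show "h1 p d a b c = - h1 p d a c b" using neg[of a b c] by linarith
qed

lemma w0_skew: "p \<in> S \<Longrightarrow> w0 p a s b = - w0 p a b s"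
  unfolding w0_def by (rule connection_skew[OF connection])

lemma w0_near: "p \<in> S \<Longrightarrow> smooth_near A p (\<lambda>q. w0 q a s b)"
  unfolding w0_def by (rule connection_smooth_near[OF connection])

lemma w1_skew: "p \<in> S \<Longrightarrow> w1 p c a s b = - w1 p c a b s"
  unfolding w0_def w1_def by (rule deriv_connection_skew[OF connection])

lemma f0_near: "p \<in> S \<Longrightarrow> smooth_near A p (\<lambda>q. f0 q a)"
  unfolding f0_def by (rule smooth_nearI[OF atlas open_S _ E_smooth_fn[OF open_S order_refl \<phi>_smooth]])

lemma \<epsilon>_near:
  assumes "p \<in> S"
  shows "spinor_near A p \<epsilon>"
proof -
  have "smooth_fn A S (\<lambda>q. Re (\<epsilon> q $ k))" "smooth_fn A S (\<lambda>q. Im (\<epsilon> q $ k))" for k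
    by (rule smooth_fn_linear[OF atlas open_S _ \<epsilon>_smooth],
        intro bounded_linear_compose[OF bounded_linear_Re bounded_linear_vec_nth]
          bounded_linear_compose[OF bounded_linear_Im bounded_linear_vec_nth])+
  then show ?thesis
    unfolding spinor_near_def by (auto intro: smooth_nearI[OF atlas open_S assms])
qed

lemma torsion_jet:
  assumes p: "p \<in> S"
  shows "torsion_jet (w0 p) (w1 p) (h0 p) (h1 p)"
  by unfold_locales (rule w0_skew[OF p] w1_skew[OF p] h0_skew[OF p] h1_skew[OF p])+

lemma levi_civita_jet:
  assumes p: "p \<in> S"
  shows "levi_civita_jet (w0 p) (w1 p) (h0 p) (h1 p) (f0 p) (f1 p)"
proof -
  interpret J: torsion_jet "w0 p" "w1 p" "h0 p" "h1 p" "f0 p" "f1 p" by (rule torsion_jet[OF p])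
  have d: "E a p (\<lambda>q. W q (E b q) $ s $ c - W q (E c q) $ s $ b) = w1 p a b s c - w1 p a c s b" for a b c s
    unfolding w1_def w0_def
    by (rule tvec_diff[OF atlas E_tspace[OF p]]) (rule connection_smooth_near[OF connection p])+
  show ?thesis
  proof unfold_locales
    show "J.curv a b s c + J.curv b c s a + J.curv c a s b = 0" for a b s c
      unfolding J.curv_cyclic using jacobi[OF p, where a = a and b = b and c = c and s = s]
      unfolding d J.bracket_def w0_def by simp
    show "f1 p a b - f1 p b a = (\<Sum>s\<in>UNIV. J.bracket a b s * f0 p s)" for a b
      unfolding f1_def f0_def J.bracket_def w0_def
      by (rule bracket_apply[OF p smooth_nearI[OF atlas open_S p \<phi>_smooth]])
  qed
qed

lemma contact_spinor:
  assumes p: "p \<in> S"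
  shows "contact_spinor (\<lambda>a v. \<Gamma> a *v v) (\<lambda>v. \<i> *s v) (\<epsilon> p) (\<lambda>a. g p (\<xi> p) (E a p)) (frame_endo g E \<psi> p)"
proof unfold_locales
  let ?J = "\<lambda>v::complex^4. \<i> *s v" and ?\<xi> = "\<lambda>a. g p (\<xi> p) (E a p)"
  have J_inj: "x = y" if "?J x = ?J y" for x y
    using that by (simp add: vec_eq_iff)
  show "\<epsilon> p \<noteq> 0" by (rule \<epsilon>_nz[OF p])
  show x: "cl ?\<xi> (\<epsilon> p) = \<epsilon> p"
    by (rule J_inj) (use \<xi>_spinor[OF p] in \<open>simp add: cliff_cl\<close>)
  show "?J (cl (\<lambda>s. frame_endo g E \<psi> p s n) (\<epsilon> p)) = \<Gamma> n *v \<epsilon> p - ?\<xi> n *\<^sub>R \<epsilon> p" for n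
  proof -
    have En: "cl (\<lambda>m. g p (E n p) (E m p)) v = \<Gamma> n *v v" for v
      by (simp add: cl_def orthonormal[OF p] if_distrib[of "\<lambda>r. r *\<^sub>R _"] cong: if_cong)
    have two: "(- 2) *s x = - (x + x)" for x :: "complex^4"
      by (simp add: vec_eq_iff)
    define y where "y = ?J (cl (\<lambda>s. frame_endo g E \<psi> p s n) (\<epsilon> p))"
    have "- (y + y) + ?J (cl ?\<xi> (?J (\<Gamma> n *v \<epsilon> p))) = ?J (?J (\<Gamma> n *v \<epsilon> p))"
      using \<psi>_spinor[OF p E_tspace[OF p, of n]]
      by (simp only: cliff_cl En two y_def frame_endo_def)
    then have e: "- (y + y) - cl ?\<xi> (\<Gamma> n *v \<epsilon> p) = - (\<Gamma> n *v \<epsilon> p)"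
      by (simp only: J_cl J_J linear_neg[OF linear_cl])
         (simp add: J_cl[symmetric] J_J)
    \<comment> \<open>Anticommuting \<xi> past \<open>E n\<close> gives a second copy of
      \<open>\<Gamma> n *v \<epsilon> p\<close> and twice the component of \<xi>, which matches the
      factor -2 in front of \<psi>.\<close>
    have c: "cl ?\<xi> (\<Gamma> n *v \<epsilon> p) = (2 * ?\<xi> n) *\<^sub>R \<epsilon> p - \<Gamma> n *v \<epsilon> p"
      using G_cl_anti[of n ?\<xi> "\<epsilon> p"] by (simp only: x eq_diff_eq add.commute)
    have "2 *\<^sub>R y = - (- (y + y) - cl ?\<xi> (\<Gamma> n *v \<epsilon> p)) - cl ?\<xi> (\<Gamma> n *v \<epsilon> p)"
      by (simp add: scaleR_2)
    also have "\<dots> = \<Gamma> n *v \<epsilon> p + \<Gamma> n *v \<epsilon> p - (2 * ?\<xi> n) *\<^sub>R \<epsilon> p"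
      unfolding e unfolding c by simp
    also have "\<dots> = 2 *\<^sub>R (\<Gamma> n *v \<epsilon> p - ?\<xi> n *\<^sub>R \<epsilon> p)"
      by (simp only: scaleR_diff_right scaleR_2[of "\<Gamma> n *v \<epsilon> p"] scaleR_scaleR)
    finally have "y = \<Gamma> n *v \<epsilon> p - ?\<xi> n *\<^sub>R \<epsilon> p"
      by simp
    then show ?thesis by (simp add: y_def)
  qed
qed

lemma killing_jet:
  assumes p: "p \<in> S"
  shows "killing_jet (\<lambda>a v. \<Gamma> a *v v) (\<lambda>v. \<i> *s v) (\<epsilon> p) (\<lambda>a. g p (\<xi> p) (E a p)) (frame_endo g E \<psi> p)
    (w0 p) (w1 p) (h0 p) (h1 p) (f0 p) (f1 p) (\<lambda>a. spinor_deriv (E a p) \<epsilon>)"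
proof -
  \<comment> \<open>The jet knows its coefficients at the single point \<open>p\<close>; to be
    differentiated they are defined on all of \<open>S\<close> first.\<close>
  define wp where "wp q a s b = w0 q a s b + h0 q a b s / 2" for q a s b
  have jet_wp: "torsion_jet.wp (w0 q) (h0 q) = wp q" if "q \<in> S" for q
  proof -
    interpret J: torsion_jet "w0 q" "w1 q" "h0 q" "h1 q" "f0 q" "f1 q" by (rule torsion_jet[OF that])
    show ?thesis by (intro ext) (simp add: J.wp_def wp_def)
  qed
  interpret C: contact_spinor "\<lambda>a v. \<Gamma> a *v v" "\<lambda>v. \<i> *s v" "\<epsilon> p" "\<lambda>a. g p (\<xi> p) (E a p)" "frame_endo g E \<psi> p"
    by (rule contact_spinor[OF p])
  interpret J: levi_civita_jet "w0 p" "w1 p" "h0 p" "h1 p" "f0 p" "f1 p"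
    by (rule levi_civita_jet[OF p])
  have grav: "spinor_deriv (E m q) \<epsilon> = - spin_act (wp q m) (\<epsilon> q)" if q: "q \<in> S" for q m
  proof -
    have skew: "wp q m b c = - wp q m c b" for b c
      using w0_skew[OF q, of m b c] h0_skew(2)[OF q, of m b c] by (simp add: wp_def)
    have "spinor_deriv (E m q) \<epsilon> + (1/4) *\<^sub>R ((\<Sum>b\<in>UNIV. \<Sum>c\<in>UNIV. wp q m b c *\<^sub>R gamma2 \<Gamma> b c) *v \<epsilon> q) = 0"
      using gravitino[OF q, of m] by (simp only: wp_def w0_def h0_def)
    then show ?thesis
      unfolding gamma2_cl2[of "wp q m", OF skew] spin_act_def by (simp add: eq_neg_iff_add_eq_0)
  qed
  have near: "smooth_near A p (\<lambda>q. wp q a s b)" for a s b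
  proof -
    have "smooth_near A p (\<lambda>q. w0 q a s b + (1/2) * h0 q a b s)"
      by (intro smooth_near_add[OF atlas] smooth_near_mult[OF atlas] smooth_near_const[OF atlas] w0_near[OF p] h0_near[OF p])
    then show ?thesis by (simp add: wp_def)
  qed
  have dwp: "E c p (\<lambda>q. wp q a s b) = J.dwp c a s b" for c a s b
  proof -
    note Et = E_tspace[OF p, of c]
    have "E c p (\<lambda>q. w0 q a s b + (1/2) * h0 q a b s) = E c p (\<lambda>q. w0 q a s b) + E c p (\<lambda>q. (1/2) * h0 q a b s)"
      by (intro tvec_add[OF atlas Et] smooth_near_mult[OF atlas] smooth_near_const[OF atlas] w0_near[OF p] h0_near[OF p])
    also have "E c p (\<lambda>q. (1/2) * h0 q a b s) = (1/2) * E c p (\<lambda>q. h0 q a b s)"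
      by (rule tvec_cmult[OF atlas Et h0_near[OF p]])
    finally have "E c p (\<lambda>q. w0 q a s b + (1/2) * h0 q a b s) = w1 p c a s b + (1/2) * h1 p c a b s"
      by (simp only: w1_def h1_def)
    then show ?thesis by (simp add: wp_def J.dwp_def)
  qed
  \<comment> \<open>The gravitino equation is used twice, hence the plus sign of the last term. The
    coefficients \<open>wp b\<close>, which get differentiated, stay outermost.\<close>
  have dd: "spinor_deriv (E a p) (\<lambda>q. spinor_deriv (E b q) \<epsilon>)
     = - spin_act (J.dwp a b) (\<epsilon> p) + spin_act (J.wp b) (spin_act (J.wp a) (\<epsilon> p))" for a b
  proof -
    have "spinor_deriv (E a p) (\<lambda>q. spinor_deriv (E b q) \<epsilon>) = spinor_deriv (E a p) (\<lambda>q. (- 1/4) *\<^sub>R cl2 (wp q b) (\<epsilon> q))"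
      by (rule spinor_deriv_cong[OF atlas E_tspace[OF p] open_S p]) (simp add: grav spin_act_def)
    also have "\<dots> = (- 1/4) *\<^sub>R spinor_deriv (E a p) (\<lambda>q. cl2 (wp q b) (\<epsilon> q))"
    proof -
      have "spinor_near A p (\<lambda>q. cl2 (wp q b) (\<epsilon> q))"
        unfolding cl2_def
        by (intro spinor_near_sum[OF atlas] spinor_near_scale[OF atlas] spinor_near_matrix[OF atlas] near \<epsilon>_near[OF p])
      from spinor_deriv_scale[OF atlas E_tspace[OF p] smooth_near_const[OF atlas] this, of a "- 1/4"]
      show ?thesis by (simp add: tvec_const[OF atlas E_tspace[OF p]])
    qed
    also have "spinor_deriv (E a p) (\<lambda>q. cl2 (wp q b) (\<epsilon> q)) = cl2 (\<lambda>s c. E a p (\<lambda>q. wp q b s c)) (\<epsilon> p) + cl2 (wp p b) (spinor_deriv (E a p) \<epsilon>)"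
      by (rule spinor_deriv_cl2[OF atlas E_tspace[OF p] \<epsilon>_near[OF p] near])
    finally show ?thesis
      by (simp add: dwp grav[OF p] jet_wp[OF p] spin_act_def cl2_simps scaleR_add_right scaleR_diff_right)
  qed
  have comm: "spinor_deriv (E a p) (\<lambda>q. spinor_deriv (E b q) \<epsilon>) - spinor_deriv (E b p) (\<lambda>q. spinor_deriv (E a q) \<epsilon>)
     = (\<Sum>s\<in>UNIV. J.bracket a b s *\<^sub>R spinor_deriv (E s p) \<epsilon>)" for a b
    using bracket_apply[OF p spinor_nearD(1)[OF \<epsilon>_near[OF p]], of a b]
      bracket_apply[OF p spinor_nearD(2)[OF \<epsilon>_near[OF p]], of a b]
    by (simp add: vec_eq_iff complex_eq_iff spinor_deriv_def sum_component Re_sum Im_sum J.bracket_def w0_def)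
  show ?thesis
  proof unfold_locales
    show "spinor_deriv (E a p) \<epsilon> = - spin_act (J.wp a) (\<epsilon> p)" for a
      by (simp add: grav[OF p] jet_wp[OF p])
    \<comment> \<open>The commutator of two derivatives of \<epsilon> is computed once by
      \<open>dd\<close> and once through the Lie bracket in \<open>comm\<close>; the two results
      differ by the curvature acting on \<epsilon>.\<close>
    show "cl2 (J.curvp a b) (\<epsilon> p) = 0" for a b
    proof -
      have sum: "(\<Sum>s\<in>UNIV. J.bracket a b s *\<^sub>R spin_act (J.wp s) (\<epsilon> p))
         = spin_act (\<lambda>s c. \<Sum>t\<in>UNIV. J.bracket a b t * J.wp t s c) (\<epsilon> p)"
        by (simp add: spin_act_def cl2_vec_sum scaleR_sum_right mult.commute)
      have com: "spin_act (J.wp a) (spin_act (J.wp b) (\<epsilon> p)) - spin_act (J.wp b) (spin_act (J.wp a) (\<epsilon> p))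
         = spin_act (\<lambda>s c. \<Sum>t\<in>UNIV. J.wp a s t * J.wp b t c - J.wp b s t * J.wp a t c) (\<epsilon> p)"
        by (rule spin_act_commutator[OF J.wp_skew])
      have "spin_act (J.curvp a b) (\<epsilon> p) = spin_act (J.dwp a b) (\<epsilon> p) - spin_act (J.dwp b a) (\<epsilon> p)
         - spin_act (\<lambda>s c. \<Sum>t\<in>UNIV. J.bracket a b t * J.wp t s c) (\<epsilon> p)
         + spin_act (\<lambda>s c. \<Sum>t\<in>UNIV. J.wp a s t * J.wp b t c - J.wp b s t * J.wp a t c) (\<epsilon> p)"
        by (simp add: J.curvp_def[abs_def] spin_act_def cl2_vec_add cl2_vec_diff scaleR_add_right scaleR_diff_right)
      also have "\<dots> = 0"
        using comm[of a b] unfolding dd com[symmetric] sum[symmetric]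
        by (simp add: grav[OF p] jet_wp[OF p] sum_negf algebra_simps)
      finally show ?thesis by (simp add: spin_act_def)
    qed
    have dil: "cl (f0 q) (\<epsilon> q) = (1/12) *\<^sub>R cl3 (h0 q) (\<epsilon> q)" if q: "q \<in> S" for q
    proof -
      have 1: "(\<Sum>m\<in>UNIV. f0 q m *\<^sub>R \<Gamma> m) *v \<epsilon> q = cl (f0 q) (\<epsilon> q)"
        by (simp add: cl_def sum_matrix_vector_complex scaleR_matrix_vector_complex)
      have 2: "(\<Sum>a\<in>UNIV. \<Sum>b\<in>UNIV. \<Sum>c\<in>UNIV. h0 q a b c *\<^sub>R gamma3 \<Gamma> a b c) *v \<epsilon> q = cl3 (h0 q) (\<epsilon> q)"
        by (rule gamma3_cl3) (rule h0_skew[OF q])+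
      show ?thesis
        using dilatino[OF q]
        by (simp add: f0_def[symmetric] h0_def[symmetric] matrix_vector_mult_diff_rdistrib scaleR_matrix_vector_complex 1 2)
    qed
    show "cl (f0 p) (\<epsilon> p) = (1/12) *\<^sub>R cl3 (h0 p) (\<epsilon> p)" by (rule dil[OF p])
    show "cl (f1 p a) (\<epsilon> p) + cl (f0 p) (spinor_deriv (E a p) \<epsilon>)
       = (1/12) *\<^sub>R (cl3 (h1 p a) (\<epsilon> p) + cl3 (h0 p) (spinor_deriv (E a p) \<epsilon>))" for a
    proof -
      have "cl (f1 p a) (\<epsilon> p) + cl (f0 p) (spinor_deriv (E a p) \<epsilon>) = spinor_deriv (E a p) (\<lambda>q. cl (f0 q) (\<epsilon> q))"
        by (subst spinor_deriv_cl[OF atlas E_tspace[OF p] \<epsilon>_near[OF p] f0_near[OF p]])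
          (simp add: f1_def[abs_def])
      also have "\<dots> = spinor_deriv (E a p) (\<lambda>q. (1/12) *\<^sub>R cl3 (h0 q) (\<epsilon> q))"
        by (rule spinor_deriv_cong[OF atlas E_tspace[OF p] open_S p]) (rule dil)
      also have "\<dots> = (1/12) *\<^sub>R spinor_deriv (E a p) (\<lambda>q. cl3 (h0 q) (\<epsilon> q))"
      proof -
        have "spinor_near A p (\<lambda>q. cl3 (h0 q) (\<epsilon> q))"
          unfolding cl3_def
          by (intro spinor_near_sum[OF atlas] spinor_near_scale[OF atlas] spinor_near_matrix[OF atlas] h0_near[OF p] \<epsilon>_near[OF p])
        from spinor_deriv_scale[OF atlas E_tspace[OF p] smooth_near_const[OF atlas] this, of a "1/12"]
        show ?thesis by (simp add: tvec_const[OF atlas E_tspace[OF p]])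
      qed
      also have "spinor_deriv (E a p) (\<lambda>q. cl3 (h0 q) (\<epsilon> q)) = cl3 (h1 p a) (\<epsilon> p) + cl3 (h0 p) (spinor_deriv (E a p) \<epsilon>)"
        by (subst spinor_deriv_cl3[OF atlas E_tspace[OF p] \<epsilon>_near[OF p] h0_near[OF p]])
          (simp add: h1_def[abs_def])
      finally show ?thesis .
    qed
  qed
qed

end

section \<open>Trace contractions\<close>

context killing_frame
begin

lemma H_bracket:
  assumes p: "p \<in> S"
  shows "H p (lie_bracket A (E a) (E b) p) (E c p) (E d p)
    = (\<Sum>s\<in>UNIV. (W p (E a p) $ s $ b - W p (E b p) $ s $ a) * h0 p s c d)"
proof -
  note Et = E_tspace[OF p]
  have L: "lie_bracket A (E a) (E b) p \<in> tspace A p"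
    unfolding torsion_free[OF p] by (rule tspace_sum[OF atlas]) (rule Et)
  \<comment> \<open>\<open>three_form\<close> provides linearity in the last argument, so the
    bracket is rotated there before it is expanded.\<close>
  have rot: "H p v (E c p) (E d p) = H p (E c p) (E d p) v" if v: "v \<in> tspace A p" for v
    using three_formD(2)[OF v Et[of c] Et[of d]] three_formD(3)[OF Et[of c] v Et[of d]] by simp
  have "H p (lie_bracket A (E a) (E b) p) (E c p) (E d p)
     = H p (E c p) (E d p) (\<lambda>f. \<Sum>s\<in>UNIV. (W p (E a p) $ s $ b - W p (E b p) $ s $ a) * E s p f)"
    using rot[OF L] by (simp only: torsion_free[OF p])
  also have "\<dots> = (\<Sum>s\<in>UNIV. (W p (E a p) $ s $ b - W p (E b p) $ s $ a) *\<^sub>R H p (E c p) (E d p) (E s p))"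
    by (rule tlinear_sum[OF atlas three_formD(1)[OF Et Et] Et])
  finally show ?thesis
    by (simp add: h0_def rot[OF Et])
qed

lemma frame_endo_fundamental:
  assumes p: "p \<in> S"
  shows "fundamental_form g \<psi> p (E t p) (E r p) = frame_endo g E \<psi> p t r"
proof -
  have "\<psi> p (E r p) \<in> tspace A p"
    using contact E_tspace[OF p] unfolding almost_contact_metric_def by blast
  then have "g p (E t p) (\<psi> p (E r p)) = g p (\<psi> p (E r p)) (E t p)"
    using metric E_tspace[OF p] unfolding riemannian_metric_def by blast
  then show ?thesis by (simp add: fundamental_form_def frame_endo_def)
qed

lemma einstein_eq_ext_deriv:
  assumes p: "p \<in> S"
  shows "ricci A E W p m n
      - (1/4) * (\<Sum>s\<in>UNIV. \<Sum>t\<in>UNIV. H p (E m p) (E s p) (E t p) * H p (E n p) (E s p) (E t p))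
      + 2 * hessian E W \<phi> p m n
    = - (\<Sum>s\<in>UNIV. \<Sum>t\<in>UNIV. \<Sum>r\<in>UNIV. ext_deriv3 A H (E m) (E s) (E t) (E r) p
        * frame_endo g E \<psi> p t r * frame_endo g E \<psi> p s n) / 4"
proof -
  interpret K: killing_jet "\<lambda>a v. \<Gamma> a *v v" "\<lambda>v. \<i> *s v" "\<epsilon> p" "\<lambda>a. g p (\<xi> p) (E a p)" "frame_endo g E \<psi> p"
    "w0 p" "w1 p" "h0 p" "h1 p" "f0 p" "f1 p" "\<lambda>a. spinor_deriv (E a p) \<epsilon>"
    by (rule killing_jet[OF p])
  have ric: "ricci A E W p m n = (\<Sum>k\<in>UNIV. K.curv k m k n)"
    unfolding ricci_def curv_comp_def K.curv_def K.bracket_def w0_def w1_def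
    by (intro sum.cong refl) (rule curvature_component[OF connection p])
  have hess: "hessian E W \<phi> p m n = K.hess m n"
    by (simp add: hessian_def K.hess_def f0_def f1_def w0_def)
  have ext: "ext_deriv3 A H (E m) (E s) (E t) (E r) p = K.d_H m s t r" for s t r
    unfolding K.d_H_bracket ext_deriv3_def H_bracket[OF p] K.bracket_def h1_def
    unfolding h0_def w0_def by simp
  show ?thesis
    unfolding ric hess ext K.einstein_eq_d_H[symmetric] K.einstein_def
    by (simp add: h0_def)
qed

lemma gaugino_instanton:
  assumes p: "p \<in> S" and conn: "frame_connection A S w"
    and gaugino: "(\<Sum>m\<in>UNIV. \<Sum>n\<in>UNIV. curv_comp A E w p m n x y *\<^sub>R gamma2 \<Gamma> m n) *v \<epsilon> p = 0"
  shows "(\<Sum>c\<in>UNIV. \<Sum>d\<in>UNIV. frame_endo g E \<psi> p c a * frame_endo g E \<psi> p d b * curv_comp A E w p c d x y)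
      = curv_comp A E w p a b x y"
    and "(\<Sum>k\<in>UNIV. \<Sum>c\<in>UNIV. frame_endo g E \<psi> p c k * curv_comp A E w p k c x y) = 0"
proof -
  interpret C: contact_spinor "\<lambda>a v. \<Gamma> a *v v" "\<lambda>v. \<i> *s v" "\<epsilon> p" "\<lambda>a. g p (\<xi> p) (E a p)" "frame_endo g E \<psi> p"
    by (rule contact_spinor[OF p])
  have skew: "curv_comp A E w p a b x y = - curv_comp A E w p b a x y" for a b
    unfolding curv_comp_def by (rule curvature_skew_form[OF conn p])
  have "cl2 (\<lambda>a b. curv_comp A E w p a b x y) (\<epsilon> p) = 0"
    using gaugino by (simp only: gamma2_cl2[of "\<lambda>a b. curv_comp A E w p a b x y", OF skew])
  note inst = C.instanton_of_cl2[of "\<lambda>a b. curv_comp A E w p a b x y", OF skew this]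
  show "(\<Sum>c\<in>UNIV. \<Sum>d\<in>UNIV. frame_endo g E \<psi> p c a * frame_endo g E \<psi> p d b * curv_comp A E w p c d x y)
      = curv_comp A E w p a b x y"
    by (rule inst(1))
  show "(\<Sum>k\<in>UNIV. \<Sum>c\<in>UNIV. frame_endo g E \<psi> p c k * curv_comp A E w p k c x y) = 0"
    by (rule inst(2))
qed

end

section \<open>Sums over pairs of bundle indices\<close>

lemma sum_less_pairs:
  fixes f :: "'r::{finite,linorder} \<Rightarrow> 'r \<Rightarrow> real"
  assumes sym: "\<And>x y. f x y = f y x" and diag: "\<And>x. f x x = 0"
  shows "(\<Sum>x\<in>UNIV. \<Sum>y\<in>UNIV. f x y) = 2 * (\<Sum>(x, y)\<in>{(x, y). x < y}. f x y)"
proof -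
  have U: "UNIV = {(x, y). x < y} \<union> {(x, y). y < x} \<union> {(x, y). x = (y::'r)}"
    by auto
  have "(\<Sum>x\<in>UNIV. \<Sum>y\<in>UNIV. f x y) = (\<Sum>(x, y)\<in>UNIV. f x y)"
    by (simp add: sum.cartesian_product)
  also have "\<dots> = (\<Sum>(x, y)\<in>{(x, y). x < y}. f x y) + (\<Sum>(x, y)\<in>{(x, y). y < x}. f x y)
      + (\<Sum>(x, y)\<in>{(x, y). x = y}. f x y)"
    unfolding U by (subst sum.union_disjoint; (subst sum.union_disjoint)?) auto
  also have "(\<Sum>(x, y)\<in>{(x, y). x = y}. f x y) = 0"
    by (intro sum.neutral) (auto simp: diag)
  also have "(\<Sum>(x, y)\<in>{(x, y). y < x}. f x y) = (\<Sum>(x, y)\<in>{(x, y). x < y}. f x y)"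
    by (rule sum.reindex_bij_witness[of _ prod.swap prod.swap]) (auto simp: sym)
  finally show ?thesis by simp
qed

text \<open>One matrix \<open>P\<close> plays both parts, since in an orthonormal frame the
  components of \<open>F\<close> and of \<psi> coincide.\<close>

definition phi_contraction :: "('n::finite \<Rightarrow> 'n \<Rightarrow> real) \<Rightarrow> ('n \<Rightarrow> 'n \<Rightarrow> 'n \<Rightarrow> 'n \<Rightarrow> real) \<Rightarrow> 'n \<Rightarrow> 'n \<Rightarrow> real" where
  "phi_contraction P T m n = (\<Sum>s\<in>UNIV. \<Sum>t\<in>UNIV. \<Sum>r\<in>UNIV. T m s t r * P t r * P s n)"

lemma phi_contraction_sum:
  "phi_contraction P (\<lambda>a b c d. \<Sum>i\<in>I. T i a b c d) m n = (\<Sum>i\<in>I. phi_contraction P (T i) m n)"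
proof (induction I rule: infinite_finite_induct)
  case (insert i I)
  then show ?case
    by (simp add: phi_contraction_def distrib_right sum.distrib)
qed (simp_all add: phi_contraction_def)

lemma phi_contraction_diff:
  "phi_contraction P (\<lambda>a b c d. k * (T a b c d - T' a b c d)) m n
    = k * (phi_contraction P T m n - phi_contraction P T' m n)"
  by (simp add: phi_contraction_def left_diff_distrib right_diff_distrib sum_subtractf sum_distrib_left mult.assoc)

text \<open>For each pair \<open>x < y\<close> the curvature entry is a two-form to which
  \<open>asd_wedge_contraction\<close> applies. \<open>tr_wedge\<close> takes the transposed entry,
  but it occurs twice and the signs cancel.\<close>

lemma instanton_contraction:
  fixes R :: "'n::finite \<Rightarrow> 'n \<Rightarrow> 'r::{finite,linorder} \<Rightarrow> 'r \<Rightarrow> real"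
  assumes P: "\<And>a b. P a b = - P b a"
    and R: "\<And>a b x y. R a b x y = - R b a x y" "\<And>a b x y. R a b x y = - R a b y x"
    and inv: "\<And>a b x y. (\<Sum>c\<in>UNIV. \<Sum>d\<in>UNIV. P c a * P d b * R c d x y) = R a b x y"
    and tr: "\<And>x y. (\<Sum>k\<in>UNIV. \<Sum>c\<in>UNIV. P c k * R k c x y) = 0"
  shows "phi_contraction P (tr_wedge R) m n = 4 * curv_square R m n"
proof -
  have 1: "phi_contraction P (wedge22 (\<lambda>a b. R a b y x) (\<lambda>a b. R a b y x)) m n
     = 4 * (\<Sum>s\<in>UNIV. R m s x y * R n s x y)" for x y
    using asd_wedge_contraction[of P "\<lambda>a b. R a b y x", OF P R(1) inv tr, of m n]
    by (simp add: phi_contraction_def R(2)[of _ _ y x])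
  have "phi_contraction P (tr_wedge R) m n
     = (\<Sum>i\<in>{(x, y). x < y}. phi_contraction P (wedge22 (\<lambda>a b. R a b (snd i) (fst i)) (\<lambda>a b. R a b (snd i) (fst i))) m n)"
    unfolding phi_contraction_sum[symmetric]
    by (rule arg_cong[where f = "\<lambda>T. phi_contraction P T m n"]) (simp add: fun_eq_iff tr_wedge_def case_prod_beta)
  also have "\<dots> = (\<Sum>i\<in>{(x, y). x < y}. \<Sum>s\<in>UNIV. 4 * (R m s (fst i) (snd i) * R n s (fst i) (snd i)))"
    by (simp add: 1 sum_distrib_left)
  also have "\<dots> = 4 * curv_square R m n"
    unfolding curv_square_def sum_distrib_left by (subst sum.swap) (simp add: case_prod_beta)
  finally show ?thesis .
qed

text \<open>The full sum counts each pair of bundle indices twice, and \<open>wedge22\<close> of a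
  two-form with itself is twice the sum of the three products, so the first identity has no factor.
  In the second the factor 2 stays. With its coefficient 1/2, the quadratic identity therefore says
  that the contraction is four times \<open>curv_square\<close>.\<close>

lemma quadratic_sum_eq:
  fixes R :: "'n::finite \<Rightarrow> 'n \<Rightarrow> 'r::{finite,linorder} \<Rightarrow> 'r \<Rightarrow> real"
  assumes R: "\<And>a b x y. R a b x y = - R b a x y" "\<And>a b x y. R a b x y = - R a b y x"
  shows "(\<Sum>s\<in>UNIV. \<Sum>t\<in>UNIV. \<Sum>r\<in>UNIV. \<Sum>i\<in>UNIV. \<Sum>j\<in>UNIV.
            (R m s i j * R t r i j + R m t i j * R r s i j + R m r i j * R s t i j) * P t r * P s n)
      = phi_contraction P (tr_wedge R) m n"
    and "(\<Sum>s\<in>UNIV. \<Sum>t\<in>UNIV. \<Sum>r\<in>UNIV. R m s t r * R n s t r) = 2 * curv_square R m n"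
proof -
  have diag: "R a b x x = 0" for a b x using R(2)[of a b x x] by simp
  have pairs: "(\<Sum>i\<in>UNIV. \<Sum>j\<in>UNIV. R a b i j * R c d i j) = 2 * (\<Sum>(x, y)\<in>{(x, y). x < y}. R a b x y * R c d x y)" for a b c d
  proof (rule sum_less_pairs)
    show "R a b x y * R c d x y = R a b y x * R c d y x" for x y
      using R(2)[of a b x y] R(2)[of c d x y] by simp
  qed (simp add: diag)
  have w: "(\<Sum>i\<in>UNIV. \<Sum>j\<in>UNIV. R m s i j * R t r i j + R m t i j * R r s i j + R m r i j * R s t i j)
     = tr_wedge R m s t r" for s t r
  proof -
    have "(\<Sum>i\<in>UNIV. \<Sum>j\<in>UNIV. R m s i j * R t r i j + R m t i j * R r s i j + R m r i j * R s t i j)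
      = 2 * (\<Sum>(x, y)\<in>{(x, y). x < y}. R m s x y * R t r x y) + 2 * (\<Sum>(x, y)\<in>{(x, y). x < y}. R m t x y * R r s x y)
       + 2 * (\<Sum>(x, y)\<in>{(x, y). x < y}. R m r x y * R s t x y)"
      by (simp only: sum.distrib pairs)
    also have "\<dots> = (\<Sum>(x, y)\<in>{(x, y). x < y}. wedge22 (\<lambda>a b. R a b y x) (\<lambda>a b. R a b y x) m s t r)"
      unfolding sum_distrib_left sum.distrib[symmetric]
    proof (intro sum.cong refl, clarify)
      fix x y
      have k: "R a b y x = - R a b x y" for a b by (rule R(2))
      show "2 * (R m s x y * R t r x y) + 2 * (R m t x y * R r s x y) + 2 * (R m r x y * R s t x y)
        = wedge22 (\<lambda>a b. R a b y x) (\<lambda>a b. R a b y x) m s t r"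
        unfolding wedge22_def k using R(1)[of r s x y] by simp
    qed
    finally show ?thesis by (simp add: tr_wedge_def)
  qed
  show "(\<Sum>s\<in>UNIV. \<Sum>t\<in>UNIV. \<Sum>r\<in>UNIV. \<Sum>i\<in>UNIV. \<Sum>j\<in>UNIV.
            (R m s i j * R t r i j + R m t i j * R r s i j + R m r i j * R s t i j) * P t r * P s n)
      = phi_contraction P (tr_wedge R) m n"
    unfolding phi_contraction_def w[symmetric] sum_distrib_right ..
  show "(\<Sum>s\<in>UNIV. \<Sum>t\<in>UNIV. \<Sum>r\<in>UNIV. R m s t r * R n s t r) = 2 * curv_square R m n"
    unfolding pairs curv_square_def sum_distrib_left ..
qed

theorem theorem3p1:
  fixes A :: "'p::{t2_space,second_countable_topology} chart set"
    and g :: "'p \<Rightarrow> 'p tvec \<Rightarrow> 'p tvec \<Rightarrow> real"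
    and \<Gamma> :: "5 \<Rightarrow> complex^4^4"
    and U :: "'i \<Rightarrow> 'p set" and e :: "'i \<Rightarrow> 5 \<Rightarrow> 'p vfield" and S :: "'i \<Rightarrow> 'i \<Rightarrow> 'p \<Rightarrow> complex^4^4"
    and H :: "'p \<Rightarrow> 'p tvec \<Rightarrow> 'p tvec \<Rightarrow> 'p tvec \<Rightarrow> real"
    and \<phi> :: "'p \<Rightarrow> real"
    and \<epsilon> :: "'i \<Rightarrow> 'p \<Rightarrow> complex^4"
    and V :: "'j \<Rightarrow> 'p set" and \<tau> :: "'j \<Rightarrow> 'j \<Rightarrow> 'p \<Rightarrow> real^'r::{finite,linorder}^'r::{finite,linorder}"
    and \<omega>A :: "'j \<Rightarrow> 'p \<Rightarrow> 'p tvec \<Rightarrow> real^'r::{finite,linorder}^'r::{finite,linorder}"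
    and \<omega>g \<omega> :: "'i \<Rightarrow> 'p \<Rightarrow> 'p tvec \<Rightarrow> real^5^5"
    and \<xi> :: "'p vfield" and \<psi> :: "'p \<Rightarrow> 'p tvec \<Rightarrow> 'p tvec"
    and \<alpha> :: real
  assumes manifold: "smooth_atlas A" "riemannian_metric A g"
    and spin: "gamma_matrices \<Gamma>" "spin_structure A g \<Gamma> U e S"
    and fields: "three_form A H" "smooth_fn A UNIV \<phi>"
    and spinor: "spinor_field A U S \<epsilon>" "\<forall>i. \<forall>p\<in>U i. \<epsilon> i p \<noteq> 0"
    and levi_civita: "levi_civita A g U e \<omega>g"
    and gauge_bundle: "metric_bundle A V \<tau>" "metric_connection A V \<tau> \<omega>A"
    and tangent_connection: "metric_connection A U (frame_transition g e) \<omega>"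
    and alpha_pos: "\<alpha> > 0"
    and killing: "gravitino_eq \<Gamma> U e H \<omega>g \<epsilon>" "dilatino_eq \<Gamma> U e H \<phi> \<epsilon>" "gaugino_eq A \<Gamma> U e V \<omega>A \<epsilon>"
    and anomaly: "anomaly_cancellation A \<alpha> U e H \<omega> V \<omega>A"
    and contact: "determined_by_spinor A g \<Gamma> U e \<epsilon> \<xi> \<psi>"
  shows "(einstein_eq A \<alpha> U e \<omega>g H \<phi> \<omega> V \<omega>A \<longleftrightarrow> quadratic_identity A g U e \<omega> \<psi>) \<and>
         (instanton A g U e \<omega> \<psi> \<longrightarrow> quadratic_identity A g U e \<omega> \<psi>)"
proof -
  have frames: "orthonormal_frames A g U e"
    using spin(2) unfolding spin_structure_def by (elim conjE)
  have lc: "metric_connection A U (frame_transition g e) \<omega>g"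
    using levi_civita unfolding levi_civita_def by (elim conjE)
  have U_open: "open (U i)" and e_smooth: "smooth_vfield A (U i) (e i a)" for i a
    using frames unfolding orthonormal_frames_def by simp_all
  have V_open: "open (V j)" and V_cover: "(\<Union>j. V j) = UNIV" for j
    using gauge_bundle(1) unfolding metric_bundle_def by simp_all
  \<comment> \<open>The gaugino equation and anomaly cancellation relate a tangent frame to a bundle
    frame, so the argument runs on overlaps \<open>U i \<inter> V j\<close>.\<close>
  have frame: "killing_frame A g (U i \<inter> V j) (e i) (\<omega>g i) \<Gamma> H \<phi> (\<epsilon> i) \<xi> \<psi>" for i j
  proof unfold_locales
    show "smooth_atlas A" "riemannian_metric A g" "gamma_matrices \<Gamma>" "three_form A H"
      by fact+
    show "open (U i \<inter> V j)" using U_open V_open by blast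
    show "smooth_vfield A (U i \<inter> V j) (e i a)" for a
      by (rule smooth_vfield_subset[OF e_smooth]) simp
    show "g p (e i a p) (e i b p) = (if a = b then 1 else 0)" if "p \<in> U i \<inter> V j" for p a b
      using frames that unfolding orthonormal_frames_def by simp
    show "frame_connection A (U i \<inter> V j) (\<omega>g i)"
      by (rule metric_connection_frame[OF lc]) simp
    show "lie_bracket A (e i a) (e i b) p
      = (\<lambda>f. \<Sum>s\<in>UNIV. (\<omega>g i p (e i a p) $ s $ b - \<omega>g i p (e i b p) $ s $ a) * e i s p f)"
      if "p \<in> U i \<inter> V j" for p a b
      using levi_civita that unfolding levi_civita_def by simp
    show "smooth_fn A (U i \<inter> V j) \<phi>"
      by (rule smooth_fn_subset[OF manifold(1) fields(2)]) simp
    show "smooth_fn A (U i \<inter> V j) (\<epsilon> i)"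
      using spinor(1) smooth_fn_subset[OF manifold(1), of "U i" "\<epsilon> i" "U i \<inter> V j"]
      unfolding spinor_field_def by simp
    show "\<epsilon> i p \<noteq> 0" if "p \<in> U i \<inter> V j" for p
      using spinor(2) that by simp
    show "spinor_deriv (e i m p) (\<epsilon> i) + (1/4) *\<^sub>R ((\<Sum>b\<in>UNIV. \<Sum>c\<in>UNIV.
        (\<omega>g i p (e i m p) $ b $ c + H p (e i m p) (e i c p) (e i b p) / 2) *\<^sub>R gamma2 \<Gamma> b c) *v \<epsilon> i p) = 0"
      if "p \<in> U i \<inter> V j" for p m
      using killing(1) that unfolding gravitino_eq_def spin_nabla_def plus_connection_def by simp
    show "((\<Sum>m\<in>UNIV. e i m p \<phi> *\<^sub>R \<Gamma> m) - (1/12) *\<^sub>R (\<Sum>m\<in>UNIV. \<Sum>n\<in>UNIV. \<Sum>q\<in>UNIV.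
        H p (e i m p) (e i n p) (e i q p) *\<^sub>R gamma3 \<Gamma> m n q)) *v \<epsilon> i p = 0"
      if "p \<in> U i \<inter> V j" for p
      using killing(2) that unfolding dilatino_eq_def by simp
    show "almost_contact_metric A g \<xi> \<psi>"
      using contact unfolding determined_by_spinor_def by (elim conjE)
    show "cliff g \<Gamma> (e i) p (\<xi> p) (\<epsilon> i p) = \<i> *s \<epsilon> i p" if "p \<in> U i \<inter> V j" for p
      using contact that unfolding determined_by_spinor_def Let_def by simp
    show "(-2) *s cliff g \<Gamma> (e i) p (\<psi> p X) (\<epsilon> i p) + cliff g \<Gamma> (e i) p (\<xi> p) (cliff g \<Gamma> (e i) p X (\<epsilon> i p))
        = \<i> *s cliff g \<Gamma> (e i) p X (\<epsilon> i p)" if "p \<in> U i \<inter> V j" "X \<in> tspace A p" for p X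
      using contact that unfolding determined_by_spinor_def Let_def by simp
  qed
  define P where "P i p = frame_endo g (e i) \<psi> p" for i p
  define R where "R i p = curv_comp A (e i) (\<omega> i) p" for i p
  define FA where "FA i j p = curv_comp A (e i) (\<omega>A j) p" for i j p
  have P_skew: "P i p a b = - P i p b a" if "p \<in> U i \<inter> V j" for i j p a b
  proof -
    interpret killing_frame A g "U i \<inter> V j" "e i" "\<omega>g i" \<Gamma> H \<phi> "\<epsilon> i" \<xi> \<psi> by (rule frame)
    show ?thesis unfolding P_def by (rule contact_spinor.P_skew[OF contact_spinor[OF that]])
  qed
  have R_skew: "R i p a b x y = - R i p b a x y" "R i p a b x y = - R i p a b y x"
    if p: "p \<in> U i \<inter> V j" for i j p a b x y
  proof -
    interpret killing_frame A g "U i \<inter> V j" "e i" "\<omega>g i" \<Gamma> H \<phi> "\<epsilon> i" \<xi> \<psi> by (rule frame)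
    have conn: "frame_connection A (U i \<inter> V j) (\<omega> i)"
      by (rule metric_connection_frame[OF tangent_connection]) simp
    show "R i p a b x y = - R i p b a x y" "R i p a b x y = - R i p a b y x"
      unfolding R_def curv_comp_def
      by (rule curvature_skew_form[OF conn p] curvature_skew_endo[OF conn p])+
  qed
  have FA_contraction: "phi_contraction (P i p) (tr_wedge (FA i j p)) m n = 4 * curv_square (FA i j p) m n"
    if p: "p \<in> U i \<inter> V j" for i j p m n
  proof -
    interpret killing_frame A g "U i \<inter> V j" "e i" "\<omega>g i" \<Gamma> H \<phi> "\<epsilon> i" \<xi> \<psi> by (rule frame)
    have conn: "frame_connection A (U i \<inter> V j) (\<omega>A j)"
      by (rule metric_connection_frame[OF gauge_bundle(2)]) simp
    have gaugino: "(\<Sum>m\<in>UNIV. \<Sum>n\<in>UNIV. curv_comp A (e i) (\<omega>A j) p m n x y *\<^sub>R gamma2 \<Gamma> m n) *v \<epsilon> i p = 0" for x y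
      using killing(3) p unfolding gaugino_eq_def by simp
    show ?thesis
    proof (rule instanton_contraction)
      show "P i p a b = - P i p b a" for a b by (rule P_skew[OF p])
      show "FA i j p a b x y = - FA i j p b a x y" "FA i j p a b x y = - FA i j p a b y x" for a b x y
        unfolding FA_def curv_comp_def
        by (rule curvature_skew_form[OF conn p] curvature_skew_endo[OF conn p])+
    qed (unfold P_def FA_def, (rule gaugino_instanton[OF p conn gaugino])+)
  qed
  have einstein_lhs: "ricci A (e i) (\<omega>g i) p a b
        - (1/4) * (\<Sum>m\<in>UNIV. \<Sum>n\<in>UNIV. H p (e i a p) (e i m p) (e i n p) * H p (e i b p) (e i m p) (e i n p))
        + 2 * hessian (e i) (\<omega>g i) \<phi> p a b
      = - (\<alpha> / 4 * (phi_contraction (P i p) (tr_wedge (R i p)) a b - 4 * curv_square (FA i j p) a b)) / 4"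
    if p: "p \<in> U i \<inter> V j" for i j p a b
  proof -
    interpret killing_frame A g "U i \<inter> V j" "e i" "\<omega>g i" \<Gamma> H \<phi> "\<epsilon> i" \<xi> \<psi> by (rule frame)
    have anom: "ext_deriv3 A H (e i a) (e i b) (e i c) (e i d) p
        = \<alpha> / 4 * (tr_wedge (R i p) a b c d - tr_wedge (FA i j p) a b c d)" for a b c d
      using anomaly p unfolding anomaly_cancellation_def R_def FA_def by simp
    show ?thesis
      unfolding einstein_eq_ext_deriv[OF p] anom P_def[symmetric] FA_contraction[OF p, symmetric]
        phi_contraction_diff[symmetric]
      by (simp only: phi_contraction_def)
  qed
  have einstein_iff: "einstein_eq A \<alpha> U e \<omega>g H \<phi> \<omega> V \<omega>A \<longleftrightarrow>
     (\<forall>i j. \<forall>p\<in>U i \<inter> V j. \<forall>a b. phi_contraction (P i p) (tr_wedge (R i p)) a b = 4 * curv_square (R i p) a b)"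
  proof -
    \<comment> \<open>Here \<open>x\<close> is the contraction of \<open>Tr (R \<and> R)\<close>,
      while \<open>y\<close> and \<open>z\<close> are the squares of \<open>F^A\<close> and
      \<open>R\<close>. The gauge term \<open>y\<close> cancels, and what remains can be divided by
      the positive \<alpha>.\<close>
    have key: "- (\<alpha> / 4 * (x - 4 * y)) / 4 - \<alpha> / 4 * (y - z) = 0 \<longleftrightarrow> x = 4 * z" for x y z :: real
    proof -
      have "- (\<alpha> / 4 * (x - 4 * y)) / 4 - \<alpha> / 4 * (y - z) = \<alpha> / 16 * (4 * z - x)"
        by (simp add: field_simps)
      moreover have "\<alpha> / 16 * (4 * z - x) = 0 \<longleftrightarrow> x = 4 * z"
        using alpha_pos by auto
      ultimately show ?thesis by (simp only:)
    qed
    show ?thesis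
      unfolding einstein_eq_def R_def[symmetric] FA_def[symmetric]
      by (simp only: einstein_lhs key cong: ball_cong)
  qed
  have quadratic_iff: "quadratic_identity A g U e \<omega> \<psi> \<longleftrightarrow>
     (\<forall>i j. \<forall>p\<in>U i \<inter> V j. \<forall>a b. phi_contraction (P i p) (tr_wedge (R i p)) a b = 4 * curv_square (R i p) a b)"
  proof -
    have key: "((1/2) * (\<Sum>s\<in>UNIV. \<Sum>t\<in>UNIV. \<Sum>r\<in>UNIV. \<Sum>k\<in>UNIV. \<Sum>l\<in>UNIV.
            (R i p m s k l * R i p t r k l + R i p m t k l * R i p r s k l + R i p m r k l * R i p s t k l)
              * fundamental_form g \<psi> p (e i t p) (e i r p) * P i p s n)
        = (\<Sum>s\<in>UNIV. \<Sum>t\<in>UNIV. \<Sum>r\<in>UNIV. R i p m s t r * R i p n s t r)) \<longleftrightarrow>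
       phi_contraction (P i p) (tr_wedge (R i p)) m n = 4 * curv_square (R i p) m n"
      if p: "p \<in> U i \<inter> V j" for i j p m n
    proof -
      interpret killing_frame A g "U i \<inter> V j" "e i" "\<omega>g i" \<Gamma> H \<phi> "\<epsilon> i" \<xi> \<psi> by (rule frame)
      show ?thesis
        unfolding frame_endo_fundamental[OF p] P_def[symmetric]
          quadratic_sum_eq[of "R i p", OF R_skew[OF p]] by auto
    qed
    show ?thesis
    proof (intro iffI allI ballI)
      fix i j p a b
      assume q: "quadratic_identity A g U e \<omega> \<psi>" and p: "p \<in> U i \<inter> V j"
      have "p \<in> U i" using p by simp
      from q[unfolded quadratic_identity_def Let_def, folded R_def P_def, rule_format, OF this]
      show "phi_contraction (P i p) (tr_wedge (R i p)) a b = 4 * curv_square (R i p) a b"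
        by (rule iffD1[OF key[OF p]])
    next
      assume q: "\<forall>i j. \<forall>p\<in>U i \<inter> V j. \<forall>a b. phi_contraction (P i p) (tr_wedge (R i p)) a b = 4 * curv_square (R i p) a b"
      show "quadratic_identity A g U e \<omega> \<psi>"
        unfolding quadratic_identity_def Let_def R_def[symmetric] P_def[symmetric]
      proof (intro allI ballI)
        fix i p m n assume "p \<in> U i"
        \<comment> \<open>The quadratic identity mentions no bundle frame, but the equivalence
          \<open>key\<close> is available only on overlaps; as \<open>V\<close> covers the manifold,
          some \<open>j\<close> can be chosen.\<close>
        moreover have "p \<in> (\<Union>j. V j)" by (simp only: V_cover UNIV_I)
        then obtain j where "p \<in> V j" by auto
        ultimately have p: "p \<in> U i \<inter> V j" by simp
        show "(1/2) * (\<Sum>s\<in>UNIV. \<Sum>t\<in>UNIV. \<Sum>r\<in>UNIV. \<Sum>k\<in>UNIV. \<Sum>l\<in>UNIV.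
            (R i p m s k l * R i p t r k l + R i p m t k l * R i p r s k l + R i p m r k l * R i p s t k l)
              * fundamental_form g \<psi> p (e i t p) (e i r p) * P i p s n)
          = (\<Sum>s\<in>UNIV. \<Sum>t\<in>UNIV. \<Sum>r\<in>UNIV. R i p m s t r * R i p n s t r)"
          by (rule iffD2[OF key[OF p] q[rule_format, OF p]])
      qed
    qed
  qed
  have "quadratic_identity A g U e \<omega> \<psi>" if inst: "instanton A g U e \<omega> \<psi>"
    unfolding quadratic_iff
  proof (intro allI ballI)
    fix i j p a b assume p: "p \<in> U i \<inter> V j"
    show "phi_contraction (P i p) (tr_wedge (R i p)) a b = 4 * curv_square (R i p) a b"
    proof (rule instanton_contraction)
      show "P i p a b = - P i p b a" for a b by (rule P_skew[OF p])
      show "R i p a b x y = - R i p b a x y" "R i p a b x y = - R i p a b y x" for a b x y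
        by (rule R_skew[OF p])+
    qed (use inst p in \<open>simp_all add: instanton_def Let_def P_def R_def\<close>)
  qed
  then show ?thesis
    using einstein_iff quadratic_iff by blast
qed

end
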